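(* Let $\lambda$ and $\mathbf d$ be partitions of $n$, with corresponding nilpotent orbits $\mathcal O_\lambda$ and $\mathcal O_{\mathbf d}$ in $\mathfrak{sl}_n(\mathbb C)$. If $\mathcal O_{\mathbf d}\le\mathcal O_\lambda$, then $m_{\mathcal O_{\mathbf d}}\le m_{\mathcal O_\lambda}$; and if $\mathcal O_{\mathbf d}<\mathcal O_\lambda$, then $m_{\mathcal O_{\mathbf d}}<m_{\mathcal O_\lambda}$.
   Context: Let $G=SL_n(\mathbb C)$ with Borel subgroup $B$. $\mathcal O_\lambda$ is the nilpotent orbit in $\mathfrak{sl}_n(\mathbb C)$ with Jordan type $\lambda$. Write $\mathcal O_1\le\mathcal O_2$ (resp. $\mathcal O_1<\mathcal O_2$) if the closure of $\mathcal O_1$ is contained (resp. strictly contained) in the closure of $\mathcal O_2$. For a nilpotent orbit $\mathcal O$ and $X\in\mathcal O$, $m_{\mathcal O}=\dim B-\dim B_{G_X}$, where $G_X$ is the centralizer of $X$ in $G$ and $B_{G_X}$ is a Borel subgroup (maximal connected solvable subgroup) of $G_X$; it depends only on $\mathcal O$. *)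

theory Defs
  imports "HOL-Analysis.Analysis" "HOL-Algebra.Solvable_Groups"
begin

text \<open>
  Throughout, \<open>n = CARD('n)\<close>, and \<open>SL\<^sub>n(\<complex>)\<close> is treated as a complex Lie group: closures and
  connectedness refer to the classical topology on \<open>n \<times> n\<close> complex matrices, dimensions are
  dimensions of complex submanifolds.
\<close>

type_synonym 'n cmat = "complex ^ 'n ^ 'n"

section \<open>Dimension\<close>

text \<open>The matrix \<open>mat c ** A\<close> is the scalar multiple of \<open>A\<close> by \<open>c\<close>, so the second conjunct
  says that the (real) derivative is complex linear.\<close>

definition holomorphic_map_on :: "('n::finite cmat \<Rightarrow> 'n cmat) \<Rightarrow> 'n cmat set \<Rightarrow> bool" where
  "holomorphic_map_on f U \<longleftrightarrow>
     (\<forall>x\<in>U. \<exists>D. (f has_derivative D) (at x) \<and> (\<forall>c A. D (mat c ** A) = mat c ** D A))"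

text \<open>Adapted (slice) charts: around each point of \<open>M\<close> there are holomorphic coordinates of the
  ambient space \<open>\<complex>\<^bsup>n\<times>n\<^esup>\<close> in which \<open>M\<close> is the locus where all coordinates outside a
  set \<open>K\<close> of \<open>d\<close> indices vanish.\<close>

definition complex_submanifold :: "nat \<Rightarrow> 'n::finite cmat set \<Rightarrow> bool" where
  "complex_submanifold d M \<longleftrightarrow>
     (\<forall>p\<in>M. \<exists>U V \<Phi> \<Psi> (K :: ('n \<times> 'n) set).
        open U \<and> p \<in> U \<and> open V \<and> homeomorphism U V \<Phi> \<Psi> \<and>
        holomorphic_map_on \<Phi> U \<and> holomorphic_map_on \<Psi> V \<and> card K = d \<and>
        \<Phi> ` (M \<inter> U) = {A \<in> V. \<forall>i j. (i, j) \<notin> K \<longrightarrow> A $ i $ j = 0})"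

definition complex_dim :: "'n::finite cmat set \<Rightarrow> nat" where
  "complex_dim M = (THE d. complex_submanifold d M)"

section \<open>Borel subgroups and centralizers\<close>

definition SL :: "'n::finite cmat monoid" where
  "SL = \<lparr>carrier = {g. det g = 1}, mult = (**), one = mat 1\<rparr>"

definition conn_solvable_subgroup :: "'n::finite cmat set \<Rightarrow> 'n cmat set \<Rightarrow> bool" where
  "conn_solvable_subgroup H K \<longleftrightarrow>
     subgroup H (SL\<lparr>carrier := K\<rparr>) \<and> connected H \<and> solvable (SL\<lparr>carrier := H\<rparr>)"

text \<open>\<open>B\<close> is a Borel subgroup of the subgroup \<open>K\<close> of \<open>SL\<^sub>n(\<complex>)\<close>.\<close>

definition borel_subgroup :: "'n::finite cmat set \<Rightarrow> 'n cmat set \<Rightarrow> bool" where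
  "borel_subgroup B K \<longleftrightarrow>
     conn_solvable_subgroup B K \<and> (\<forall>H. conn_solvable_subgroup H K \<and> B \<subseteq> H \<longrightarrow> H = B)"

text \<open>The common dimension of all Borel subgroups of \<open>K\<close>.\<close>

definition borel_dim :: "'n::finite cmat set \<Rightarrow> nat" where
  "borel_dim K = (THE d. \<exists>B. borel_subgroup B K \<and> complex_dim B = d)"

definition SL_centralizer :: "'n::finite cmat \<Rightarrow> 'n cmat set" where
  "SL_centralizer X = {g \<in> carrier SL. g ** X = X ** g}"

section \<open>Nilpotent orbits\<close>

definition is_partition :: "nat \<Rightarrow> nat list \<Rightarrow> bool" where
  "is_partition n xs \<longleftrightarrow> sorted_wrt (\<ge>) xs \<and> (\<forall>x \<in> set xs. 0 < x) \<and> sum_list xs = n"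

text \<open>\<open>J\<close> is the block diagonal matrix of nilpotent Jordan blocks of sizes \<open>xs\<close>. As the index type
  carries no order, \<open>e\<close> names the basis: \<open>e (k, i)\<close> is position \<open>i\<close> of block \<open>k\<close>.\<close>

definition nilpotent_jordan_matrix :: "nat list \<Rightarrow> 'n::finite cmat \<Rightarrow> bool" where
  "nilpotent_jordan_matrix xs J \<longleftrightarrow>
     (\<exists>e :: nat \<times> nat \<Rightarrow> 'n.
        bij_betw e {(k, i). k < length xs \<and> i < xs ! k} UNIV \<and>
        (\<forall>k i l j. k < length xs \<and> i < xs ! k \<and> l < length xs \<and> j < xs ! l \<longrightarrow>
           J $ e (k, i) $ e (l, j) = (if k = l \<and> j = Suc i then 1 else 0)))"

definition has_jordan_type :: "'n::finite cmat \<Rightarrow> nat list \<Rightarrow> bool" where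
  "has_jordan_type X xs \<longleftrightarrow>
     (\<exists>J P :: 'n cmat. nilpotent_jordan_matrix xs J \<and> invertible P \<and>
        X = P ** J ** matrix_inv P)"

definition adjoint_orbit :: "'n::finite cmat \<Rightarrow> 'n cmat set" where
  "adjoint_orbit X = (\<lambda>g. g ** X ** matrix_inv g) ` carrier SL"

definition nilpotent_orbit :: "nat list \<Rightarrow> 'n::finite cmat set" where
  "nilpotent_orbit xs = (THE O1. \<exists>X. has_jordan_type X xs \<and> O1 = adjoint_orbit X)"

definition orbit_le :: "'n::finite cmat set \<Rightarrow> 'n cmat set \<Rightarrow> bool" where
  "orbit_le O1 O2 \<longleftrightarrow> closure O1 \<subseteq> closure O2"

definition orbit_less :: "'n::finite cmat set \<Rightarrow> 'n cmat set \<Rightarrow> bool" where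
  "orbit_less O1 O2 \<longleftrightarrow> closure O1 \<subset> closure O2"

text \<open>The value of \<open>dim B - dim B\<^sub>G\<^sub>X\<close>, which is the same for all \<open>X\<close> in the orbit.\<close>

definition m_orbit :: "'n::finite cmat set \<Rightarrow> int" where
  "m_orbit O1 = (THE m. \<exists>X\<in>O1.
     m = int (borel_dim (carrier SL :: 'n cmat set)) - int (borel_dim (SL_centralizer X)))"

end

theory Submission
  imports Defs "HOL-Computational_Algebra.Fundamental_Theorem_Algebra"
begin

text \<open>
  By the Lie-Kolchin theorem a connected solvable group \<open>H\<close> commuting with the nilpotent matrix \<open>X\<close>
  fixes a complete flag of \<open>ker X\<close> refining the filtration by \<open>ker X \<inter> im X\<^bsup>k\<^esup>\<close>. A Jordan basis of \<open>X\<close>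
  adapted to this flag puts \<open>H\<close> into the group of determinant-one elements of a fixed algebra of upper
  triangular block Toeplitz matrices. The identity components of the conjugates of that group are
  therefore exactly the Borel subgroups of the centralizer. If \<open>a\<^sub>1 \<ge> a\<^sub>2 \<ge> \<dots>\<close> is the conjugate
  partition, counting free entries gives them dimension \<open>a\<^sub>1 (a\<^sub>1 + 1) / 2 + (\<Sum>t. a\<^sub>t a\<^bsub>t+1\<^esub>) - 1\<close>.

  Semicontinuity of \<open>dim ker X\<^sup>i = a\<^sub>1 + \<dots> + a\<^sub>i\<close> turns the closure relation into dominance of the conjugate
  partitions, and summation by parts shows that the quadratic expression above is strictly monotone for
  dominance.
\<close>

section \<open>Matrices and determinants\<close>

lemma continuous_on_det [continuous_intros]:
  fixes f :: "'a::topological_space \<Rightarrow> 'n::finite cmat"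
  assumes "continuous_on S f"
  shows "continuous_on S (\<lambda>x. det (f x))"
  unfolding det_def by (intro continuous_intros assms)

lemma continuous_on_matrix_mult [continuous_intros]:
  fixes f g :: "'a::topological_space \<Rightarrow> 'n::finite cmat"
  assumes "continuous_on S f" "continuous_on S g"
  shows "continuous_on S (\<lambda>x. f x ** g x)"
  unfolding matrix_matrix_mult_def by (intro continuous_intros continuous_on_vec_lambda assms)

lemma continuous_on_matrix_vector_mult [continuous_intros]:
  fixes f :: "'a::topological_space \<Rightarrow> 'n::finite cmat" and g :: "'a \<Rightarrow> complex ^ 'n"
  assumes "continuous_on S f" "continuous_on S g"
  shows "continuous_on S (\<lambda>x. f x *v g x)"
  unfolding matrix_vector_mult_def by (intro continuous_intros continuous_on_vec_lambda assms)

lemma matrix_inv_mult [simp]: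
  fixes A :: "'n::finite cmat"
  assumes "det A \<noteq> 0"
  shows "A ** matrix_inv A = mat 1" "matrix_inv A ** A = mat 1"
  using assms invertible_det_nz[of A] unfolding invertible_def matrix_inv_def
  by (metis (mono_tags, lifting) someI_ex)+

lemma matrix_inv_unique:
  fixes A B :: "'n::finite cmat"
  assumes "A ** B = mat 1"
  shows "matrix_inv A = B"
  by (metis assms matrix_inv_mult(2) invertible_det_nz invertible_right_inverse matrix_mul_assoc
      matrix_mul_lid matrix_mul_rid)

lemma matrix_inv_cancel [simp]:
  fixes A B :: "'n::finite cmat"
  assumes "det A \<noteq> 0"
  shows "B ** A ** matrix_inv A = B" "B ** matrix_inv A ** A = B"
  using assms by (simp_all flip: matrix_mul_assoc)

lemma inj_matrix_vec_iff:
  fixes A :: "'n::finite cmat"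
  shows "inj ((*v) A) \<longleftrightarrow> det A \<noteq> 0"
  using det_nz_iff_inj_gen[of "(*v) A"] by simp

lemma det_matrix_inv:
  fixes A :: "'n::finite cmat"
  assumes "det A \<noteq> 0"
  shows "det (matrix_inv A) = inverse (det A)"
  by (metis assms det_I det_mul inverse_unique matrix_inv_mult(1))

lemma matrix_inv_vec [simp]:
  fixes A :: "'n::finite cmat"
  assumes "det A \<noteq> 0"
  shows "A *v (matrix_inv A *v x) = x" "matrix_inv A *v (A *v x) = x"
  using assms by (simp_all add: matrix_vector_mul_assoc)

lemma matrix_inv_cramer:
  fixes A :: "'n::finite cmat"
  assumes "det A \<noteq> 0"
  shows "matrix_inv A = (\<chi> k j. det (\<chi> i l. if l = k then axis j 1 $ i else A $ i $ l) / det A)"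
proof -
  have "matrix_inv A *v axis j 1 = (\<chi> k. det (\<chi> i l. if l = k then axis j 1 $ i else A $ i $ l) / det A)" for j
    using cramer[OF assms, of "matrix_inv A *v axis j 1" "axis j 1"] assms by simp
  then have "(matrix_inv A *v axis j 1) $ k = det (\<chi> i l. if l = k then axis j 1 $ i else A $ i $ l) / det A" for j k
    by simp
  then show ?thesis
    by (simp add: vec_eq_iff matrix_vector_mult_def axis_def if_distrib sum.delta' cong: if_cong)
qed

lemma continuous_on_matrix_inv:
  "continuous_on {A :: 'n::finite cmat. det A \<noteq> 0} matrix_inv"
proof -
  have "continuous_on {A :: 'n cmat. det A \<noteq> 0}
     (\<lambda>A. \<chi> k j. det (\<chi> i l. if l = k then axis j 1 $ i else A $ i $ l) / det A)"
  proof (intro continuous_on_vec_lambda continuous_on_divide continuous_on_det continuous_on_id ballI)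
    fix i j k l :: 'n
    show "continuous_on {A :: 'n cmat. det A \<noteq> 0} (\<lambda>A. if l = k then axis j 1 $ i else A $ i $ l)"
      by (cases "l = k") (auto intro!: continuous_intros)
  qed auto
  then show ?thesis
    by (rule continuous_on_eq) (simp add: matrix_inv_cramer)
qed

lemma vec_subspace_imp_subspace:
  fixes W :: "(complex ^ 'n) set"
  assumes "vec.subspace W"
  shows "subspace W"
proof -
  have "c *\<^sub>R x = complex_of_real c *s x" for c and x :: "complex ^ 'n"
    by (simp add: vec_eq_iff scaleR_conv_of_real[where 'a = complex])
  then show ?thesis
    using assms unfolding subspace_def vec.subspace_def by metis
qed

lemma closed_vec_subspace:
  fixes W :: "(complex ^ 'n::finite) set"
  shows "vec.subspace W \<Longrightarrow> closed W"
  by (simp add: closed_subspace vec_subspace_imp_subspace)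

lemma vec_linear_relation:
  fixes w :: "'i \<Rightarrow> complex ^ 'n::finite"
  assumes "finite I" "w ` I \<subseteq> S" "vec.dim S < card I"
  shows "\<exists>c. (\<exists>i\<in>I. c i \<noteq> 0) \<and> (\<Sum>i\<in>I. c i *s w i) = 0"
proof (cases "inj_on w I")
  case True
  then have "card (w ` I) = card I" by (rule card_image)
  then have "vec.dependent (w ` I)"
    using vec.independent_card_le_dim[of "w ` I" S] assms by force
  then obtain u where u: "\<exists>v\<in>w ` I. u v \<noteq> 0" "(\<Sum>v\<in>w ` I. u v *s v) = 0"
    using vec.dependent_finite[of "w ` I"] assms(1) by auto
  have "(\<Sum>i\<in>I. u (w i) *s w i) = 0"
    using u(2) by (simp add: sum.reindex[OF True])
  with u(1) show ?thesis by (intro exI[of _ "\<lambda>i. u (w i)"]) auto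
next
  case False
  then obtain i j where ij: "i \<in> I" "j \<in> I" "i \<noteq> j" "w i = w j" by (auto simp: inj_on_def)
  define c :: "'i \<Rightarrow> complex" where "c k = (if k = i then 1 else if k = j then -1 else 0)" for k
  have "(\<Sum>k\<in>I. c k *s w k) = (\<Sum>k\<in>I. (if k = i then w i else 0) - (if k = j then w j else 0))"
    using ij by (intro sum.cong) (auto simp: c_def)
  also have "\<dots> = 0" using ij assms(1) by (simp add: sum_subtractf)
  finally show ?thesis using ij by (intro exI[of _ c]) (auto simp: c_def)
qed

lemma matrix_image_subspace:
  fixes A :: "'n::finite cmat"
  assumes "det A \<noteq> 0" "vec.subspace W" "\<And>w. w \<in> W \<Longrightarrow> A *v w \<in> W"
  shows "(*v) A ` W = W"
proof (rule vec.subspace_dim_equal)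
  show "vec.subspace ((*v) A ` W)"
    using assms(2) matrix_vector_mul_linear_gen vec.linear_subspace_image by blast
  have "inj ((*v) A)" using assms(1) by (simp add: inj_matrix_vec_iff)
  then have "vec.dim ((*v) A ` W) = vec.dim W"
    by (intro vec.dim_image_eq) (auto intro: inj_on_subset)
  then show "vec.dim W \<le> vec.dim ((*v) A ` W)" by simp
qed (use assms in auto)

lemma matrix_inv_stable:
  fixes A :: "'n::finite cmat"
  assumes "det A \<noteq> 0" "vec.subspace W" "\<And>w. w \<in> W \<Longrightarrow> A *v w \<in> W" "w \<in> W"
  shows "matrix_inv A *v w \<in> W"
proof -
  obtain u where "u \<in> W" "w = A *v u" using matrix_image_subspace[OF assms(1-3)] assms(4) by blast
  then show ?thesis using assms(1) by simp
qed

section \<open>Eigenvalues on quotients\<close>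

lemma finite_roots_det:
  fixes A :: "'n::finite cmat"
  shows "finite {c. det (A - mat c) = 0}"
proof -
  define M :: "complex poly ^ 'n ^ 'n" where "M = (\<chi> i j. [: A $ i $ j, if i = j then -1 else 0 :])"
  have ev: "poly (det M) c = det (A - mat c)" for c
    unfolding det_def by (auto simp: poly_sum poly_prod M_def mat_def intro!: sum.cong prod.cong)
  obtain B where B: "B > 0" "\<And>x. norm (A *v x) \<le> norm x * B"
    using bounded_linear.pos_bounded[OF matrix_vector_mul_bounded_linear, of A] by auto
  have "det (A - mat (of_real (B + 1))) \<noteq> 0"
  proof
    assume "det (A - mat (of_real (B + 1))) = 0"
    then have "\<not> inj ((*v) (A - mat (of_real (B + 1))))" by (simp add: inj_matrix_vec_iff)
    then obtain x where x: "x \<noteq> 0" "(A - mat (of_real (B + 1))) *v x = 0"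
      by (auto simp: vec.linear_inj_iff_eq_0[OF matrix_vector_mul_linear_gen])
    have "mat (of_real (B + 1)) *v x = (B + 1) *\<^sub>R x"
      by (simp add: vec_eq_iff matrix_vector_mult_def mat_def if_distrib[of "\<lambda>a. a * _"] cong: if_cong)
         (simp add: scaleR_conv_of_real[where 'a = complex])
    with x have "A *v x = (B + 1) *\<^sub>R x" by (simp add: matrix_vector_mult_diff_rdistrib)
    with B(2)[of x] have "(B + 1) * norm x \<le> norm x * B" using B(1) by simp
    with x show False by (simp add: algebra_simps)
  qed
  then have "det M \<noteq> 0" using ev by fastforce
  then show ?thesis using poly_roots_finite[of "det M"] by (simp add: ev)
qed

lemma diff_mat_vec:
  fixes A :: "'n::finite cmat"
  shows "(A - mat c) *v x = A *v x - c *s x"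
  by (simp add: vec_eq_iff matrix_vector_mult_def mat_def left_diff_distrib sum_subtractf
      if_distrib[of "\<lambda>a. a * _"] cong: if_cong)

lemma subspace_quotient_eigenspace:
  fixes A :: "'n::finite cmat"
  assumes "vec.subspace W"
  shows "vec.subspace {w. A *v w - c *s w \<in> W}"
  using vec.linear_subspace_vimage[OF matrix_vector_mul_linear_gen assms, of "A - mat c"]
  by (simp add: diff_mat_vec vimage_def)

lemma finite_quotient_eigenvalues:
  fixes A :: "'n::finite cmat"
  assumes "vec.subspace W" "\<And>w. w \<in> W \<Longrightarrow> A *v w \<in> W"
  shows "finite {c. \<exists>v. v \<notin> W \<and> A *v v - c *s v \<in> W}"
proof (rule finite_subset[OF _ finite_roots_det[of A]], clarify, rule ccontr)
  fix c v assume v: "v \<notin> W" "A *v v - c *s v \<in> W" and det: "det (A - mat c) \<noteq> 0"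
  have "matrix_inv (A - mat c) *v ((A - mat c) *v v) \<in> W"
    using v assms
    by (intro matrix_inv_stable[OF det assms(1)]) (auto simp: diff_mat_vec intro!: vec.subspace_diff vec.subspace_scale)
  with v det show False by simp
qed

text \<open>Horner evaluation of \<open>p(A) u\<close>.\<close>

definition poly_mat_vec :: "'n::finite cmat \<Rightarrow> complex ^ 'n \<Rightarrow> complex poly \<Rightarrow> complex ^ 'n" where
  "poly_mat_vec A u p = fold_coeffs (\<lambda>a v. a *s u + A *v v) p 0"

lemma poly_mat_vec_0 [simp]: "poly_mat_vec A u 0 = 0"
  by (simp add: poly_mat_vec_def)

lemma poly_mat_vec_pCons [simp]:
  "poly_mat_vec A u (pCons a p) = a *s u + A *v poly_mat_vec A u p"
  by (cases "p = 0 \<and> a = 0") (auto simp: poly_mat_vec_def)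

lemma poly_mat_vec_add: "poly_mat_vec A u (p + q) = poly_mat_vec A u p + poly_mat_vec A u q"
  by (induction p q rule: poly_induct2)
     (auto simp: matrix_vector_right_distrib vec.scale_left_distrib algebra_simps)

lemma poly_mat_vec_smult: "poly_mat_vec A u (smult c p) = c *s poly_mat_vec A u p"
  by (induction p)
     (auto simp: matrix_vector_right_distrib vec.scale_right_distrib vector_scalar_commute)

lemma poly_mat_vec_stable:
  assumes "vec.subspace W" "\<And>w. w \<in> W \<Longrightarrow> A *v w \<in> W" "u \<in> W"
  shows "poly_mat_vec A u p \<in> W"
  by (induction p) (use assms in \<open>auto intro!: vec.subspace_add vec.subspace_scale vec.subspace_0\<close>)

lemma quotient_eigenvector:
  fixes A :: "'n::finite cmat"
  assumes W: "vec.subspace W" "\<And>w. w \<in> W \<Longrightarrow> A *v w \<in> W"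
    and W': "vec.subspace W'" and u: "u \<in> W" "u \<notin> W'"
  shows "\<exists>v\<in>W. v \<notin> W' \<and> (\<exists>c. A *v v - c *s v \<in> W')"
proof -
  define E where "E = poly_mat_vec A u"
  have "\<exists>p. p \<noteq> 0 \<and> E p \<in> W'"
  proof -
    let ?w = "\<lambda>i. E (monom 1 i)"
    have "\<exists>c. (\<exists>i\<in>{..CARD('n)}. c i \<noteq> 0) \<and> (\<Sum>i\<in>{..CARD('n)}. c i *s ?w i) = 0"
      by (rule vec_linear_relation[where S = UNIV]) (auto simp: vec_dim_card simp del: vec.dim_UNIV)
    then obtain c where c: "\<exists>i\<le>CARD('n). c i \<noteq> 0" "(\<Sum>i\<le>CARD('n). c i *s ?w i) = 0" by auto
    define p where "p = (\<Sum>i\<le>CARD('n). monom (c i) i)"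
    have "E (sum f S) = (\<Sum>i\<in>S. E (f i))" if "finite S" for f and S :: "nat set"
      using that by (induction S) (auto simp: E_def poly_mat_vec_add)
    moreover have "E (monom a i) = a *s ?w i" for a i
      by (metis E_def poly_mat_vec_smult smult_monom mult.right_neutral)
    ultimately have "E p = (\<Sum>i\<le>CARD('n). c i *s ?w i)"
      unfolding p_def by (metis (no_types, lifting) finite_atMost sum.cong)
    then have "E p \<in> W'" using c W' vec.subspace_0 by simp
    moreover have "coeff p i = c i" if "i \<le> CARD('n)" for i
      using that by (simp add: p_def coeff_sum if_distrib cong: if_cong)
    then have "p \<noteq> 0" using c(1) by force
    ultimately show ?thesis by blast
  qed
  then obtain p where p: "p \<noteq> 0" "E p \<in> W'"
    and min: "\<And>q. q \<noteq> 0 \<Longrightarrow> E q \<in> W' \<Longrightarrow> degree p \<le> degree q"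
    using exists_least_iff[of "\<lambda>n. \<exists>p. p \<noteq> 0 \<and> E p \<in> W' \<and> degree p = n"]
    by (metis (no_types, lifting) leI)
  have "\<not> constant (poly p)"
  proof
    assume "constant (poly p)"
    then obtain a where a: "p = [:a:]" by (metis constant_degree degree_eq_zeroE)
    then have "inverse a *s (a *s u) \<in> W'"
      using p W' by (intro vec.subspace_scale[of W' "a *s u"]) (auto simp: E_def)
    moreover have "inverse a *s (a *s u) = u" using a p by (simp add: vec_eq_iff field_simps)
    ultimately show False using u by simp
  qed
  then obtain c where "poly p c = 0" using fundamental_theorem_of_algebra by blast
  then obtain q where q: "p = [:-c, 1:] * q" unfolding poly_eq_0_iff_dvd by (elim dvdE)
  have "q \<noteq> 0" using p q by auto
  then have "degree q < degree p" using q by (simp add: degree_mult_eq del: mult_pCons_left)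
  then have "E q \<notin> W'" using min \<open>q \<noteq> 0\<close> by fastforce
  moreover have "E p = A *v E q - c *s E q"
    by (simp add: q E_def poly_mat_vec_add poly_mat_vec_smult flip: add_uminus_conv_diff vec.scale_minus_left smult_minus_left)
  moreover have "E q \<in> W" unfolding E_def using W u(1) by (rule poly_mat_vec_stable)
  ultimately show ?thesis using p(2) by metis
qed

section \<open>The special linear group\<close>

lemma SL_simps [simp]:
  "carrier SL = {g. det g = 1}" "mult SL = (**)" "one SL = mat 1"
  by (simp_all add: SL_def)

lemma group_SL: "group (SL :: 'n::finite cmat monoid)"
proof (rule groupI)
  fix g :: "'n cmat" assume "g \<in> carrier SL"
  then show "\<exists>h\<in>carrier SL. h \<otimes>\<^bsub>SL\<^esub> g = \<one>\<^bsub>SL\<^esub>"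
    by (intro bexI[of _ "matrix_inv g"]) (auto simp: det_matrix_inv)
qed (auto simp: det_mul matrix_mul_assoc)

lemma inv_SL:
  assumes "det g = 1"
  shows "inv\<^bsub>SL\<^esub> g = matrix_inv g"
  using assms by (intro group.inv_equality[OF group_SL]) (auto simp: det_matrix_inv)

lemma subgroup_SL_iff:
  "subgroup H SL \<longleftrightarrow> mat 1 \<in> H \<and> (\<forall>g\<in>H. det g = 1 \<and> matrix_inv g \<in> H \<and> (\<forall>h\<in>H. g ** h \<in> H))"
proof
  assume "subgroup H SL"
  then interpret subgroup H SL .
  show "mat 1 \<in> H \<and> (\<forall>g\<in>H. det g = 1 \<and> matrix_inv g \<in> H \<and> (\<forall>h\<in>H. g ** h \<in> H))"
    using subset one_closed m_closed m_inv_closed by (auto simp: inv_SL[symmetric] subset_iff)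
next
  assume "mat 1 \<in> H \<and> (\<forall>g\<in>H. det g = 1 \<and> matrix_inv g \<in> H \<and> (\<forall>h\<in>H. g ** h \<in> H))"
  then show "subgroup H SL" by unfold_locales (auto simp: inv_SL)
qed

lemma subgroup_SL_subgroup:
  assumes "subgroup K SL"
  shows "subgroup H (SL\<lparr>carrier := K\<rparr>) \<longleftrightarrow> subgroup H SL \<and> H \<subseteq> K"
  using group.incl_subgroup[OF group_SL assms] group.subgroup_incl[OF group_SL _ assms] subgroup.subset
  by fastforce

lemma solvable_SL_iff:
  assumes "subgroup H (SL :: 'n::finite cmat monoid)"
  shows "solvable (SL\<lparr>carrier := H\<rparr>) \<longleftrightarrow> (\<exists>m. (derived SL ^^ m) H = {mat 1})"
proof -
  interpret H: group "SL\<lparr>carrier := H\<rparr>" using assms by (simp add: group.subgroup_imp_group[OF group_SL])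
  have "(derived (SL\<lparr>carrier := H\<rparr>) ^^ m) H = (derived SL ^^ m) H \<and> (derived SL ^^ m) H \<subseteq> H" for m
  proof (induction m)
    case (Suc m)
    then show ?case using group.derived_consistent[OF group_SL _ assms] group.derived_incl[OF group_SL _ assms] by simp
  qed simp
  then show ?thesis using H.solvable_iff_trivial_derived_seq by simp
qed

section \<open>The Lie-Kolchin theorem\<close>

lemma derived_subset:
  assumes "subgroup H (SL :: 'n::finite cmat monoid)"
  shows "derived SL H \<subseteq> H"
  using group.derived_incl[OF group_SL _ assms] by blast

lemma subgroup_derived:
  assumes "subgroup H (SL :: 'n::finite cmat monoid)"
  shows "subgroup (derived SL H) SL"
  using subgroup.subset[OF assms] by (rule group.derived_is_subgroup[OF group_SL])

lemma commutator_in_derived: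
  assumes "subgroup H (SL :: 'n::finite cmat monoid)" "g \<in> H" "h \<in> H"
  shows "g ** h ** matrix_inv g ** matrix_inv h \<in> derived SL H"
  unfolding derived_def using assms
  by (intro generate.incl) (force simp: inv_SL[symmetric] subgroup_SL_iff)

lemma connected_translate_component:
  assumes "subgroup D (SL :: 'n::finite cmat monoid)" "x \<in> D" "connected_component D (mat 1) y"
  shows "connected_component D x (x ** y)"
proof -
  obtain T where T: "connected T" "T \<subseteq> D" "mat 1 \<in> T" "y \<in> T"
    using assms(3) unfolding connected_component_def by auto
  have "connected ((\<lambda>t. x ** t) ` T)"
    by (intro connected_continuous_image T continuous_intros)
  moreover have "(\<lambda>t. x ** t) ` T \<subseteq> D" using T assms(1,2) by (auto simp: subgroup_SL_iff)
  moreover have "x \<in> (\<lambda>t. x ** t) ` T" using T(3) by force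
  ultimately show ?thesis using T(4) unfolding connected_component_def by blast
qed

lemma connected_derived:
  assumes H: "subgroup H (SL :: 'n::finite cmat monoid)" and "connected H"
  shows "connected (derived SL H)"
proof -
  let ?D = "derived SL H"
  have D: "subgroup ?D SL" by (rule subgroup_derived[OF H])
  have one: "mat 1 \<in> H" "mat 1 \<in> ?D" using H D by (auto simp: subgroup_SL_iff)
  have comm: "connected_component ?D (mat 1) (g ** h ** matrix_inv g ** matrix_inv h)" if "g \<in> H" "h \<in> H" for g h
  proof -
    let ?f = "\<lambda>g. g ** h ** matrix_inv g ** matrix_inv h"
    have "continuous_on H matrix_inv"
      using H by (intro continuous_on_subset[OF continuous_on_matrix_inv]) (auto simp: subgroup_SL_iff)
    then have "connected (?f ` H)"
      by (intro connected_continuous_image continuous_intros \<open>connected H\<close>)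
    moreover have "?f ` H \<subseteq> ?D" using commutator_in_derived[OF H] that by blast
    moreover have "?f (mat 1) = mat 1" using H that by (simp add: subgroup_SL_iff matrix_inv_unique[of "mat 1" "mat 1"])
    then have "mat 1 \<in> ?f ` H" using one(1) by force
    ultimately show ?thesis unfolding connected_component_def using that by blast
  qed
  have inv_comm: "matrix_inv (g ** h ** matrix_inv g ** matrix_inv h) = h ** g ** matrix_inv h ** matrix_inv g"
    if "g \<in> H" "h \<in> H" for g h
  proof (rule matrix_inv_unique)
    have gh: "det g = 1" "det h = 1" using H that by (auto simp: subgroup_SL_iff)
    have "g ** h ** matrix_inv g ** matrix_inv h ** (h ** g ** matrix_inv h ** matrix_inv g)
       = g ** h ** (matrix_inv g ** (matrix_inv h ** h) ** g) ** matrix_inv h ** matrix_inv g"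
      by (simp only: matrix_mul_assoc)
    also have "\<dots> = g ** (h ** matrix_inv h) ** matrix_inv g" using gh by (simp add: matrix_mul_assoc)
    finally show "g ** h ** matrix_inv g ** matrix_inv h ** (h ** g ** matrix_inv h ** matrix_inv g) = mat 1"
      using gh by simp
  qed
  have "connected_component ?D (mat 1) x" if "x \<in> ?D" for x
    using that unfolding derived_def
  proof (induction rule: generate.induct)
    case one
    then show ?case using \<open>mat 1 \<in> ?D\<close> by (simp add: derived_def)
  next
    case (incl x)
    then obtain g h where gh: "g \<in> H" "h \<in> H" "x = g ** h ** inv\<^bsub>SL\<^esub> g ** inv\<^bsub>SL\<^esub> h" by auto
    then have "x = g ** h ** matrix_inv g ** matrix_inv h" using H by (simp add: subgroup_SL_iff inv_SL)
    then show ?case using comm gh by (simp add: derived_def)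
  next
    case (inv x)
    then obtain g h where gh: "g \<in> H" "h \<in> H" "x = g ** h ** inv\<^bsub>SL\<^esub> g ** inv\<^bsub>SL\<^esub> h" by auto
    then have x: "x = g ** h ** matrix_inv g ** matrix_inv h" using H by (simp add: subgroup_SL_iff inv_SL)
    then have "x \<in> ?D" using commutator_in_derived[OF H] gh by blast
    then have "inv\<^bsub>SL\<^esub> x = matrix_inv x" using D by (simp add: subgroup_SL_iff inv_SL)
    then show ?case using comm[of h g] gh by (simp add: derived_def x inv_comm)
  next
    case (eng x y)
    have "x \<in> ?D" using eng(1) by (simp add: derived_def)
    then have "connected_component ?D x (x ** y)"
      using connected_translate_component[OF D] eng(4) by (simp add: derived_def)
    with eng(3) show ?case unfolding derived_def by (auto intro: connected_component_trans)
  qed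
  then show ?thesis
    unfolding connected_iff_connected_component
    by (meson connected_component_sym connected_component_trans)
qed

lemma connected_finite_closed_cover:
  assumes "connected H" "finite C" "\<And>c. closed (T c)" "H \<subseteq> (\<Union>c\<in>C. T c)"
    and "\<And>c c'. c \<noteq> c' \<Longrightarrow> H \<inter> T c \<inter> T c' = {}" and "x \<in> H" "x \<in> T a"
  shows "H \<subseteq> T a"
proof -
  let ?U = "\<Union>c\<in>C - {a}. T c"
  have 1: "closed ?U" using assms(2,3) by (intro closed_UN) auto
  have 2: "H \<subseteq> T a \<union> ?U" using assms(4) by auto
  have "T a \<inter> T c \<inter> H = {}" if "c \<in> C - {a}" for c using assms(5)[of a c] that by auto
  then have 3: "T a \<inter> ?U \<inter> H = {}" by auto
  have "T a \<inter> H = {} \<or> ?U \<inter> H = {}"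
    by (rule connected_closedD[OF assms(1) 3 2 assms(3) 1])
  then have "x \<notin> ?U" if "x \<in> H" for x using assms(6,7) that by (metis IntI empty_iff)
  then show ?thesis using 2 by (meson UnE subset_iff)
qed

definition stable :: "'n::finite cmat set \<Rightarrow> (complex ^ 'n) set \<Rightarrow> bool" where
  "stable H W \<longleftrightarrow> vec.subspace W \<and> (\<forall>h\<in>H. \<forall>w\<in>W. h *v w \<in> W)"

lemma stable_mono: "stable H W \<Longrightarrow> D \<subseteq> H \<Longrightarrow> stable D W"
  by (auto simp: stable_def)

lemma eigenvalue_constant:
  fixes H :: "'n::finite cmat set"
  assumes "connected H" "mat 1 \<in> H" "stable {h} W"
    and w: "\<And>g. g \<in> H \<Longrightarrow> g *v w \<notin> W"
    and ex: "\<And>g. g \<in> H \<Longrightarrow> \<exists>c. h *v (g *v w) - c *s (g *v w) \<in> W"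
    and a: "h *v w - a *s w \<in> W" and "g \<in> H"
  shows "h *v (g *v w) - a *s (g *v w) \<in> W"
proof -
  let ?C = "{c. \<exists>v. v \<notin> W \<and> h *v v - c *s v \<in> W}"
  let ?T = "\<lambda>c. {g. h *v (g *v w) - c *s (g *v w) \<in> W}"
  have W: "vec.subspace W" using assms(3) by (simp add: stable_def)
  have "H \<subseteq> ?T a"
  proof (rule connected_finite_closed_cover[where T = ?T and C = ?C, OF assms(1)])
    show "finite ?C" using assms(3) by (intro finite_quotient_eigenvalues) (auto simp: stable_def)
    have eq: "c *s v = (\<chi> i. c * v $ i)" for c and v :: "complex ^ 'n" by (simp add: vec_eq_iff)
    have "closed ((\<lambda>g. h *v (g *v w) - c *s (g *v w)) -` W)" for c
      unfolding eq
      by (intro closed_vimage closed_vec_subspace W continuous_intros continuous_on_vec_lambda)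
    then show "closed (?T c)" for c by (simp add: vimage_def)
    show "H \<subseteq> (\<Union>c\<in>?C. ?T c)" using w ex by blast
    show "mat 1 \<in> H" "mat 1 \<in> ?T a" using assms by auto
    show "H \<inter> ?T c \<inter> ?T c' = {}" if "c \<noteq> c'" for c c'
    proof (rule ccontr)
      assume "H \<inter> ?T c \<inter> ?T c' \<noteq> {}"
      then obtain g where g: "g \<in> H" "h *v (g *v w) - c *s (g *v w) \<in> W" "h *v (g *v w) - c' *s (g *v w) \<in> W" by auto
      have "inverse (c' - c) *s ((h *v (g *v w) - c *s (g *v w)) - (h *v (g *v w) - c' *s (g *v w))) \<in> W"
        using g W vec.subspace_diff vec.subspace_scale by blast
      moreover have "inverse (c' - c) *s ((h *v (g *v w) - c *s (g *v w)) - (h *v (g *v w) - c' *s (g *v w))) = g *v w"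
        using that by (simp add: vec_eq_iff flip: mult.assoc distrib_right left_diff_distrib right_diff_distrib)
      ultimately show False using w g(1) by metis
    qed
  qed
  then show ?thesis using \<open>g \<in> H\<close> by blast
qed

lemma minimal_stable:
  assumes "stable H W" "W' \<subset> W"
  obtains U where "stable H U" "W' \<subset> U" "U \<subseteq> W"
    "\<And>U'. stable H U' \<Longrightarrow> W' \<subset> U' \<Longrightarrow> U' \<subseteq> U \<Longrightarrow> U' = U"
proof -
  let ?P = "\<lambda>U. stable H U \<and> W' \<subset> U \<and> U \<subseteq> W"
  have "\<exists>U. ?P U \<and> (\<forall>U'. ?P U' \<longrightarrow> vec.dim U \<le> vec.dim U')"
    by (rule ex_has_least_nat[of ?P W]) (use assms in blast)
  then obtain U where U: "?P U" "\<And>U'. ?P U' \<Longrightarrow> vec.dim U \<le> vec.dim U'" by blast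
  have "U' = U" if "stable H U'" "W' \<subset> U'" "U' \<subseteq> U" for U'
  proof (rule vec.subspace_dim_equal)
    have "U' \<subseteq> W" using U(1) that(3) by (meson subset_trans)
    then show "vec.dim U \<le> vec.dim U'" using U(2)[of U'] that by (simp only: simp_thms)
  qed (use that U in \<open>auto simp: stable_def\<close>)
  with U(1) show thesis by (intro that[of U]) auto
qed

lemma scalar_action_on_minimal:
  fixes H :: "'n::finite cmat set"
  assumes "subgroup H SL" "connected H" "(derived SL ^^ m) H = {mat 1}"
    and "stable H W" "stable H W'" "W' \<subset> W"
    and "\<And>U. stable H U \<Longrightarrow> W' \<subset> U \<Longrightarrow> U \<subseteq> W \<Longrightarrow> U = W"
  shows "\<forall>h\<in>H. \<exists>c. \<forall>w\<in>W. h *v w - c *s w \<in> W'"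
  using assms
proof (induction m arbitrary: H W W')
  case 0
  then have "vec.subspace W'" "H = {mat 1}" by (auto simp: stable_def)
  then show ?case by (auto intro!: exI[of _ 1] simp: vec.subspace_0)
next
  case (Suc m)
  let ?D = "derived SL H"
  note H = Suc.prems(1)
  have DH: "?D \<subseteq> H" by (rule derived_subset[OF H])
  have W: "vec.subspace W" "vec.subspace W'"
    and st: "\<And>h w. h \<in> H \<Longrightarrow> w \<in> W \<Longrightarrow> h *v w \<in> W" "\<And>h w. h \<in> H \<Longrightarrow> w \<in> W' \<Longrightarrow> h *v w \<in> W'"
    using Suc.prems by (auto simp: stable_def)
  have det: "det h = 1" if "h \<in> H" for h using H that by (auto simp: subgroup_SL_iff)
  have inv: "matrix_inv h \<in> H" if "h \<in> H" for h using H that by (auto simp: subgroup_SL_iff)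
  have one: "mat 1 \<in> H" using H by (auto simp: subgroup_SL_iff)
  have out: "h *v w \<notin> W'" if "h \<in> H" "w \<notin> W'" for h w
    using st(2)[OF inv[OF that(1)], of "h *v w"] that det by auto
  obtain W2 where W2: "stable ?D W2" "W' \<subset> W2" "W2 \<subseteq> W"
    "\<And>U. stable ?D U \<Longrightarrow> W' \<subset> U \<Longrightarrow> U \<subseteq> W2 \<Longrightarrow> U = W2"
    using minimal_stable[OF stable_mono[OF Suc.prems(4) DH] Suc.prems(6)] by metis
  have "\<forall>h\<in>?D. \<exists>c. \<forall>w\<in>W2. h *v w - c *s w \<in> W'"
  proof (rule Suc.IH)
    show "(derived SL ^^ m) ?D = {mat 1}" using Suc.prems(3) by (simp add: funpow_swap1)
  qed (use Suc.prems W2 in \<open>auto intro: subgroup_derived connected_derived stable_mono[OF _ DH]\<close>)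
  then obtain \<mu> where \<mu>: "\<And>d w. d \<in> ?D \<Longrightarrow> w \<in> W2 \<Longrightarrow> d *v w - \<mu> d *s w \<in> W'" by metis
  obtain v where v: "v \<in> W2" "v \<notin> W'" using W2(2) by blast
  define U where "U = {w \<in> W. \<forall>d\<in>?D. d *v w - \<mu> d *s w \<in> W'}"
  have W'U: "W' \<subseteq> U"
    using Suc.prems(6) st(2) DH W(2) unfolding U_def
    by (auto intro!: vec.subspace_diff vec.subspace_scale)
  have "stable H U"
    unfolding stable_def
  proof (intro conjI ballI)
    show "vec.subspace U"
    proof -
      have "U = W \<inter> (\<Inter>d\<in>?D. {w. d *v w - \<mu> d *s w \<in> W'})" by (auto simp: U_def)
      then show ?thesis
        using W by (auto intro!: vec.subspace_inter vec.subspace_Inter subspace_quotient_eigenspace)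
    qed
  next
    fix h w assume h: "h \<in> H" and w: "w \<in> U"
    show "h *v w \<in> U"
    proof (cases "w \<in> W'")
      case True then show ?thesis using st(2) h W'U by blast
    next
      case False
      have "d *v (h *v w) - \<mu> d *s (h *v w) \<in> W'" if d: "d \<in> ?D" for d
      proof (rule eigenvalue_constant[OF Suc.prems(2) one _ out])
        show "stable {d} W'" using st(2) W(2) d DH by (auto simp: stable_def)
        show "d *v w - \<mu> d *s w \<in> W'" using w d by (simp add: U_def)
        fix g assume g: "g \<in> H"
        define d' where "d' = matrix_inv g ** d ** g"
        have dH: "d \<in> H" "det d = 1" using d DH det by auto
        have "matrix_inv d ** matrix_inv g ** matrix_inv (matrix_inv d) ** matrix_inv (matrix_inv g) \<in> ?D"
          using commutator_in_derived[OF H] inv g dH by blast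
        moreover have "matrix_inv (matrix_inv d) = d" "matrix_inv (matrix_inv g) = g"
          using det g dH by (simp_all add: matrix_inv_unique)
        ultimately have "d ** (matrix_inv d ** matrix_inv g ** d ** g) \<in> ?D"
          using subgroup_derived[OF H] d by (auto simp: subgroup_SL_iff)
        then have "d' \<in> ?D" using dH by (simp add: d'_def matrix_mul_assoc)
        then have "g *v (d' *v w - \<mu> d' *s w) \<in> W'" using w g st(2) by (auto simp: U_def)
        moreover have "g *v (d' *v w) = d *v (g *v w)"
          using det g by (simp add: d'_def matrix_vector_mul_assoc matrix_mul_assoc)
        ultimately have "d *v (g *v w) - \<mu> d' *s (g *v w) \<in> W'"
          by (simp add: matrix_vector_mult_diff_distrib vector_scalar_commute)
        then show "\<exists>c. d *v (g *v w) - c *s (g *v w) \<in> W'" by blast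
      qed (use h False in auto)
      then show ?thesis using st(1) h w by (auto simp: U_def)
    qed
  qed
  moreover have "v \<in> U" using v W2 \<mu> by (auto simp: U_def)
  ultimately have "U = W" using v W'U by (intro Suc.prems(7)) (auto simp: U_def)
  then have sc: "d *v w - \<mu> d *s w \<in> W'" if "d \<in> ?D" "w \<in> W" for d w using that by (auto simp: U_def)
  show ?case
  proof
    fix h assume h: "h \<in> H"
    obtain u where "u \<in> W" "u \<notin> W'" using Suc.prems(6) by blast
    then obtain u a where u: "u \<in> W" "u \<notin> W'" "h *v u - a *s u \<in> W'"
      using quotient_eigenvector[OF W(1) st(1)[OF h] W(2)] by metis
    define E where "E = {w \<in> W. h *v w - a *s w \<in> W'}"
    have W'E: "W' \<subseteq> E"
      using Suc.prems(6) st(2) h W(2) unfolding E_def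
      by (auto intro!: vec.subspace_diff vec.subspace_scale)
    have "stable H E"
      unfolding stable_def
    proof (intro conjI ballI)
      show "vec.subspace E"
      proof -
        have "E = W \<inter> {w. h *v w - a *s w \<in> W'}" by (auto simp: E_def)
        then show ?thesis using W by (auto intro!: vec.subspace_inter subspace_quotient_eigenspace)
      qed
    next
      fix g w assume g: "g \<in> H" and w: "w \<in> E"
      show "g *v w \<in> E"
      proof (cases "w \<in> W'")
        case True then show ?thesis using st(2) g W'E by blast
      next
        case False
        have "h *v (g *v w) - a *s (g *v w) \<in> W'"
        proof (rule eigenvalue_constant[OF Suc.prems(2) one _ out])
          show "stable {h} W'" using st(2) W(2) h by (auto simp: stable_def)
          show "h *v w - a *s w \<in> W'" using w by (simp add: E_def)
          fix g assume g: "g \<in> H"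
          define d where "d = matrix_inv h ** matrix_inv g ** h ** g"
          have "matrix_inv h ** matrix_inv g ** matrix_inv (matrix_inv h) ** matrix_inv (matrix_inv g) \<in> ?D"
            using commutator_in_derived[OF H] inv g h by blast
          moreover have "matrix_inv (matrix_inv h) = h" "matrix_inv (matrix_inv g) = g"
            using det g h by (simp_all add: matrix_inv_unique)
          ultimately have "d \<in> ?D" by (simp add: d_def)
          then have "d *v w - \<mu> d *s w \<in> W'" using sc w by (auto simp: E_def)
          then have "g *v (h *v (d *v w - \<mu> d *s w)) + \<mu> d *s (g *v (h *v w - a *s w)) \<in> W'"
            using st(2) g h w W(2) by (auto simp: E_def intro!: vec.subspace_add vec.subspace_scale)
          moreover have "g *v (h *v (d *v w)) = h *v (g *v w)"
          proof -
            have "g ** (h ** d) = g ** (h ** matrix_inv h) ** matrix_inv g ** h ** g"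
              by (simp add: d_def matrix_mul_assoc)
            also have "\<dots> = h ** g" using det g h by simp
            finally show ?thesis by (simp add: matrix_vector_mul_assoc)
          qed
          ultimately have "h *v (g *v w) - (\<mu> d * a) *s (g *v w) \<in> W'"
            by (simp add: matrix_vector_mult_diff_distrib vector_scalar_commute vec.scale_right_diff_distrib)
          then show "\<exists>c. h *v (g *v w) - c *s (g *v w) \<in> W'" by blast
        qed (use g False in auto)
        then show ?thesis using st(1) g w by (auto simp: E_def)
      qed
    qed
    then have "E = W" using u W'E by (intro Suc.prems(7)) (auto simp: E_def)
    then show "\<exists>c. \<forall>w\<in>W. h *v w - c *s w \<in> W'" by (auto simp: E_def)
  qed
qed

theorem Lie_Kolchin:
  fixes H :: "'n::finite cmat set"
  assumes "subgroup H SL" "connected H" "solvable (SL\<lparr>carrier := H\<rparr>)"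
    and "stable H W" "stable H W'" "W' \<subset> W"
  shows "\<exists>v\<in>W. v \<notin> W' \<and> (\<forall>h\<in>H. \<exists>c. h *v v - c *s v \<in> W')"
proof -
  obtain m where m: "(derived SL ^^ m) H = {mat 1}" using assms solvable_SL_iff by blast
  obtain U where U: "stable H U" "W' \<subset> U" "U \<subseteq> W" "\<And>U'. stable H U' \<Longrightarrow> W' \<subset> U' \<Longrightarrow> U' \<subseteq> U \<Longrightarrow> U' = U"
    using minimal_stable[OF assms(4,6)] by metis
  have "\<forall>h\<in>H. \<exists>c. \<forall>w\<in>U. h *v w - c *s w \<in> W'"
    by (rule scalar_action_on_minimal[OF assms(1,2) m U(1) assms(5) U(2,4)])
  then show ?thesis using U(2,3) by blast
qed

section \<open>Holomorphic maps and submanifolds\<close>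

definition holomorphic_fun_at :: "('n::finite cmat \<Rightarrow> complex) \<Rightarrow> 'n cmat \<Rightarrow> bool" where
  "holomorphic_fun_at f x \<longleftrightarrow> (\<exists>D. (f has_derivative D) (at x) \<and> (\<forall>c A. D (mat c ** A) = c * D A))"

lemma mat_mult_entry [simp]:
  fixes A :: "'n::finite cmat"
  shows "(mat c ** A) $ i $ j = c * A $ i $ j"
  by (simp add: matrix_matrix_mult_def mat_def if_distrib[of "\<lambda>a. a * _"] cong: if_cong)

lemma det_mat_mult:
  fixes A :: "'n::finite cmat"
  shows "det (mat c ** A) = c ^ CARD('n) * det A"
proof -
  have "det (mat c :: 'n cmat) = (\<Prod>i\<in>(UNIV :: 'n set). c)"
    by (subst det_diagonal) (auto simp: mat_def)
  then show ?thesis by (simp add: det_mul)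
qed

lemma holomorphic_fun_const: "holomorphic_fun_at (\<lambda>_. c) x"
  unfolding holomorphic_fun_at_def by (intro exI[of _ "\<lambda>_. 0"]) auto

lemma holomorphic_fun_entry: "holomorphic_fun_at (\<lambda>A. A $ i $ j) x"
  unfolding holomorphic_fun_at_def
  by (intro exI[of _ "\<lambda>A. A $ i $ j"])
     (auto intro!: bounded_linear_imp_has_derivative bounded_linear_compose[OF bounded_linear_vec_nth bounded_linear_vec_nth])

lemma holomorphic_fun_add:
  assumes "holomorphic_fun_at f x" "holomorphic_fun_at g x"
  shows "holomorphic_fun_at (\<lambda>x. f x + g x) x"
proof -
  obtain D D' where "(f has_derivative D) (at x)" "\<forall>c A. D (mat c ** A) = c * D A"
    "(g has_derivative D') (at x)" "\<forall>c A. D' (mat c ** A) = c * D' A"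
    using assms unfolding holomorphic_fun_at_def by blast
  then show ?thesis unfolding holomorphic_fun_at_def
    by (intro exI[of _ "\<lambda>h. D h + D' h"]) (auto intro!: derivative_eq_intros simp: algebra_simps)
qed

lemma holomorphic_fun_mult:
  assumes "holomorphic_fun_at f x" "holomorphic_fun_at g x"
  shows "holomorphic_fun_at (\<lambda>x. f x * g x) x"
proof -
  obtain D D' where "(f has_derivative D) (at x)" "\<forall>c A. D (mat c ** A) = c * D A"
    "(g has_derivative D') (at x)" "\<forall>c A. D' (mat c ** A) = c * D' A"
    using assms unfolding holomorphic_fun_at_def by blast
  then show ?thesis unfolding holomorphic_fun_at_def
    by (intro exI[of _ "\<lambda>h. f x * D' h + D h * g x"]) (auto intro!: derivative_eq_intros simp: algebra_simps)
qed

lemma holomorphic_fun_sum: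
  assumes "\<And>i. i \<in> I \<Longrightarrow> holomorphic_fun_at (f i) x"
  shows "holomorphic_fun_at (\<lambda>x. \<Sum>i\<in>I. f i x) x"
  using assms by (induction I rule: infinite_finite_induct)
    (auto intro: holomorphic_fun_const holomorphic_fun_add)

lemma holomorphic_fun_prod:
  assumes "\<And>i. i \<in> I \<Longrightarrow> holomorphic_fun_at (f i) x"
  shows "holomorphic_fun_at (\<lambda>x. \<Prod>i\<in>I. f i x) x"
  using assms by (induction I rule: infinite_finite_induct)
    (auto intro: holomorphic_fun_const holomorphic_fun_mult)

lemma holomorphic_fun_compose:
  assumes "holomorphic_fun_at f x" "(F has_field_derivative F') (at (f x))"
  shows "holomorphic_fun_at (\<lambda>x. F (f x)) x"
proof -
  obtain D where D: "(f has_derivative D) (at x)" "\<forall>c A. D (mat c ** A) = c * D A"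
    using assms unfolding holomorphic_fun_at_def by blast
  have "((\<lambda>x. F (f x)) has_derivative (\<lambda>h. F' * D h)) (at x)"
    using has_derivative_compose[OF D(1) assms(2)[unfolded has_field_derivative_def]] by simp
  then show ?thesis using D(2) unfolding holomorphic_fun_at_def
    by (intro exI[of _ "\<lambda>h. F' * D h"]) auto
qed

lemma holomorphic_fun_divide:
  assumes "holomorphic_fun_at f x" "holomorphic_fun_at g x" "g x \<noteq> 0"
  shows "holomorphic_fun_at (\<lambda>x. f x / g x) x"
proof -
  have "holomorphic_fun_at (\<lambda>x. inverse (g x)) x"
    using assms(2) by (rule holomorphic_fun_compose) (rule DERIV_inverse[OF assms(3)])
  from holomorphic_fun_mult[OF assms(1) this] show ?thesis by (simp add: divide_inverse)
qed

lemma holomorphic_fun_det: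
  fixes f :: "'n::finite cmat \<Rightarrow> 'n cmat"
  assumes "\<And>i j. holomorphic_fun_at (\<lambda>A. f A $ i $ j) x"
  shows "holomorphic_fun_at (\<lambda>A. det (f A)) x"
  unfolding det_def
  by (intro holomorphic_fun_sum holomorphic_fun_mult holomorphic_fun_prod holomorphic_fun_const assms)

lemma holomorphic_fun_linear:
  fixes f :: "'n::finite cmat \<Rightarrow> 'n cmat"
  assumes "linear f" "\<And>c A. f (mat c ** A) = mat c ** f A"
  shows "holomorphic_fun_at (\<lambda>A. f A $ i $ j) x"
proof -
  have "bounded_linear f" using assms(1) by (simp add: linear_conv_bounded_linear)
  then have "bounded_linear (\<lambda>A. f A $ i $ j)"
    using bounded_linear_compose[OF bounded_linear_vec_nth bounded_linear_compose[OF bounded_linear_vec_nth]] by blast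
  then show ?thesis unfolding holomorphic_fun_at_def
    by (intro exI[of _ "\<lambda>A. f A $ i $ j"]) (simp add: bounded_linear_imp_has_derivative assms(2))
qed

lemma has_derivative_matrix_componentwise:
  fixes f :: "'a::real_normed_vector \<Rightarrow> 'n::finite cmat"
  assumes "\<And>i j. ((\<lambda>x. f x $ i $ j) has_derivative (\<lambda>h. f' h $ i $ j)) (at x)"
  shows "(f has_derivative f') (at x)"
proof -
  have vec: "(g has_derivative g') (at x)" if "\<And>i. ((\<lambda>x. g x $ i) has_derivative (\<lambda>h. g' h $ i)) (at x)"
    for g g' :: "'a \<Rightarrow> 'b::real_normed_vector ^ 'n"
  proof -
    have "bounded_linear g'"
    proof -
      have bl: "bounded_linear (\<lambda>h. g' h $ i)" for i by (rule has_derivative_bounded_linear[OF that])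
      note lin = bounded_linear.linear[OF bl]
      have "\<forall>i. \<exists>B. \<forall>h. norm (g' h $ i) \<le> norm h * B" using bounded_linear.bounded[OF bl] by blast
      then obtain B where B: "\<And>i h. norm (g' h $ i) \<le> norm h * B i" by metis
      show ?thesis
      proof (rule bounded_linear_intro[where K = "\<Sum>i\<in>UNIV. B i"])
        show "g' (a + b) = g' a + g' b" for a b using linear_add[OF lin] by (simp add: vec_eq_iff)
        show "g' (r *\<^sub>R a) = r *\<^sub>R g' a" for r a using linear_scale[OF lin] by (simp add: vec_eq_iff)
        have "norm (g' h) \<le> (\<Sum>i\<in>UNIV. norm (g' h $ i))" for h by (simp add: norm_vec_def L2_set_le_sum)
        also have "(\<Sum>i\<in>UNIV. norm (g' h $ i)) \<le> norm h * (\<Sum>i\<in>UNIV. B i)" for h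
          unfolding sum_distrib_left by (intro sum_mono B)
        finally show "norm (g' h) \<le> norm h * (\<Sum>i\<in>UNIV. B i)" for h .
      qed
    qed
    moreover have "((\<lambda>y. (1 / norm (y - x)) *\<^sub>R (g y - (g x + g' (y - x)))) \<longlongrightarrow> 0) (at x)"
      using that by (intro vec_tendstoI) (simp add: has_derivative_within)
    ultimately show ?thesis by (simp add: has_derivative_within)
  qed
  show ?thesis by (intro vec assms)
qed

lemma holomorphic_map_onI:
  fixes f :: "'n::finite cmat \<Rightarrow> 'n cmat"
  assumes "\<And>x i j. x \<in> U \<Longrightarrow> holomorphic_fun_at (\<lambda>A. f A $ i $ j) x"
  shows "holomorphic_map_on f U"
  unfolding holomorphic_map_on_def
proof
  fix x assume "x \<in> U"
  then have "\<forall>i j. \<exists>D. ((\<lambda>A. f A $ i $ j) has_derivative D) (at x) \<and> (\<forall>c A. D (mat c ** A) = c * D A)"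
    using assms unfolding holomorphic_fun_at_def by blast
  then obtain D where D: "\<And>i j. ((\<lambda>A. f A $ i $ j) has_derivative D i j) (at x)"
    "\<And>i j c A. D i j (mat c ** A) = c * D i j A" by metis
  show "\<exists>D. (f has_derivative D) (at x) \<and> (\<forall>c A. D (mat c ** A) = mat c ** D A)"
    using D by (intro exI[of _ "\<lambda>h. \<chi> i j. D i j h"]) (auto intro!: has_derivative_matrix_componentwise simp: vec_eq_iff)
qed

lemma holomorphic_map_imp_continuous_on: "holomorphic_map_on f U \<Longrightarrow> continuous_on U f"
  unfolding holomorphic_map_on_def
  by (meson continuous_at_imp_continuous_on has_derivative_continuous)

lemma holomorphic_map_compose:
  assumes "holomorphic_map_on f U" "holomorphic_map_on g V" "f ` U \<subseteq> V"
  shows "holomorphic_map_on (\<lambda>x. g (f x)) U"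
  unfolding holomorphic_map_on_def
proof
  fix x assume x: "x \<in> U"
  then obtain D where D: "(f has_derivative D) (at x)" "\<forall>c A. D (mat c ** A) = mat c ** D A"
    using assms by (auto simp: holomorphic_map_on_def)
  obtain D' where D': "(g has_derivative D') (at (f x))" "\<forall>c A. D' (mat c ** A) = mat c ** D' A"
    using assms x unfolding holomorphic_map_on_def by blast
  have "((\<lambda>x. g (f x)) has_derivative (\<lambda>h. D' (D h))) (at x)" by (rule has_derivative_compose[OF D(1) D'(1)])
  then show "\<exists>D. ((\<lambda>x. g (f x)) has_derivative D) (at x) \<and> (\<forall>c A. D (mat c ** A) = mat c ** D A)"
    using D D' by (intro exI[of _ "\<lambda>h. D' (D h)"]) auto
qed

lemma dim_coordinate_subspace:
  fixes K :: "('n::finite \<times> 'n) set"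
  shows "dim {A :: 'n cmat. \<forall>i j. (i, j) \<notin> K \<longrightarrow> A $ i $ j = 0} = 2 * card K"
proof -
  let ?f = "\<lambda>((i, j), b). axis i (axis j b) :: 'n cmat"
  let ?d = "?f ` (K \<times> (Basis :: complex set))"
  have inner: "A \<bullet> axis i (axis j b) = A $ i $ j \<bullet> b" for A :: "'n cmat" and i j b
    by (simp add: inner_axis)
  have mem: "axis i (axis j b) \<in> ?d \<longleftrightarrow> (i, j) \<in> K" if b: "b \<in> Basis" for i j and b :: complex
  proof
    assume "axis i (axis j b) \<in> ?d"
    then obtain i' j' b' where *: "(i', j') \<in> K" "b' \<in> Basis" "axis i (axis j b) = (axis i' (axis j' b') :: 'n cmat)" by auto
    then have "axis i (axis j b) $ i $ j = (axis i' (axis j' b') :: 'n cmat) $ i $ j" by simp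
    moreover have "b \<noteq> 0" using b by (rule nonzero_Basis)
    ultimately have "i = i'" "j = j'" by (auto simp: axis_def split: if_splits)
    then show "(i, j) \<in> K" using * by simp
  qed (use b in force)
  have Basis: "Basis = {axis i (axis j b) | i j b. b \<in> (Basis :: complex set)}" for i :: 'n
    unfolding Basis_vec_def by auto
  have sub: "?d \<subseteq> (Basis :: 'n cmat set)" by (auto simp: Basis)
  have "{A :: 'n cmat. \<forall>i j. (i, j) \<notin> K \<longrightarrow> A $ i $ j = 0} = {A. \<forall>i\<in>Basis. i \<notin> ?d \<longrightarrow> A \<bullet> i = 0}"
  proof (rule Collect_cong, intro iffI ballI allI impI)
    fix A :: "'n cmat" and v :: "'n cmat"
    assume A: "\<forall>i j. (i, j) \<notin> K \<longrightarrow> A $ i $ j = 0" and v: "v \<in> Basis" "v \<notin> ?d"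
    then obtain i j b where "v = axis i (axis j b)" "b \<in> Basis" by (auto simp: Basis)
    then show "A \<bullet> v = 0" using A v mem inner by simp
  next
    fix A :: "'n cmat" and i j
    assume A: "\<forall>v\<in>Basis. v \<notin> ?d \<longrightarrow> A \<bullet> v = 0" and ij: "(i, j) \<notin> K"
    have "A $ i $ j \<bullet> b = 0" if "b \<in> Basis" for b
      using A[rule_format, of "axis i (axis j b)"] mem[OF that] ij that by (auto simp: inner Basis)
    then show "A $ i $ j = 0" using euclidean_all_zero_iff by blast
  qed
  moreover have "card ?d = 2 * card K"
  proof -
    have "inj_on ?f (K \<times> Basis)"
    proof (rule inj_onI)
      fix u v :: "('n \<times> 'n) \<times> complex"
      obtain i j b i' j' b' where uv: "u = ((i, j), b)" "v = ((i', j'), b')" by (metis surj_pair)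
      assume *: "u \<in> K \<times> Basis" "v \<in> K \<times> Basis" "?f u = ?f v"
      then have e: "axis i (axis j b) $ i $ j = (axis i' (axis j' b') :: 'n cmat) $ i $ j" by (simp add: uv)
      have "b \<noteq> 0" using *(1) nonzero_Basis by (auto simp: uv)
      with e show "u = v" by (auto simp: axis_def uv split: if_splits)
    qed
    then show ?thesis by (simp add: card_image card_cartesian_product)
  qed
  ultimately show ?thesis using dim_substandard[OF sub] by simp
qed

lemma complex_submanifoldE:
  fixes M :: "'n::finite cmat set"
  assumes "complex_submanifold d M" "p \<in> M"
  obtains U V \<Phi> \<Psi> and K :: "('n \<times> 'n) set" where "open U" "p \<in> U" "open V"
    "homeomorphism U V \<Phi> \<Psi>" "holomorphic_map_on \<Phi> U" "holomorphic_map_on \<Psi> V" "card K = d"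
    "\<Phi> ` (M \<inter> U) = {A \<in> V. \<forall>i j. (i, j) \<notin> K \<longrightarrow> A $ i $ j = 0}"
  using bspec[OF assms(1)[unfolded complex_submanifold_def] assms(2)]
  by (elim exE conjE) (rule that)

lemma complex_submanifold_dim_le:
  fixes M :: "'n::finite cmat set"
  assumes "complex_submanifold d M" "complex_submanifold d' M" "M \<noteq> {}"
  shows "d \<le> d'"
proof -
  obtain p where p: "p \<in> M" using assms(3) by blast
  obtain U V \<Phi> \<Psi> and K :: "('n \<times> 'n) set" where 1: "open U" "p \<in> U" "open V" "homeomorphism U V \<Phi> \<Psi>"
     "holomorphic_map_on \<Phi> U" "holomorphic_map_on \<Psi> V" "card K = d"
     "\<Phi> ` (M \<inter> U) = {A \<in> V. \<forall>i j. (i, j) \<notin> K \<longrightarrow> A $ i $ j = 0}"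
    by (rule complex_submanifoldE[OF assms(1) p])
  obtain U' V' \<Phi>' \<Psi>' and K' :: "('n \<times> 'n) set" where 2: "open U'" "p \<in> U'" "open V'" "homeomorphism U' V' \<Phi>' \<Psi>'"
     "holomorphic_map_on \<Phi>' U'" "holomorphic_map_on \<Psi>' V'" "card K' = d'"
     "\<Phi>' ` (M \<inter> U') = {A \<in> V'. \<forall>i j. (i, j) \<notin> K' \<longrightarrow> A $ i $ j = 0}"
    by (rule complex_submanifoldE[OF assms(2) p])
  define a where "a = \<Phi> p"
  have aV: "a \<in> V" and \<Psi>a: "\<Psi> a = p" using 1(2,4) by (auto simp: homeomorphism_def a_def)
  have p'V: "\<Phi>' p \<in> V'" "\<Psi>' (\<Phi>' p) = p" using 2(2,4) by (auto simp: homeomorphism_def)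
  obtain D where D: "(\<Psi> has_derivative D) (at a)" using 1(6) aV by (auto simp: holomorphic_map_on_def)
  obtain D1 where D1: "(\<Phi> has_derivative D1) (at p)" using 1(2,5) by (auto simp: holomorphic_map_on_def)
  obtain D' where D': "(\<Phi>' has_derivative D') (at p)" using 2(2,5) by (auto simp: holomorphic_map_on_def)
  obtain D2 where D2: "(\<Psi>' has_derivative D2) (at (\<Phi>' p))" using 2(6) p'V by (auto simp: holomorphic_map_on_def)
  have inv1: "D1 (D h) = h" for h
  proof -
    have "((\<lambda>x. \<Phi> (\<Psi> x)) has_derivative (\<lambda>h. D1 (D h))) (at a)"
      by (rule has_derivative_compose[OF D]) (simp add: \<Psi>a D1)
    moreover have "((\<lambda>x. x) has_derivative (\<lambda>h. D1 (D h))) (at a)"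
      by (rule has_derivative_transform_within_open[OF calculation 1(3) aV]) (use 1(4) in \<open>auto simp: homeomorphism_def\<close>)
    ultimately show ?thesis using has_derivative_unique[OF _ has_derivative_ident] by metis
  qed
  have inv2: "D2 (D' h) = h" for h
  proof -
    have "((\<lambda>x. \<Psi>' (\<Phi>' x)) has_derivative (\<lambda>h. D2 (D' h))) (at p)"
      by (rule has_derivative_compose[OF D' D2])
    moreover have "((\<lambda>x. x) has_derivative (\<lambda>h. D2 (D' h))) (at p)"
      by (rule has_derivative_transform_within_open[OF calculation 2(1,2)]) (use 2(4) in \<open>auto simp: homeomorphism_def\<close>)
    ultimately show ?thesis using has_derivative_unique[OF _ has_derivative_ident] by metis
  qed
  define L L' where "L = {A :: 'n cmat. \<forall>i j. (i, j) \<notin> K \<longrightarrow> A $ i $ j = 0}"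
    and "L' = {A :: 'n cmat. \<forall>i j. (i, j) \<notin> K' \<longrightarrow> A $ i $ j = 0}"
  have subL: "subspace L" "subspace L'" unfolding L_def L'_def by (auto simp: subspace_def)
  have aL: "a \<in> L" using 1(2,8) p by (auto simp: L_def a_def)
  let ?F = "\<lambda>x. \<Phi>' (\<Psi> x)"
  have F: "(?F has_derivative (\<lambda>h. D' (D h))) (at a)"
    by (rule has_derivative_compose[OF D]) (simp add: \<Psi>a D')
  have "D' (D v) \<in> L'" if v: "v \<in> L" for v
  proof -
    let ?g = "\<lambda>t::real. ?F (a + t *\<^sub>R v)"
    have "((\<lambda>t::real. a + t *\<^sub>R v) has_derivative (\<lambda>t. t *\<^sub>R v)) (at 0)"
      by (auto intro!: derivative_eq_intros)
    then have "(?g has_derivative (\<lambda>t. D' (D (t *\<^sub>R v)))) (at 0)"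
      by (rule has_derivative_compose) (simp add: F)
    moreover have "D' (D (t *\<^sub>R v)) = t *\<^sub>R D' (D v)" for t
      using linear_scale[OF has_derivative_linear[OF F]] by simp
    ultimately have "((\<lambda>t. (1 / \<bar>t\<bar>) *\<^sub>R (?g t - (?g 0 + t *\<^sub>R D' (D v)))) \<longlongrightarrow> 0) (at 0)"
      by (simp add: has_derivative_within)
    then have lim0: "((\<lambda>t. norm ((1 / \<bar>t\<bar>) *\<^sub>R (?g t - (?g 0 + t *\<^sub>R D' (D v))))) \<longlongrightarrow> 0) (at 0)"
      by (rule tendsto_norm_zero)
    have "norm ((1 / \<bar>t\<bar>) *\<^sub>R (?g t - (?g 0 + t *\<^sub>R D' (D v)))) = norm ((1 / t) *\<^sub>R (?g t - ?g 0) - D' (D v))"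
      if "t \<noteq> 0" for t
    proof -
      have "(1 / t) *\<^sub>R (?g t - ?g 0) - D' (D v) = (1 / t) *\<^sub>R (?g t - (?g 0 + t *\<^sub>R D' (D v)))"
        using that by (simp add: algebra_simps)
      then show ?thesis by simp
    qed
    then have "((\<lambda>t. norm ((1 / t) *\<^sub>R (?g t - ?g 0) - D' (D v))) \<longlongrightarrow> 0) (at 0)"
      by (intro Lim_transform_eventually[OF lim0]) (auto simp: eventually_at_filter)
    then have lim: "((\<lambda>t. (1 / t) *\<^sub>R (?g t - ?g 0)) \<longlongrightarrow> D' (D v)) (at 0)"
      by (simp add: tendsto_norm_zero_iff LIM_zero_iff)
    have cont: "continuous_on V \<Psi>" using 1(4) by (simp add: homeomorphism_def)
    have "open (V \<inter> \<Psi> -` U')" using cont 1(3) 2(1) by (simp add: continuous_open_preimage)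
    then have "open ((\<lambda>t::real. a + t *\<^sub>R v) -` (V \<inter> \<Psi> -` U'))"
      by (intro open_vimage continuous_intros)
    moreover have "0 \<in> (\<lambda>t::real. a + t *\<^sub>R v) -` (V \<inter> \<Psi> -` U')" using aV \<Psi>a 2(2) by auto
    ultimately have ev: "eventually (\<lambda>t. t \<in> (\<lambda>t::real. a + t *\<^sub>R v) -` (V \<inter> \<Psi> -` U')) (at 0)"
      using eventually_nhds_in_open by (fastforce simp: eventually_at_filter elim: eventually_mono)
    have in': "?F x \<in> L'" if "x \<in> V" "\<Psi> x \<in> U'" "x \<in> L" for x
    proof -
      have "x \<in> \<Phi> ` (M \<inter> U)" using that 1(8) by (auto simp: L_def)
      then have "\<Psi> x \<in> M" using 1(4) by (auto simp: homeomorphism_def)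
      then show ?thesis using 2(8) that by (auto simp: L'_def)
    qed
    have "eventually (\<lambda>t. (1 / t) *\<^sub>R (?g t - ?g 0) \<in> L') (at 0)"
      using ev
    proof eventually_elim
      case (elim t)
      have "?g t \<in> L'" using elim v aL subL by (intro in') (auto intro: subspace_add subspace_scale)
      moreover have "?g 0 \<in> L'" using in'[of a] aV aL \<Psi>a 2(2) by simp
      ultimately show ?case using subL by (intro subspace_scale subspace_diff)
    qed
    then show ?thesis using lim subL closed_subspace by (intro Lim_in_closed_set[OF _ _ _ lim]) auto
  qed
  then have "(\<lambda>h. D' (D h)) ` L \<subseteq> L'" by blast
  then have "dim ((\<lambda>h. D' (D h)) ` L) \<le> dim L'" by (rule dim_subset)
  moreover have "dim ((\<lambda>h. D' (D h)) ` L) = dim L"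
  proof (rule dim_image_eq)
    show "linear (\<lambda>h. D' (D h))" using F has_derivative_linear by blast
    show "inj_on (\<lambda>h. D' (D h)) (span L)" by (rule inj_on_inverseI[of _ "\<lambda>h. D1 (D2 h)"]) (simp add: inv1 inv2)
  qed
  ultimately show ?thesis using 1(7) 2(7) by (simp add: L_def L'_def dim_coordinate_subspace)
qed

lemma complex_dim_eqI:
  assumes "complex_submanifold d M" "M \<noteq> {}"
  shows "complex_dim M = d"
  unfolding complex_dim_def
  by (rule the_equality[where P = "\<lambda>d. complex_submanifold d M", OF assms(1)])
     (metis antisym assms complex_submanifold_dim_le)

lemma linear_matrix_sandwich: "linear (\<lambda>A. P ** A ** Q)" for P Q :: "'n::finite cmat"
  by (rule linearI)
     (simp_all add: vec_eq_iff matrix_matrix_mult_def distrib_left distrib_right sum.distrib flip: scaleR_sum_right)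

lemma mat_mult_commute: "A ** mat c = mat c ** A" for A :: "'n::finite cmat"
  by (simp add: vec_eq_iff matrix_matrix_mult_def mat_def if_distrib[of "\<lambda>a. a * _"] if_distrib[of "\<lambda>a. _ * a"] mult.commute cong: if_cong)

lemma holomorphic_map_sandwich: "holomorphic_map_on (\<lambda>A. P ** A ** Q) U" for P Q :: "'n::finite cmat"
proof (intro holomorphic_map_onI holomorphic_fun_linear linear_matrix_sandwich)
  fix c and A :: "'n cmat"
  have "P ** (mat c ** A) ** Q = (P ** mat c) ** A ** Q" by (simp add: matrix_mul_assoc)
  then show "P ** (mat c ** A) ** Q = mat c ** (P ** A ** Q)" by (simp add: mat_mult_commute matrix_mul_assoc)
qed

lemma complex_submanifold_conj:
  fixes P :: "'n::finite cmat"
  assumes "complex_submanifold d M" "det P \<noteq> 0"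
  shows "complex_submanifold d ((\<lambda>A. P ** A ** matrix_inv P) ` M)"
  unfolding complex_submanifold_def
proof
  let ?c = "\<lambda>A. P ** A ** matrix_inv P" and ?i = "\<lambda>A. matrix_inv P ** A ** P"
  have ci: "?c (?i A) = A" and ic: "?i (?c A) = A" for A
    using assms(2) by (simp_all add: matrix_mul_assoc)
  fix p' assume "p' \<in> ?c ` M"
  then obtain p where p: "p \<in> M" "p' = ?c p" by blast
  obtain U V \<Phi> \<Psi> and K :: "('n \<times> 'n) set" where 1: "open U" "p \<in> U" "open V" "homeomorphism U V \<Phi> \<Psi>"
     "holomorphic_map_on \<Phi> U" "holomorphic_map_on \<Psi> V" "card K = d"
     "\<Phi> ` (M \<inter> U) = {A \<in> V. \<forall>i j. (i, j) \<notin> K \<longrightarrow> A $ i $ j = 0}"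
    by (rule complex_submanifoldE[OF assms(1) p(1)])
  have U: "?c ` U = ?i -` U"
  proof
    show "?i -` U \<subseteq> ?c ` U"
    proof
      fix A assume "A \<in> ?i -` U"
      then show "A \<in> ?c ` U" using ci[of A] by (metis (no_types, lifting) image_eqI vimageD)
    qed
  qed (auto simp: ic)
  have cont: "continuous_on S ?c" "continuous_on S ?i" for S by (intro continuous_intros)+
  show "\<exists>U V \<Phi> \<Psi> (K :: ('n \<times> 'n) set).
        open U \<and> p' \<in> U \<and> open V \<and> homeomorphism U V \<Phi> \<Psi> \<and>
        holomorphic_map_on \<Phi> U \<and> holomorphic_map_on \<Psi> V \<and> card K = d \<and>
        \<Phi> ` (?c ` M \<inter> U) = {A \<in> V. \<forall>i j. (i, j) \<notin> K \<longrightarrow> A $ i $ j = 0}"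
  proof (intro exI conjI)
    show "open (?c ` U)" unfolding U using 1(1) cont by (simp add: open_vimage)
    show "p' \<in> ?c ` U" using p 1 by blast
    show "open V" "card K = d" using 1 by auto
    have "homeomorphism (?c ` U) U ?i ?c" using cont ci ic by (auto simp: homeomorphism_def image_image)
    from homeomorphism_compose[OF this 1(4)]
    show "homeomorphism (?c ` U) V (\<lambda>A. \<Phi> (?i A)) (\<lambda>A. ?c (\<Psi> A))" by (simp add: o_def)
    show "holomorphic_map_on (\<lambda>A. \<Phi> (?i A)) (?c ` U)"
      by (rule holomorphic_map_compose[OF holomorphic_map_sandwich 1(5)]) (auto simp: ic)
    show "holomorphic_map_on (\<lambda>A. ?c (\<Psi> A)) V"
      by (rule holomorphic_map_compose[OF 1(6) holomorphic_map_sandwich subset_UNIV])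
    have "inj ?c" by (rule inj_on_inverseI[of _ ?i]) (rule ic)
    then have "?c ` M \<inter> ?c ` U = ?c ` (M \<inter> U)" by (simp only: image_Int)
    then show "(\<lambda>A. \<Phi> (?i A)) ` (?c ` M \<inter> ?c ` U) = {A \<in> V. \<forall>i j. (i, j) \<notin> K \<longrightarrow> A $ i $ j = 0}"
      using 1(8) by (simp add: image_image ic)
  qed
qed

text \<open>Charts show that submanifolds are locally connected, so their components are relatively open.\<close>

lemma complex_submanifold_component:
  fixes M :: "'n::finite cmat set"
  assumes "complex_submanifold d M"
  shows "complex_submanifold d (connected_component_set M x)"
  unfolding complex_submanifold_def
proof
  fix p assume "p \<in> connected_component_set M x"
  then have px: "connected_component M x p" and p: "p \<in> M" using connected_component_in by auto
  obtain U V \<Phi> \<Psi> and K :: "('n \<times> 'n) set" where 1: "open U" "p \<in> U" "open V" "homeomorphism U V \<Phi> \<Psi>"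
     "holomorphic_map_on \<Phi> U" "holomorphic_map_on \<Psi> V" "card K = d"
     "\<Phi> ` (M \<inter> U) = {A \<in> V. \<forall>i j. (i, j) \<notin> K \<longrightarrow> A $ i $ j = 0}"
    by (rule complex_submanifoldE[OF assms(1) p])
  have hom: "\<And>x. x \<in> U \<Longrightarrow> \<Psi> (\<Phi> x) = x \<and> \<Phi> x \<in> V" "\<And>x. x \<in> V \<Longrightarrow> \<Phi> (\<Psi> x) = x \<and> \<Psi> x \<in> U"
    and cont: "continuous_on U \<Phi>" "continuous_on V \<Psi>" using 1(4) by (auto simp: homeomorphism_def)
  define L where "L = {A :: 'n cmat. \<forall>i j. (i, j) \<notin> K \<longrightarrow> A $ i $ j = 0}"
  obtain e where e: "e > 0" "ball (\<Phi> p) e \<subseteq> V" using 1(2,3) hom(1) by (meson openE)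
  let ?V = "ball (\<Phi> p) e" and ?U = "U \<inter> \<Phi> -` ball (\<Phi> p) e"
  have "subspace L" unfolding L_def by (auto simp: subspace_def)
  then have "connected (?V \<inter> L)" by (intro convex_connected convex_Int convex_ball subspace_imp_convex)
  then have conn: "connected (\<Psi> ` (?V \<inter> L))"
    using e by (intro connected_continuous_image continuous_on_subset[OF cont(2)]) auto
  have img: "\<Psi> ` (?V \<inter> L) = M \<inter> ?U"
  proof
    show "\<Psi> ` (?V \<inter> L) \<subseteq> M \<inter> ?U"
    proof clarify
      fix A assume A: "A \<in> ?V" "A \<in> L"
      then have "A \<in> \<Phi> ` (M \<inter> U)" using e 1(8) by (auto simp: L_def)
      then have "\<Psi> A \<in> M" using hom by auto
      then show "\<Psi> A \<in> M \<inter> ?U" using A e hom by auto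
    qed
    show "M \<inter> ?U \<subseteq> \<Psi> ` (?V \<inter> L)"
    proof
      fix y assume y: "y \<in> M \<inter> ?U"
      then have "\<Phi> y \<in> L" using 1(8) by (auto simp: L_def)
      moreover have "\<Psi> (\<Phi> y) = y" using y hom by auto
      ultimately show "y \<in> \<Psi> ` (?V \<inter> L)" using y by (metis IntD2 IntI image_eqI vimageD)
    qed
  qed
  have sub: "M \<inter> ?U \<subseteq> connected_component_set M x"
  proof
    fix y assume "y \<in> M \<inter> ?U"
    then have "connected_component M p y"
      using conn img p 1(2) e(1) unfolding connected_component_def by (intro exI[of _ "M \<inter> ?U"]) auto
    then show "y \<in> connected_component_set M x" using px connected_component_trans by fastforce
  qed
  then have eq: "connected_component_set M x \<inter> ?U = M \<inter> ?U" using connected_component_subset by blast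
  show "\<exists>U V \<Phi> \<Psi> (K :: ('n \<times> 'n) set).
        open U \<and> p \<in> U \<and> open V \<and> homeomorphism U V \<Phi> \<Psi> \<and>
        holomorphic_map_on \<Phi> U \<and> holomorphic_map_on \<Psi> V \<and> card K = d \<and>
        \<Phi> ` (connected_component_set M x \<inter> U) = {A \<in> V. \<forall>i j. (i, j) \<notin> K \<longrightarrow> A $ i $ j = 0}"
  proof (intro exI conjI)
    show "open ?U" using cont(1) 1(1) by (simp add: continuous_open_preimage)
    show "p \<in> ?U" using 1(2) e by simp
    show "open ?V" "card K = d" using 1 by auto
    have "\<Phi> ` ?U = ?V" using hom e by (force simp: image_iff)
    then show "homeomorphism ?U ?V \<Phi> \<Psi>"
      using 1(4) e by (intro homeomorphism_of_subsets[OF 1(4)]) auto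
    show "holomorphic_map_on \<Phi> ?U" "holomorphic_map_on \<Psi> ?V" using 1(5,6) e by (auto simp: holomorphic_map_on_def)
    have "\<Phi> ` (M \<inter> ?U) = ?V \<inter> L"
      unfolding img[symmetric] using hom e by (force simp: image_iff)
    then show "\<Phi> ` (connected_component_set M x \<inter> ?U) = {A \<in> ?V. \<forall>i j. (i, j) \<notin> K \<longrightarrow> A $ i $ j = 0}"
      unfolding eq by (auto simp: L_def)
  qed
qed

section \<open>Determinant one in a linear space of matrices\<close>

lemma exp_notin_nonpos_Reals:
  assumes "\<bar>Im w\<bar> < pi"
  shows "exp w \<notin> \<real>\<^sub>\<le>\<^sub>0"
proof
  assume "exp w \<in> \<real>\<^sub>\<le>\<^sub>0"
  then have "Re (exp w) < 0 \<and> Im (exp w) = 0"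
    using exp_not_eq_zero[of w] by (auto simp: complex_nonpos_Reals_iff complex_eq_iff le_less simp del: exp_not_eq_zero)
  then have "Im (Ln (exp w)) = pi" using Im_Ln_eq_pi by simp
  moreover have "Ln (exp w) = w" using assms by (intro Ln_exp) auto
  ultimately show False using assms by simp
qed

lemma abs_Im_Ln_less_pi:
  assumes "z \<notin> \<real>\<^sub>\<le>\<^sub>0"
  shows "\<bar>Im (Ln z)\<bar> < pi"
proof -
  have z: "z \<noteq> 0" using assms by auto
  then have "Im (Ln z) \<noteq> pi" using assms Im_Ln_eq_pi[of z] by (auto simp: complex_nonpos_Reals_iff)
  then show ?thesis using mpi_less_Im_Ln[OF z] Im_Ln_le_pi[OF z] by auto
qed

text \<open>\<open>S\<close> is the graph of a linear map over the coordinates in \<open>K\<close>; after a shear straightening \<open>S\<close>, the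
  coordinates near \<open>p\<close> on its determinant-one part are \<open>g / g\<^bsub>q\<^esub>\<close> with the entry at \<open>q\<close> replaced by \<open>det g - 1\<close>. The inverse
  recovers \<open>g\<^bsub>q\<^esub>\<close> as the \<open>n\<close>-th root closest to \<open>p\<^bsub>q\<^esub>\<close>.\<close>

lemma complex_submanifold_det_one:
  fixes N :: "'n::finite cmat \<Rightarrow> 'n cmat" and K :: "('n \<times> 'n) set"
  defines "S \<equiv> {A. \<forall>i j. (i, j) \<notin> K \<longrightarrow> A $ i $ j = N A $ i $ j}"
  assumes lin: "linear N" "\<And>c A. N (mat c ** A) = mat c ** N A"
    and NK: "\<And>A i j. (i, j) \<in> K \<Longrightarrow> N A $ i $ j = 0" and NN: "\<And>A. N (N A) = 0"
    and q: "(a, b) \<in> K" and nz: "\<And>g. g \<in> S \<Longrightarrow> det g = 1 \<Longrightarrow> g $ a $ b \<noteq> 0"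
  shows "complex_submanifold (card K - 1) {g \<in> S. det g = 1}"
  unfolding complex_submanifold_def
proof
  fix p assume "p \<in> {g \<in> S. det g = 1}"
  define c where "c = p $ a $ b"
  have c: "c \<noteq> 0" using \<open>p \<in> _\<close> nz by (auto simp: c_def)
  define n where "n = CARD('n)"
  have n: "n > 0" by (simp add: n_def)
  define F where "F z A = (\<chi> i j. if (i, j) = (a, b) then z else A $ i $ j)" for z and A :: "'n cmat"
  define T where "T A = A - N A" for A
  define Ti where "Ti A = A + N A" for A
  define \<Phi> where "\<Phi> g = F (det g - 1) (mat (1 / g $ a $ b) ** T g)" for g
  define h where "h A = Ti (F 1 A)" for A
  define \<rho> where "\<rho> A = (1 + A $ a $ b) / (c ^ n * det (h A))" for A
  define \<tau> where "\<tau> A = c * exp (Ln (\<rho> A) / of_nat n)" for A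
  define \<Psi> where "\<Psi> A = mat (\<tau> A) ** h A" for A
  define W where "W = - \<real>\<^sub>\<le>\<^sub>0 \<inter> Ln -` {w. \<bar>Im w\<bar> < pi / n}"
  define U where "U = {g. det g \<noteq> 0} \<inter> {g. g $ a $ b / c \<in> W}"
  define V where "V = {A. det (h A) \<noteq> 0} \<inter> \<rho> -` (- \<real>\<^sub>\<le>\<^sub>0)"
  have TTi: "T (Ti A) = A" "Ti (T A) = A" for A
    using linear_diff[OF lin(1)] linear_add[OF lin(1)] by (simp_all add: T_def Ti_def NN)
  have TK: "T A $ i $ j = A $ i $ j" "Ti A $ i $ j = A $ i $ j" if "(i, j) \<in> K" for A i j
    using NK[OF that] by (simp_all add: T_def Ti_def)
  have Tmat: "T (mat z ** A) = mat z ** T A" "Ti (mat z ** A) = mat z ** Ti A" for z A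
    by (simp_all add: T_def Ti_def lin(2) matrix_add_ldistrib vec_eq_iff algebra_simps)
  have F_ab [simp]: "F z A $ a $ b = z" for z A by (simp add: F_def)
  have F_id: "F z A = A" if "A $ a $ b = z" for z A using that by (auto simp: F_def vec_eq_iff)
  have F_F: "F z (F y A) = F z A" for z y A by (auto simp: F_def vec_eq_iff)
  have mat_mat: "mat y ** (mat z ** A) = mat (y * z) ** A" for y z and A :: "'n cmat"
    by (simp add: vec_eq_iff)
  have h_ab: "h A $ a $ b = 1" for A using TK(2)[OF q] by (simp add: h_def)
  have W_iff: "z \<in> W \<longleftrightarrow> z \<notin> \<real>\<^sub>\<le>\<^sub>0 \<and> \<bar>Im (Ln z)\<bar> < pi / n" for z by (simp add: W_def)

  have \<Phi>: "\<Phi> g \<in> V \<and> \<Psi> (\<Phi> g) = g" if "g \<in> U" for g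
  proof -
    define x where "x = g $ a $ b"
    have g: "det g \<noteq> 0" "x / c \<in> W" using that by (auto simp: U_def x_def)
    then have x: "x \<noteq> 0" by (auto simp: W_def)
    have "F 1 (\<Phi> g) = mat (1 / x) ** T g"
      using x TK(1)[OF q] by (simp add: \<Phi>_def F_F) (simp add: F_id x_def)
    then have hg: "h (\<Phi> g) = mat (1 / x) ** g" by (simp add: h_def Tmat TTi)
    have deth: "det (h (\<Phi> g)) = det g / x ^ n" by (simp add: hg det_mat_mult n_def power_one_over)
    have "\<rho> (\<Phi> g) = det g / (c ^ n * (det g / x ^ n))" by (simp add: \<rho>_def deth) (simp add: \<Phi>_def)
    also have "\<dots> = (x / c) ^ n" using g x c by (simp add: field_simps)
    also have "\<dots> = exp (of_nat n * Ln (x / c))" using x c by (simp add: exp_of_nat_mult)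
    finally have \<rho>: "\<rho> (\<Phi> g) = exp (of_nat n * Ln (x / c))" .
    have Im: "\<bar>Im (of_nat n * Ln (x / c))\<bar> < pi"
      using g(2) n by (simp add: W_iff abs_mult field_simps)
    then have "Ln (\<rho> (\<Phi> g)) = of_nat n * Ln (x / c)" unfolding \<rho> by (intro Ln_exp) auto
    then have "\<tau> (\<Phi> g) = x" using n x c by (simp add: \<tau>_def)
    then have "\<Psi> (\<Phi> g) = g" using x by (simp add: \<Psi>_def hg mat_mat)
    moreover have "\<Phi> g \<in> V" using exp_notin_nonpos_Reals[OF Im] g x by (simp add: V_def deth \<rho>)
    ultimately show ?thesis by blast
  qed
  have \<Psi>: "\<Psi> A \<in> U \<and> \<Phi> (\<Psi> A) = A" if "A \<in> V" for A
  proof -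
    have A: "det (h A) \<noteq> 0" "\<rho> A \<notin> \<real>\<^sub>\<le>\<^sub>0" using that by (auto simp: V_def)
    then have \<rho>0: "\<rho> A \<noteq> 0" by auto
    have \<tau>: "\<tau> A \<noteq> 0" using c by (simp add: \<tau>_def)
    have x: "\<Psi> A $ a $ b = \<tau> A" by (simp add: \<Psi>_def h_ab)
    have "exp (Ln (\<rho> A) / of_nat n) ^ n = \<rho> A" using n \<rho>0 by (simp flip: exp_of_nat_mult)
    then have "\<tau> A ^ n = c ^ n * \<rho> A" by (simp add: \<tau>_def power_mult_distrib)
    then have det: "det (\<Psi> A) = 1 + A $ a $ b"
      using A c by (simp add: \<Psi>_def det_mat_mult n_def[symmetric]) (simp add: \<rho>_def)
    have "mat (1 / \<tau> A) ** T (\<Psi> A) = F 1 A"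
      using \<tau> by (simp add: \<Psi>_def Tmat mat_mat h_def TTi)
    then have "\<Phi> (\<Psi> A) = F (A $ a $ b) A" by (simp add: \<Phi>_def x det F_F)
    then have "\<Phi> (\<Psi> A) = A" by (simp add: F_id)
    moreover have "\<Psi> A \<in> U"
    proof -
      have "\<bar>Im (Ln (\<rho> A) / of_nat n)\<bar> < pi / n"
        using abs_Im_Ln_less_pi[OF A(2)] n by (simp add: divide_strict_right_mono)
      moreover have "pi / n \<le> pi" using n by (simp add: field_simps)
      ultimately have Im: "\<bar>Im (Ln (\<rho> A) / of_nat n)\<bar> < pi / n" "\<bar>Im (Ln (\<rho> A) / of_nat n)\<bar> < pi" by auto
      moreover have "\<tau> A / c = exp (Ln (\<rho> A) / of_nat n)" using c by (simp add: \<tau>_def)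
      moreover have "Ln (exp (Ln (\<rho> A) / of_nat n)) = Ln (\<rho> A) / of_nat n" using Im(2) by (intro Ln_exp; linarith)
      ultimately have "\<tau> A / c \<in> W" using exp_notin_nonpos_Reals by (simp add: W_iff)
      moreover have "det (\<Psi> A) \<noteq> 0" using \<rho>0 by (auto simp: det \<rho>_def)
      ultimately show ?thesis by (simp add: U_def x)
    qed
    ultimately show ?thesis by blast
  qed
  have hol_lin: "linear T" "linear Ti"
    using lin(1) by (auto simp: T_def[abs_def] Ti_def[abs_def] intro!: linear_compose_sub linear_compose_add linear_ident)
  note hol = holomorphic_fun_const holomorphic_fun_entry holomorphic_fun_add holomorphic_fun_mult
    holomorphic_fun_divide holomorphic_fun_det
  have hol_h: "holomorphic_fun_at (\<lambda>A. h A $ i $ j) x" for i j x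
  proof -
    have "holomorphic_map_on (\<lambda>A. F 1 A) UNIV"
    proof (rule holomorphic_map_onI)
      show "holomorphic_fun_at (\<lambda>A. F 1 A $ i $ j) x" for x i j
        by (cases "(i, j) = (a, b)") (auto simp: F_def intro: hol)
    qed
    moreover have "holomorphic_map_on Ti UNIV"
      by (intro holomorphic_map_onI holomorphic_fun_linear hol_lin Tmat)
    ultimately have "holomorphic_map_on h UNIV"
      unfolding h_def[abs_def] by (rule holomorphic_map_compose) auto
    then obtain D where "(h has_derivative D) (at x)" "\<forall>c A. D (mat c ** A) = mat c ** D A"
      unfolding holomorphic_map_on_def by (elim ballE[of _ _ x]) blast+
    then show ?thesis unfolding holomorphic_fun_at_def
      by (intro exI[of _ "\<lambda>A. D A $ i $ j"])
         (auto intro!: bounded_linear.has_derivative[OF bounded_linear_vec_nth])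
  qed
  have hol_\<Phi>: "holomorphic_map_on \<Phi> U"
  proof (rule holomorphic_map_onI)
    fix x i j assume "x \<in> U"
    then have x: "x $ a $ b \<noteq> 0" by (auto simp: U_def W_def)
    have "holomorphic_fun_at (\<lambda>A. det A + (- 1)) x" by (intro hol)
    moreover have "holomorphic_fun_at (\<lambda>A. 1 / A $ a $ b * T A $ i $ j) x"
      by (intro hol x holomorphic_fun_linear hol_lin Tmat)
    ultimately show "holomorphic_fun_at (\<lambda>A. \<Phi> A $ i $ j) x"
      by (cases "(i, j) = (a, b)") (auto simp: \<Phi>_def F_def)
  qed
  have hol_\<rho>: "holomorphic_fun_at \<rho> x" if "x \<in> V" for x
    unfolding \<rho>_def[abs_def] using that c by (intro hol hol_h) (auto simp: V_def)
  have hol_\<Psi>: "holomorphic_map_on \<Psi> V"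
  proof (rule holomorphic_map_onI)
    fix x i j assume x: "x \<in> V"
    have "holomorphic_fun_at (\<lambda>A. exp (Ln (\<rho> A) / of_nat n)) x"
    proof (rule holomorphic_fun_compose[OF hol_\<rho>[OF x], where F = "\<lambda>z. exp (Ln z / of_nat n)"])
      show "((\<lambda>z. exp (Ln z / of_nat n)) has_field_derivative
          (inverse (\<rho> x) / of_nat n) * exp (Ln (\<rho> x) / of_nat n)) (at (\<rho> x))"
        using x n by (auto simp: V_def intro!: derivative_eq_intros)
    qed
    then show "holomorphic_fun_at (\<lambda>A. \<Psi> A $ i $ j) x"
      unfolding \<Psi>_def mat_mult_entry \<tau>_def by (intro hol hol_h)
  qed
  have cont_h: "continuous_on UNIV h"
  proof -
    have "holomorphic_map_on h UNIV" by (intro holomorphic_map_onI hol_h)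
    then show ?thesis by (rule holomorphic_map_imp_continuous_on)
  qed
  have openW: "open W" unfolding W_def
  proof (rule continuous_open_preimage)
    show "continuous_on (- \<real>\<^sub>\<le>\<^sub>0) Ln" by (intro continuous_intros) auto
    show "open (- \<real>\<^sub>\<le>\<^sub>0 :: complex set)" by auto
    show "open {w :: complex. \<bar>Im w\<bar> < pi / n}" by (intro open_Collect_less continuous_intros)
  qed
  have openU: "open U"
  proof -
    have "open ((\<lambda>g :: 'n cmat. g $ a $ b / c) -` W)"
      using openW c by (intro open_vimage continuous_intros) auto
    moreover have "open {g :: 'n cmat. det g \<noteq> 0}" by (intro open_Collect_neq continuous_intros)
    ultimately show ?thesis unfolding U_def vimage_def by (intro open_Int) auto
  qed
  have openV: "open V" unfolding V_def
  proof (rule continuous_open_preimage)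
    show "continuous_on {A. det (h A) \<noteq> 0} \<rho>" unfolding \<rho>_def[abs_def]
      using c by (intro continuous_intros continuous_on_subset[OF cont_h]) auto
    show "open {A. det (h A) \<noteq> 0}" by (intro open_Collect_neq continuous_intros cont_h)
  qed auto
  have image: "\<Phi> ` ({g \<in> S. det g = 1} \<inter> U) = {A \<in> V. \<forall>i j. (i, j) \<notin> K - {(a, b)} \<longrightarrow> A $ i $ j = 0}"
  proof -
    have iff: "(\<forall>i j. (i, j) \<notin> K - {(a, b)} \<longrightarrow> \<Phi> g $ i $ j = 0) \<longleftrightarrow> g \<in> S \<and> det g = 1" if "g \<in> U" for g
    proof -
      have x: "g $ a $ b \<noteq> 0" using that by (auto simp: U_def W_def)
      have "(\<forall>i j. (i, j) \<notin> K - {(a, b)} \<longrightarrow> \<Phi> g $ i $ j = 0) \<longleftrightarrow>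
            \<Phi> g $ a $ b = 0 \<and> (\<forall>i j. (i, j) \<notin> K \<longrightarrow> \<Phi> g $ i $ j = 0)"
        using q by auto
      also have "(\<forall>i j. (i, j) \<notin> K \<longrightarrow> \<Phi> g $ i $ j = 0) \<longleftrightarrow> (\<forall>i j. (i, j) \<notin> K \<longrightarrow> T g $ i $ j = 0)"
        using x q by (intro all_cong1 imp_cong refl) (auto simp: \<Phi>_def F_def)
      also have "\<dots> \<longleftrightarrow> g \<in> S" by (simp add: S_def T_def)
      also have "\<Phi> g $ a $ b = 0 \<longleftrightarrow> det g = 1" by (simp add: \<Phi>_def)
      finally show ?thesis by blast
    qed
    show ?thesis
    proof (intro equalityI subsetI)
      fix A assume "A \<in> \<Phi> ` ({g \<in> S. det g = 1} \<inter> U)"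
      then obtain g where "g \<in> U" "g \<in> S" "det g = 1" "A = \<Phi> g" by blast
      then show "A \<in> {A \<in> V. \<forall>i j. (i, j) \<notin> K - {(a, b)} \<longrightarrow> A $ i $ j = 0}" using iff \<Phi> by blast
    next
      fix A assume "A \<in> {A \<in> V. \<forall>i j. (i, j) \<notin> K - {(a, b)} \<longrightarrow> A $ i $ j = 0}"
      then have A: "A \<in> V" "\<forall>i j. (i, j) \<notin> K - {(a, b)} \<longrightarrow> A $ i $ j = 0" by auto
      then have "\<Psi> A \<in> S \<and> det (\<Psi> A) = 1" using iff[of "\<Psi> A"] \<Psi>[of A] by auto
      then show "A \<in> \<Phi> ` ({g \<in> S. det g = 1} \<inter> U)"
        using \<Psi>[OF A(1)] by (intro image_eqI[of _ _ "\<Psi> A"]) auto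
    qed
  qed
  show "\<exists>U V \<Phi> \<Psi> (K' :: ('n \<times> 'n) set). open U \<and> p \<in> U \<and> open V \<and> homeomorphism U V \<Phi> \<Psi> \<and>
        holomorphic_map_on \<Phi> U \<and> holomorphic_map_on \<Psi> V \<and> card K' = card K - 1 \<and>
        \<Phi> ` ({g \<in> S. det g = 1} \<inter> U) = {A \<in> V. \<forall>i j. (i, j) \<notin> K' \<longrightarrow> A $ i $ j = 0}"
  proof (intro exI conjI)
    show "p \<in> U" using \<open>p \<in> _\<close> c n by (auto simp: U_def W_iff c_def)
    show "homeomorphism U V \<Phi> \<Psi>"
    proof (rule homeomorphismI)
      show "continuous_on U \<Phi>" "continuous_on V \<Psi>"
        using hol_\<Phi> hol_\<Psi> holomorphic_map_imp_continuous_on by auto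
    qed (use \<Phi> \<Psi> in auto)
    show "card (K - {(a, b)}) = card K - 1" using q by simp
  qed (fact openU openV hol_\<Phi> hol_\<Psi> image)+
qed

section \<open>Triangular groups are solvable\<close>

lemma matrix_vec_axis [simp]:
  fixes A :: "'n::finite cmat"
  shows "(A *v axis j 1) $ i = A $ i $ j"
  by (simp add: matrix_vector_mult_def axis_def if_distrib cong: if_cong)

lemma matrix_diff_distrib:
  fixes A B C :: "'n::finite cmat"
  shows "A ** (B - C) = A ** B - A ** C" "(A - B) ** C = A ** C - B ** C"
  by (simp_all add: vec_eq_iff matrix_matrix_mult_def algebra_simps sum_subtractf)

definition upper :: "('n::finite \<Rightarrow> nat) \<Rightarrow> nat \<Rightarrow> 'n cmat set" where
  "upper ord s = {A. \<forall>i j. A $ i $ j \<noteq> 0 \<longrightarrow> ord i + s \<le> ord j}"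

lemma upper_mult:
  assumes "A \<in> upper ord s" "B \<in> upper ord t"
  shows "A ** B \<in> upper ord (s + t)"
  unfolding upper_def
proof (intro CollectI allI impI)
  fix i j assume "(A ** B) $ i $ j \<noteq> 0"
  then have "(\<Sum>k\<in>UNIV. A $ i $ k * B $ k $ j) \<noteq> 0" by (simp add: matrix_matrix_mult_def)
  then obtain k where "A $ i $ k * B $ k $ j \<noteq> 0" by (meson sum.not_neutral_contains_not_neutral)
  then have "A $ i $ k \<noteq> 0" "B $ k $ j \<noteq> 0" by auto
  then show "ord i + (s + t) \<le> ord j" using assms unfolding upper_def by fastforce
qed

lemma upper_add: "A \<in> upper ord s \<Longrightarrow> B \<in> upper ord s \<Longrightarrow> A + B \<in> upper ord s"
  unfolding upper_def by (simp, metis add_0)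

lemma upper_uminus: "A \<in> upper ord s \<Longrightarrow> - A \<in> upper ord s"
  by (simp add: upper_def)

lemma upper_diff: "A \<in> upper ord s \<Longrightarrow> B \<in> upper ord s \<Longrightarrow> A - B \<in> upper ord s"
  using upper_add[of A ord s "- B"] upper_uminus[of B ord s] by simp

lemma upper_mono: "t \<le> s \<Longrightarrow> upper ord s \<subseteq> upper ord t"
  unfolding upper_def by fastforce

lemma mat_1_upper: "mat 1 \<in> upper ord 0"
  by (simp add: upper_def mat_def)

lemma matrix_inv_upper:
  assumes "A \<in> upper ord 0" "det A \<noteq> 0"
  shows "matrix_inv A \<in> upper ord 0"
  unfolding upper_def
proof (intro CollectI allI impI)
  fix i j assume ij: "matrix_inv A $ i $ j \<noteq> 0"
  let ?S = "{v :: complex ^ 'a. \<forall>i. v $ i \<noteq> 0 \<longrightarrow> ord i \<le> ord j}"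
  have "matrix_inv A *v axis j 1 \<in> ?S"
  proof (rule matrix_inv_stable[OF assms(2)])
    show "vec.subspace ?S" unfolding vec.subspace_def by (auto, metis add_0)
    show "A *v w \<in> ?S" if "w \<in> ?S" for w
    proof (intro CollectI allI impI)
      fix i assume "(A *v w) $ i \<noteq> 0"
      then have "(\<Sum>k\<in>UNIV. A $ i $ k * w $ k) \<noteq> 0" by (simp add: matrix_vector_mult_def)
      then obtain k where "A $ i $ k * w $ k \<noteq> 0" by (meson sum.not_neutral_contains_not_neutral)
      then have "A $ i $ k \<noteq> 0" "w $ k \<noteq> 0" by auto
      then show "ord i \<le> ord j" using assms(1) that unfolding upper_def by fastforce
    qed
  qed (simp add: axis_def)
  moreover have "(matrix_inv A *v axis j 1) $ i = matrix_inv A $ i $ j"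
    by simp
  ultimately show "ord i + 0 \<le> ord j" using ij by simp
qed

lemma upper_commutator:
  assumes "inj ord" "A - mat 1 \<in> upper ord s" "B - mat 1 \<in> upper ord s"
  shows "A ** B - B ** A \<in> upper ord (Suc s)"
proof (cases s)
  case 0
  then have A: "A \<in> upper ord 0" and B: "B \<in> upper ord 0"
    using upper_add[OF assms(2)[unfolded 0] mat_1_upper] upper_add[OF assms(3)[unfolded 0] mat_1_upper] by auto
  have diag: "(A ** B) $ i $ i = A $ i $ i * B $ i $ i" if "A \<in> upper ord 0" "B \<in> upper ord 0" for A B i
  proof -
    have *: "A $ i $ k * B $ k $ i = (if k = i then A $ i $ i * B $ i $ i else 0)" for k
    proof (cases "k = i")
      case False
      then have "ord k \<noteq> ord i" using assms(1) by (auto dest: injD)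
      moreover have "A $ i $ k \<noteq> 0 \<longrightarrow> ord i \<le> ord k" "B $ k $ i \<noteq> 0 \<longrightarrow> ord k \<le> ord i"
        using that by (simp_all add: upper_def)
      ultimately have "A $ i $ k = 0 \<or> B $ k $ i = 0" by force
      then show ?thesis using False by auto
    qed simp
    have "(A ** B) $ i $ i = (\<Sum>k\<in>UNIV. if k = i then A $ i $ i * B $ i $ i else 0)"
      unfolding matrix_matrix_mult_def vec_lambda_beta by (intro sum.cong refl *)
    then show ?thesis by simp
  qed
  have "A ** B - B ** A \<in> upper ord 0"
    using upper_mult[OF A B] upper_mult[OF B A] by (intro upper_diff) auto
  moreover have "(A ** B - B ** A) $ i $ j = 0" if "ord i = ord j" for i j
  proof -
    have "i = j" using assms(1) that by (rule injD)
    then show ?thesis by (simp add: diag[OF A B] diag[OF B A])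
  qed
  ultimately show ?thesis unfolding upper_def 0 by (simp add: Suc_le_eq) (metis le_neq_implies_less)
next
  case (Suc t)
  define a b where "a = A - mat 1" and "b = B - mat 1"
  have "A ** B - B ** A = a ** b - b ** a"
    unfolding a_def b_def
    by (simp add: matrix_add_ldistrib vec_eq_iff matrix_matrix_mult_def mat_def algebra_simps sum.distrib sum_subtractf
        if_distrib[of "\<lambda>x. x * _"] if_distrib[of "\<lambda>x. _ * x"] cong: if_cong)
  also have "\<dots> \<in> upper ord (s + s)"
    using assms(2,3) by (intro upper_diff upper_mult) (auto simp: a_def b_def)
  finally show ?thesis using upper_mono[of "Suc s" "s + s" ord] Suc by auto
qed

lemma solvable_if_upper:
  fixes H :: "'n::finite cmat set"
  assumes H: "subgroup H SL" and "inj ord" and Q: "det Q \<noteq> 0"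
    and up: "\<And>h. h \<in> H \<Longrightarrow> matrix_inv Q ** h ** Q \<in> upper ord 0"
  shows "solvable (SL\<lparr>carrier := H\<rparr>)"
proof -
  define c where "c g = matrix_inv Q ** g ** Q" for g
  have c_mult: "c (g ** h) = c g ** c h" for g h
  proof -
    have "c g ** c h = matrix_inv Q ** g ** (Q ** matrix_inv Q) ** h ** Q"
      by (simp only: c_def matrix_mul_assoc)
    then show ?thesis using Q by (simp add: c_def matrix_mul_assoc)
  qed
  have c_1: "c (mat 1) = mat 1" using Q by (simp add: c_def)
  have c_inj: "g = mat 1" if "c g = mat 1" for g
  proof -
    have "Q ** c g ** matrix_inv Q = g" using Q by (simp add: c_def matrix_mul_assoc)
    then show ?thesis using that Q by simp
  qed
  have det_c: "det (c g) = det g" for g using Q by (simp add: c_def det_mul det_matrix_inv)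
  have c_inv: "c (matrix_inv g) = matrix_inv (c g)" if "det g = 1" for g
    using that by (intro matrix_inv_unique[symmetric]) (simp add: c_mult[symmetric] c_1)
  define N where "N s = {g. det g = 1 \<and> c g - mat 1 \<in> upper ord s}" for s
  have N0: "c g \<in> upper ord 0" if "g \<in> N s" for g s
  proof -
    have "c g - mat 1 \<in> upper ord 0" using that upper_mono[of 0 s ord] by (auto simp: N_def)
    from upper_add[OF this mat_1_upper] show ?thesis by simp
  qed
  have N0_inv: "c (matrix_inv g) \<in> upper ord 0" if "g \<in> N s" for g s
    using matrix_inv_upper[OF N0[OF that]] that by (simp add: c_inv det_c N_def)
  have sub: "subgroup (N s) SL" for s
    unfolding subgroup_SL_iff
  proof (intro conjI ballI)
    show "mat 1 \<in> N s" by (simp add: N_def c_1 upper_def)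
  next
    fix g assume g: "g \<in> N s"
    then show det: "det g = 1" by (simp add: N_def)
    have "c (matrix_inv g) - mat 1 = - (c (matrix_inv g) ** (c g - mat 1))"
      using det by (simp add: matrix_diff_distrib(1) c_mult[symmetric] c_1)
    moreover have "c (matrix_inv g) ** (c g - mat 1) \<in> upper ord (0 + s)"
      using g by (intro upper_mult N0_inv) (auto simp: N_def)
    ultimately show "matrix_inv g \<in> N s" using det by (simp add: N_def upper_uminus det_matrix_inv)
  next
    fix g h assume g: "g \<in> N s" and h: "h \<in> N s"
    have "c (g ** h) - mat 1 = c g ** (c h - mat 1) + (c g - mat 1)"
      by (simp add: matrix_diff_distrib(1) c_mult)
    moreover have "c g ** (c h - mat 1) \<in> upper ord (0 + s)"
      using h by (intro upper_mult N0[OF g]) (auto simp: N_def)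
    ultimately have "c (g ** h) - mat 1 \<in> upper ord s" using g upper_add by (simp only: N_def mem_Collect_eq add_0) blast
    then show "g ** h \<in> N s" using g h by (simp add: N_def det_mul)
  qed
  have "(derived SL ^^ s) H \<subseteq> N s" for s
  proof (induction s)
    case 0
    have "h \<in> N 0" if "h \<in> H" for h
      using H that upper_diff[OF up[OF that] mat_1_upper] by (simp add: N_def subgroup_SL_iff c_def)
    then show ?case by auto
  next
    case (Suc s)
    have "derived SL (N s) \<subseteq> N (Suc s)"
      unfolding derived_def
    proof (rule group.generate_subgroup_incl[OF group_SL _ sub], clarify)
      fix g h assume g: "g \<in> N s" and h: "h \<in> N s"
      have det: "det g = 1" "det h = 1" using g h by (auto simp: N_def)
      let ?k = "g ** h ** matrix_inv g ** matrix_inv h"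
      have "c g ** c h ** c (matrix_inv g) ** c (matrix_inv h) - c h ** c g ** c (matrix_inv g) ** c (matrix_inv h) = 
         (c g ** c h - c h ** c g) ** (c (matrix_inv g) ** c (matrix_inv h))"
        by (simp only: matrix_mul_assoc matrix_diff_distrib)
      moreover have "c h ** c g ** c (matrix_inv g) ** c (matrix_inv h) = mat 1"
        using det by (simp add: c_mult[symmetric] c_1)
      moreover have "(c g ** c h - c h ** c g) ** (c (matrix_inv g) ** c (matrix_inv h)) \<in> upper ord (Suc s + (0 + 0))"
        using g h assms(2) by (intro upper_mult upper_commutator N0_inv) (auto simp: N_def)
      ultimately have "c ?k - mat 1 \<in> upper ord (Suc s)" by (simp add: c_mult)
      then show "g \<otimes>\<^bsub>SL\<^esub> h \<otimes>\<^bsub>SL\<^esub> inv\<^bsub>SL\<^esub> g \<otimes>\<^bsub>SL\<^esub> inv\<^bsub>SL\<^esub> h \<in> N (Suc s)"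
        using det by (simp add: inv_SL N_def det_mul det_matrix_inv)
    qed
    moreover have "derived SL ((derived SL ^^ s) H) \<subseteq> derived SL (N s)"
      using Suc by (rule group.mono_derived[OF group_SL])
    ultimately show ?case by simp
  qed
  moreover have "N (Suc (Max (range ord))) \<subseteq> {mat 1}"
  proof
    fix g assume g: "g \<in> N (Suc (Max (range ord)))"
    have "(c g - mat 1) $ i $ j = 0" for i j
    proof (rule ccontr)
      assume "(c g - mat 1) $ i $ j \<noteq> 0"
      then have "ord i + Suc (Max (range ord)) \<le> ord j" using g unfolding N_def upper_def by blast
      moreover have "ord j \<le> Max (range ord)" by simp
      ultimately show False by simp
    qed
    then have "c g = mat 1" by (simp add: vec_eq_iff)
    then show "g \<in> {mat 1}" using c_inj by blast
  qed
  moreover have "mat 1 \<in> (derived SL ^^ s) H" for s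
    using group.exp_of_derived_is_subgroup[OF group_SL H] by (auto simp: subgroup_SL_iff)
  ultimately have "(derived SL ^^ Suc (Max (range ord))) H = {mat 1}" by blast
  then show ?thesis using solvable_SL_iff[OF H] by blast
qed

section \<open>The Borel subalgebra of the commutant of a nilpotent Jordan matrix\<close>

definition part_count :: "nat list \<Rightarrow> nat \<Rightarrow> nat" where
  "part_count xs t = card {k. k < length xs \<and> t \<le> xs ! k}"

text \<open>The dimension of a Borel subgroup of the centralizer in \<open>GL\<^sub>n\<close>, in terms of the parts
  \<open>part_count xs t\<close> of the conjugate partition.\<close>

definition borel_dim_GL :: "nat list \<Rightarrow> nat" where
  "borel_dim_GL xs = (\<Sum>l<length xs. Suc l) + (\<Sum>t=1..sum_list xs. part_count xs t * part_count xs (Suc t))"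

locale jordan_form =
  fixes xs :: "nat list" and e :: "nat \<times> nat \<Rightarrow> 'n::finite" and J :: "'n cmat"
  assumes partition: "is_partition CARD('n) xs"
    and bij: "bij_betw e {(k, i). k < length xs \<and> i < xs ! k} UNIV"
    and J: "\<And>k i l j. k < length xs \<Longrightarrow> i < xs ! k \<Longrightarrow> l < length xs \<Longrightarrow> j < xs ! l \<Longrightarrow>
           J $ e (k, i) $ e (l, j) = (if k = l \<and> j = Suc i then 1 else 0)"
begin

definition valid :: "nat \<Rightarrow> nat \<Rightarrow> bool" where "valid k i \<longleftrightarrow> k < length xs \<and> i < xs ! k"

lemma index_cases:
  obtains k i where "valid k i" "p = e (k, i)"
  using bij unfolding bij_betw_def valid_def by blast

lemma e_eq_iff: "valid k i \<Longrightarrow> valid l j \<Longrightarrow> e (k, i) = e (l, j) \<longleftrightarrow> k = l \<and> i = j"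
  using bij unfolding bij_betw_def valid_def inj_on_def by blast

lemma part_pos: "k < length xs \<Longrightarrow> 0 < xs ! k"
  using partition by (auto simp: is_partition_def)

lemma valid_0: "k < length xs \<Longrightarrow> valid k 0"
  by (simp add: valid_def part_pos)

lemma part_mono: "k \<le> l \<Longrightarrow> l < length xs \<Longrightarrow> xs ! l \<le> xs ! k"
  using partition by (auto simp: is_partition_def sorted_wrt_iff_nth_less le_less)

lemma length_pos: "0 < length xs"
proof (rule ccontr)
  assume "\<not> 0 < length xs"
  then have "CARD('n) = 0" using partition by (auto simp: is_partition_def)
  then show False by simp
qed

lemma mult_J:
  assumes "valid l j"
  shows "(A ** J) $ p $ e (l, j) = (if j = 0 then 0 else A $ p $ e (l, j - 1))"
proof -
  have "J $ m $ e (l, j) = (if m = e (l, j - 1) then if j = 0 then 0 else 1 else 0)" for m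
  proof (rule index_cases[of m])
    fix k i assume m: "valid k i" "m = e (k, i)"
    have "valid l (j - 1)" using assms by (auto simp: valid_def)
    with m assms J[of k i l j] show ?thesis by (auto simp: e_eq_iff) (auto simp: valid_def)
  qed
  then show ?thesis by (simp add: matrix_matrix_mult_def if_distrib[of "\<lambda>x. _ * x"] cong: if_cong)
qed

lemma J_mult:
  assumes "valid k i"
  shows "(J ** A) $ e (k, i) $ q = (if Suc i < xs ! k then A $ e (k, Suc i) $ q else 0)"
proof -
  have "J $ e (k, i) $ m = (if m = e (k, Suc i) then if Suc i < xs ! k then 1 else 0 else 0)" for m
  proof (rule index_cases[of m])
    fix l j assume m: "valid l j" "m = e (l, j)"
    show ?thesis
    proof (cases "Suc i < xs ! k")
      case True
      then have "valid k (Suc i)" using assms by (simp add: valid_def)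
      with m assms J[of k i l j] True show ?thesis by (auto simp: e_eq_iff) (auto simp: valid_def)
    next
      case False
      with m assms J[of k i l j] show ?thesis by (auto simp: valid_def)
    qed
  qed
  then show ?thesis by (simp add: matrix_matrix_mult_def if_distrib[of "\<lambda>x. x * _"] cong: if_cong)
qed

lemma commute_J_iff:
  "A ** J = J ** A \<longleftrightarrow> (\<forall>k i l j. valid k i \<and> valid l j \<longrightarrow>
     (if j = 0 then 0 else A $ e (k, i) $ e (l, j - 1)) =
     (if Suc i < xs ! k then A $ e (k, Suc i) $ e (l, j) else 0))" (is "_ \<longleftrightarrow> ?R")
proof
  assume "A ** J = J ** A"
  then show ?R using mult_J J_mult by (metis (no_types, lifting))
next
  assume R: ?R
  have "(A ** J) $ p $ q = (J ** A) $ p $ q" for p q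
  proof (rule index_cases[of p], rule index_cases[of q])
    fix k i l j assume *: "valid k i" "p = e (k, i)" "valid l j" "q = e (l, j)"
    then show ?thesis using R[rule_format, of k i l j] by (simp only: mult_J J_mult)
  qed
  then show "A ** J = J ** A" by (simp add: vec_eq_iff)
qed

definition borel_alg :: "'n cmat set" where
  "borel_alg = {A. A ** J = J ** A \<and>
     (\<forall>k<length xs. \<forall>l<k. A $ e (k, 0) $ e (l, 0) = 0)}"

text \<open>The entries in the first rows of the blocks that may be nonzero; they determine a matrix in
  \<open>borel_alg\<close>, whose blocks are Toeplitz.\<close>

definition free_index :: "nat \<Rightarrow> nat \<Rightarrow> nat \<Rightarrow> bool" where
  "free_index k l s \<longleftrightarrow> k < length xs \<and> l < length xs \<and> s < xs ! l \<and> xs ! l \<le> s + xs ! k \<and> (s = 0 \<longrightarrow> k \<le> l)"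

lemma borel_alg_iff:
  "A \<in> borel_alg \<longleftrightarrow> (\<forall>k i l j. valid k i \<and> valid l j \<longrightarrow>
     A $ e (k, i) $ e (l, j) = (if i \<le> j \<and> free_index k l (j - i) then A $ e (k, 0) $ e (l, j - i) else 0))"
  (is "_ \<longleftrightarrow> ?R")
proof
  assume A: "A \<in> borel_alg"
  then have comm: "\<And>k i l j. valid k i \<Longrightarrow> valid l j \<Longrightarrow>
     (if j = 0 then 0 else A $ e (k, i) $ e (l, j - 1)) =
     (if Suc i < xs ! k then A $ e (k, Suc i) $ e (l, j) else 0)"
    by (simp add: borel_alg_def commute_J_iff)
  have shift: "A $ e (k, Suc i) $ e (l, j) = (if j = 0 then 0 else A $ e (k, i) $ e (l, j - 1))"
    if "valid k (Suc i)" "valid l j" for k i l j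
    using comm[of k i l j] that by (simp add: valid_def)
  have toep: "A $ e (k, i) $ e (l, j) = (if i \<le> j then A $ e (k, 0) $ e (l, j - i) else 0)"
    if "valid k i" "valid l j" for k i l j
    using that
  proof (induction i arbitrary: j)
    case (Suc i)
    then have "valid k i" by (simp add: valid_def)
    with Suc show ?case
      by (cases j) (simp_all add: shift valid_def)
  qed simp
  have "A $ e (k, 0) $ e (l, s) = 0" if "k < length xs" "valid l s" "\<not> free_index k l s" for k l s
  proof (cases "s + xs ! k < xs ! l")
    case True
    have "valid k (xs ! k - 1)" using that part_pos by (auto simp: valid_def)
    moreover have "valid l (s + xs ! k)" using True that by (auto simp: valid_def)
    ultimately have "A $ e (k, xs ! k - 1) $ e (l, s + xs ! k - 1) = 0"
      using comm[of k "xs ! k - 1" l "s + xs ! k"] part_pos[OF that(1)] by (simp split: if_splits)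
    moreover have "valid l (s + xs ! k - 1)" using True that by (auto simp: valid_def)
    moreover have eq: "s + xs ! k - 1 - (xs ! k - 1) = s" "xs ! k - 1 \<le> s + xs ! k - 1"
      using part_pos[OF that(1)] by simp_all
    ultimately show ?thesis
      using toep[of k "xs ! k - 1" l "s + xs ! k - 1"] \<open>valid k (xs ! k - 1)\<close>
      by (simp only: eq if_True simp_thms)
  next
    case False
    then have "s = 0" "l < k" using that by (auto simp: free_index_def valid_def)
    then show ?thesis using A that(1) by (simp add: borel_alg_def)
  qed
  note zero = this
  show ?R
  proof (intro allI impI)
    fix k i l j assume *: "valid k i \<and> valid l j"
    then have v: "k < length xs" "valid l (j - i)" by (auto simp: valid_def)
    show "A $ e (k, i) $ e (l, j) = (if i \<le> j \<and> free_index k l (j - i) then A $ e (k, 0) $ e (l, j - i) else 0)"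
      unfolding toep[OF conjunct1[OF *] conjunct2[OF *]] using zero[OF v] by simp
  qed
next
  assume R: ?R
  have "A ** J = J ** A"
    unfolding commute_J_iff
  proof (intro allI impI)
    fix k i l j assume v: "valid k i \<and> valid l j"
    show "(if j = 0 then 0 else A $ e (k, i) $ e (l, j - 1)) = (if Suc i < xs ! k then A $ e (k, Suc i) $ e (l, j) else 0)"
    proof (cases "Suc i < xs ! k")
      case True
      then have "valid k (Suc i)" "valid l (j - 1)" using v by (auto simp: valid_def)
      then show ?thesis using v R True by (cases j) simp_all
    next
      case False
      then have i: "Suc i = xs ! k" using v by (auto simp: valid_def)
      have "valid l (j - 1)" using v by (auto simp: valid_def)
      moreover have "\<not> free_index k l (j - 1 - i)" if "j \<noteq> 0" "i \<le> j - 1"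
        using that i v by (auto simp: free_index_def valid_def)
      ultimately show ?thesis using v R False by auto
    qed
  qed
  moreover have "A $ e (k, 0) $ e (l, 0) = 0" if "k < length xs" "l < k" for k l
    using that R[rule_format, of k 0 l 0] valid_0 by (simp add: free_index_def)
  ultimately show "A \<in> borel_alg" by (simp add: borel_alg_def)
qed

definition free_entries :: "('n \<times> 'n) set" where
  "free_entries = {(e (k, 0), e (l, s)) | k l s. free_index k l s}"

lemma free_index_valid: "free_index k l s \<Longrightarrow> valid k 0 \<and> valid l s"
  by (auto simp: free_index_def valid_def part_pos)

lemma free_entries_iff:
  assumes "valid k i" "valid l j"
  shows "(e (k, i), e (l, j)) \<in> free_entries \<longleftrightarrow> i = 0 \<and> free_index k l j"
  using assms free_index_valid unfolding free_entries_def by (auto simp: e_eq_iff)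

definition toeplitz_fill :: "'n cmat \<Rightarrow> 'n cmat" where
  "toeplitz_fill A = (\<chi> p q. 
     let (k, i) = inv_into {(k, i). valid k i} e p; (l, j) = inv_into {(k, i). valid k i} e q
     in if 0 < i \<and> i \<le> j \<and> free_index k l (j - i) then A $ e (k, 0) $ e (l, j - i) else 0)"

lemma toeplitz_fill_entry:
  assumes "valid k i" "valid l j"
  shows "toeplitz_fill A $ e (k, i) $ e (l, j) =
    (if 0 < i \<and> i \<le> j \<and> free_index k l (j - i) then A $ e (k, 0) $ e (l, j - i) else 0)"
proof -
  have inj: "inj_on e {(k, i). valid k i}" by (auto simp: inj_on_def e_eq_iff)
  have "inv_into {(k, i). valid k i} e (e (k, i)) = (k, i)" if "valid k i" for k i
    using that by (intro inv_into_f_f[OF inj]) simp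
  then show ?thesis using assms by (simp add: toeplitz_fill_def)
qed

lemma matrix_eqI:
  assumes "\<And>k i l j. valid k i \<Longrightarrow> valid l j \<Longrightarrow> A $ e (k, i) $ e (l, j) = B $ e (k, i) $ e (l, j)"
  shows "A = B"
  unfolding vec_eq_iff by (metis assms index_cases)

lemma borel_alg_eq:
  "borel_alg = {A. \<forall>p q. (p, q) \<notin> free_entries \<longrightarrow> A $ p $ q = toeplitz_fill A $ p $ q}"
proof (intro equalityI subsetI)
  fix A assume A: "A \<in> borel_alg"
  have "A $ p $ q = toeplitz_fill A $ p $ q" if "(p, q) \<notin> free_entries" for p q
  proof (rule index_cases[of p], rule index_cases[of q])
    fix k i l j assume *: "valid k i" "p = e (k, i)" "valid l j" "q = e (l, j)"
    then have "i = 0 \<Longrightarrow> \<not> free_index k l j" using that by (simp add: free_entries_iff)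
    then show ?thesis
      using * A[unfolded borel_alg_iff, rule_format, of k i l j] by (auto simp: toeplitz_fill_entry)
  qed
  then show "A \<in> {A. \<forall>p q. (p, q) \<notin> free_entries \<longrightarrow> A $ p $ q = toeplitz_fill A $ p $ q}" by blast
next
  fix A assume "A \<in> {A. \<forall>p q. (p, q) \<notin> free_entries \<longrightarrow> A $ p $ q = toeplitz_fill A $ p $ q}"
  then have A: "\<And>p q. (p, q) \<notin> free_entries \<Longrightarrow> A $ p $ q = toeplitz_fill A $ p $ q" by blast
  show "A \<in> borel_alg"
    unfolding borel_alg_iff
  proof (intro allI impI)
    fix k i l j assume *: "valid k i \<and> valid l j"
    show "A $ e (k, i) $ e (l, j) = (if i \<le> j \<and> free_index k l (j - i) then A $ e (k, 0) $ e (l, j - i) else 0)"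
      using * A[of "e (k, i)" "e (l, j)"] by (cases "i = 0") (auto simp: free_entries_iff toeplitz_fill_entry)
  qed
qed

lemma card_free_entries: "card free_entries = borel_dim_GL xs"
proof -
  define F where "F = {(k, l, s). free_index k l s}"
  define r where "r = length xs"
  have "inj_on (\<lambda>(k, l, s). (e (k, 0), e (l, s))) F"
    using free_index_valid by (auto simp: inj_on_def F_def e_eq_iff)
  moreover have "(\<lambda>(k, l, s). (e (k, 0), e (l, s))) ` F = free_entries"
    by (force simp: F_def free_entries_def)
  ultimately have "card free_entries = card F" by (metis card_image)
  define Z where "Z = (SIGMA l:{..<r}. {..l})"
  define P where "P = (SIGMA t:{1..sum_list xs}. {k. k < r \<and> t \<le> xs ! k} \<times> {l. l < r \<and> Suc t \<le> xs ! l})"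
  have le: "xs ! l \<le> sum_list xs + s" if "l < length xs" for l s
    using that elem_le_sum_list[of l xs] by simp
  have "bij_betw (\<lambda>(k, l, s). (l, k)) {(k, l, s). free_index k l s \<and> s = 0} Z"
    by (rule bij_betw_byWitness[where f' = "\<lambda>(l, k). (k, l, 0)"])
       (auto simp: Z_def r_def free_index_def part_pos part_mono)
  then have 1: "card {(k, l, s). free_index k l s \<and> s = 0} = card Z" by (rule bij_betw_same_card)
  have "bij_betw (\<lambda>(k, l, s). (xs ! l - s, (k, l))) {(k, l, s). free_index k l s \<and> s \<noteq> 0} P"
    by (rule bij_betw_byWitness[where f' = "\<lambda>(t, (k, l)). (k, l, xs ! l - t)"])
       (auto simp: P_def r_def free_index_def le_diff_conv Suc_le_eq le)
  then have 2: "card {(k, l, s). free_index k l s \<and> s \<noteq> 0} = card P" by (rule bij_betw_same_card)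
  have fin: "finite Z" "finite P" by (auto simp: Z_def P_def)
  have "finite F" using \<open>inj_on _ F\<close> by (rule inj_on_finite[of _ _ UNIV]) auto
  have "F = {(k, l, s). free_index k l s \<and> s = 0} \<union> {(k, l, s). free_index k l s \<and> s \<noteq> 0}"
    by (auto simp: F_def)
  then have "card F = card ({(k, l, s). free_index k l s \<and> s = 0} \<union> {(k, l, s). free_index k l s \<and> s \<noteq> 0})"
    by simp
  also have "\<dots> = card Z + card P"
    using \<open>finite F\<close> unfolding 1[symmetric] 2[symmetric]
    by (intro card_Un_disjoint) (auto simp: F_def elim!: finite_subset[rotated])
  also have "card Z = (\<Sum>l<r. Suc l)" by (simp add: Z_def)
  also have "card P = (\<Sum>t=1..sum_list xs. part_count xs t * part_count xs (Suc t))"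
    by (simp add: P_def part_count_def r_def card_cartesian_product)
  finally show ?thesis using \<open>card free_entries = card F\<close> by (simp add: borel_dim_GL_def r_def)
qed

lemma borel_alg_corner_nonzero:
  assumes "A \<in> borel_alg" "det A \<noteq> 0"
  shows "A $ e (0, 0) $ e (0, 0) \<noteq> 0"
proof
  assume 0: "A $ e (0, 0) $ e (0, 0) = 0"
  have "A $ p $ e (0, 0) = 0" for p
  proof (rule index_cases[of p])
    fix k i assume "valid k i" "p = e (k, i)"
    then show ?thesis
      using assms(1)[unfolded borel_alg_iff, rule_format, of k i 0 0] 0 valid_0 length_pos by (auto simp: free_index_def)
  qed
  then have "A *v axis (e (0, 0)) 1 = 0" by (simp add: vec_eq_iff)
  moreover have "inj ((*v) A)" using assms(2) by (simp add: inj_matrix_vec_iff)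
  ultimately have "axis (e (0, 0)) (1 :: complex) = 0" by (metis injD matrix_vector_mult_0_right)
  then show False by (simp add: axis_eq_0_iff)
qed

lemma complex_submanifold_borel_alg:
  "complex_submanifold (borel_dim_GL xs - 1) {g \<in> borel_alg. det g = 1}"
  unfolding card_free_entries[symmetric] borel_alg_eq
proof (rule complex_submanifold_det_one)
  show "linear toeplitz_fill"
    by (rule linearI) (auto intro!: matrix_eqI simp: toeplitz_fill_entry)
  show "toeplitz_fill (mat c ** A) = mat c ** toeplitz_fill A" for c A
    by (auto intro!: matrix_eqI simp: toeplitz_fill_entry)
  show fill_free: "toeplitz_fill A $ p $ q = 0" if "(p, q) \<in> free_entries" for A p q
    using that by (auto simp: free_entries_def toeplitz_fill_entry free_index_valid)
  show "toeplitz_fill (toeplitz_fill A) = 0" for A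
    using free_index_valid by (intro matrix_eqI) (auto simp: toeplitz_fill_entry)
  show "(e (0, 0), e (0, 0)) \<in> free_entries"
    using length_pos by (simp add: free_entries_iff valid_0 free_index_def part_pos)
  show "g $ e (0, 0) $ e (0, 0) \<noteq> 0"
    if "g \<in> {A. \<forall>p q. (p, q) \<notin> free_entries \<longrightarrow> A $ p $ q = toeplitz_fill A $ p $ q}" "det g = 1" for g
    using borel_alg_corner_nonzero[of g] that unfolding borel_alg_eq by simp
qed

definition position_order :: "'n \<Rightarrow> nat" where
  "position_order p = (let (k, i) = inv_into {(k, i). valid k i} e p in i * length xs + k)"

lemma position_order: "valid k i \<Longrightarrow> position_order (e (k, i)) = i * length xs + k"
proof -
  assume v: "valid k i"
  have inj: "inj_on e {(k, i). valid k i}" by (auto simp: inj_on_def e_eq_iff)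
  have "inv_into {(k, i). valid k i} e (e (k, i)) = (k, i)"
    using v by (intro inv_into_f_f[OF inj]) simp
  then show ?thesis by (simp add: position_order_def)
qed

lemma inj_position_order: "inj position_order"
proof (rule injI)
  fix p q assume eq: "position_order p = position_order q"
  show "p = q"
  proof (rule index_cases[of p], rule index_cases[of q])
    fix k i l j assume *: "valid k i" "p = e (k, i)" "valid l j" "q = e (l, j)"
    then have "i * length xs + k = j * length xs + l" "k < length xs" "l < length xs"
      using eq by (auto simp: position_order valid_def)
    then have "(i * length xs + k) div length xs = (j * length xs + l) div length xs"
      "(i * length xs + k) mod length xs = (j * length xs + l) mod length xs" by simp_all
    then show "p = q" using * \<open>k < length xs\<close> \<open>l < length xs\<close> length_pos by (simp add: div_mult_self3)
  qed
qed

lemma borel_alg_upper: "borel_alg \<subseteq> upper position_order 0"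
proof
  fix A assume A: "A \<in> borel_alg"
  show "A \<in> upper position_order 0"
    unfolding upper_def
  proof (intro CollectI allI impI)
    fix p q assume nz: "A $ p $ q \<noteq> 0"
    show "position_order p + 0 \<le> position_order q"
    proof (rule index_cases[of p], rule index_cases[of q])
      fix k i l j assume *: "valid k i" "p = e (k, i)" "valid l j" "q = e (l, j)"
      then have ij: "i \<le> j" "free_index k l (j - i)"
        using A[unfolded borel_alg_iff, rule_format, of k i l j] nz by (auto split: if_splits)
      show ?thesis
      proof (cases "i = j")
        case True
        then show ?thesis using ij * by (auto simp: position_order free_index_def)
      next
        case False
        then have "Suc i * length xs \<le> j * length xs" using ij by (intro mult_right_mono) auto
        moreover have "k < length xs" using * by (auto simp: valid_def)
        ultimately show ?thesis using * by (simp add: position_order)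
      qed
    qed
  qed
qed

lemma subspace_borel_alg: "subspace borel_alg"
  unfolding subspace_def borel_alg_def
  by (auto simp: matrix_add_ldistrib vec_eq_iff matrix_matrix_mult_def algebra_simps sum.distrib simp flip: scaleR_sum_right)

lemma borel_alg_mat_1: "mat 1 \<in> borel_alg"
proof -
  have "(mat 1 :: 'n cmat) $ e (k, 0) $ e (l, 0) = 0" if "k < length xs" "l < k" for k l
    using that valid_0[of k] valid_0[of l] by (simp add: mat_def e_eq_iff)
  then show ?thesis by (simp add: borel_alg_def)
qed

lemma borel_alg_stable_iff:
  "A \<in> borel_alg \<longleftrightarrow> A ** J = J ** A \<and>
     (\<forall>m<length xs. \<forall>w. (\<forall>k i. valid k i \<longrightarrow> w $ e (k, i) \<noteq> 0 \<longrightarrow> i = 0 \<and> k \<le> m) \<longrightarrow>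
        (\<forall>k i. valid k i \<longrightarrow> (A *v w) $ e (k, i) \<noteq> 0 \<longrightarrow> i = 0 \<and> k \<le> m))" (is "_ \<longleftrightarrow> _ \<and> ?S")
proof (intro iffI conjI)
  assume A: "A \<in> borel_alg"
  then show "A ** J = J ** A" by (simp add: borel_alg_def)
  show ?S
  proof (intro allI impI)
    fix m w k i assume w: "\<forall>k i. valid k i \<longrightarrow> w $ e (k, i) \<noteq> 0 \<longrightarrow> i = 0 \<and> k \<le> m"
      and ki: "valid k i" "(A *v w) $ e (k, i) \<noteq> 0"
    then have "(\<Sum>q\<in>UNIV. A $ e (k, i) $ q * w $ q) \<noteq> 0" by (simp add: matrix_vector_mult_def)
    then obtain q where q: "A $ e (k, i) $ q * w $ q \<noteq> 0" by (meson sum.not_neutral_contains_not_neutral)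
    obtain l j where lj: "valid l j" "q = e (l, j)" by (rule index_cases)
    then have "j = 0" "l \<le> m" using q w by auto
    moreover have "i \<le> j \<and> free_index k l (j - i)"
      using A[unfolded borel_alg_iff, rule_format, of k i l j] q lj ki by (auto split: if_splits)
    ultimately show "i = 0 \<and> k \<le> m" by (auto simp: free_index_def)
  qed
next
  assume *: "A ** J = J ** A \<and> ?S"
  note comm = conjunct1[OF *] and S = conjunct2[OF *]
  have "A $ e (k, 0) $ e (l, 0) = 0" if "k < length xs" "l < k" for k l
  proof (rule ccontr)
    assume nz: "A $ e (k, 0) $ e (l, 0) \<noteq> 0"
    have l: "l < length xs" using that by simp
    have "(A *v axis (e (l, 0)) 1) $ e (k, 0) \<noteq> 0" using nz by simp
    have "i' = 0 \<and> k' \<le> l" if "valid k' i'" "axis (e (l, 0)) (1 :: complex) $ e (k', i') \<noteq> 0" for k' i'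
      using that valid_0[OF l] by (auto simp: axis_def e_eq_iff split: if_splits)
    then have w: "\<forall>k' i'. valid k' i' \<longrightarrow> axis (e (l, 0)) (1 :: complex) $ e (k', i') \<noteq> 0 \<longrightarrow> i' = 0 \<and> k' \<le> l"
      by simp
    have "0 = (0::nat) \<and> k \<le> l"
      using S[THEN spec, THEN mp, OF l, THEN spec, THEN mp, OF w, THEN spec, THEN spec, THEN mp, OF valid_0[OF that(1)], THEN mp] nz
      by simp
    then have "k \<le> l" by simp
    then show False using that by simp
  qed
  then show "A \<in> borel_alg" using comm by (simp add: borel_alg_def)
qed

lemma borel_alg_mult:
  assumes "A \<in> borel_alg" "B \<in> borel_alg"
  shows "A ** B \<in> borel_alg"
  unfolding borel_alg_stable_iff
proof
  have "A ** B ** J = A ** (J ** B)" using assms(2) by (simp add: borel_alg_def flip: matrix_mul_assoc)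
  also have "\<dots> = J ** (A ** B)" using assms(1) by (simp add: borel_alg_def matrix_mul_assoc)
  finally show "A ** B ** J = J ** (A ** B)" .
  show "\<forall>m<length xs. \<forall>w. (\<forall>k i. valid k i \<longrightarrow> w $ e (k, i) \<noteq> 0 \<longrightarrow> i = 0 \<and> k \<le> m) \<longrightarrow>
        (\<forall>k i. valid k i \<longrightarrow> (A ** B *v w) $ e (k, i) \<noteq> 0 \<longrightarrow> i = 0 \<and> k \<le> m)"
  proof (intro allI impI)
    fix m w k i
    assume m: "m < length xs" and w: "\<forall>k i. valid k i \<longrightarrow> w $ e (k, i) \<noteq> 0 \<longrightarrow> i = 0 \<and> k \<le> m"
      and ki: "valid k i" "(A ** B *v w) $ e (k, i) \<noteq> 0"
    note st = conjunct2[OF assms(1)[unfolded borel_alg_stable_iff], rule_format, OF m]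
      conjunct2[OF assms(2)[unfolded borel_alg_stable_iff], rule_format, OF m]
    have B: "i = 0 \<and> k \<le> m" if "valid k i" "(B *v w) $ e (k, i) \<noteq> 0" for k i
      by (rule st(2)[of w, OF _ that]) (use w in blast)
    show "i = 0 \<and> k \<le> m"
      by (rule st(1)[of "B *v w", OF B ki(1)]) (use ki(2) in \<open>simp_all add: matrix_vector_mul_assoc\<close>)
  qed
qed

lemma borel_alg_inv:
  assumes "A \<in> borel_alg" "det A \<noteq> 0"
  shows "matrix_inv A \<in> borel_alg"
  unfolding borel_alg_stable_iff
proof (intro conjI allI impI)
  have "matrix_inv A ** (A ** J) ** matrix_inv A = matrix_inv A ** (J ** A) ** matrix_inv A"
    using assms(1) by (simp add: borel_alg_def)
  then show "matrix_inv A ** J = J ** matrix_inv A"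
    using assms(2) by (simp add: matrix_mul_assoc)
next
  fix m w k i
  assume m: "m < length xs" and w: "\<forall>k i. valid k i \<longrightarrow> w $ e (k, i) \<noteq> 0 \<longrightarrow> i = 0 \<and> k \<le> m"
    and ki: "valid k i" "(matrix_inv A *v w) $ e (k, i) \<noteq> 0"
  let ?S = "{w :: complex ^ 'n. \<forall>k i. valid k i \<longrightarrow> w $ e (k, i) \<noteq> 0 \<longrightarrow> i = 0 \<and> k \<le> m}"
  have "matrix_inv A *v w \<in> ?S"
  proof (rule matrix_inv_stable[OF assms(2)])
    show "vec.subspace ?S" unfolding vec.subspace_def by (auto; metis add_0)
    show "A *v w \<in> ?S" if "w \<in> ?S" for w
      using assms(1)[unfolded borel_alg_stable_iff] m that by blast
  qed (use w in blast)
  then show "i = 0" "k \<le> m" using ki by auto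
qed

end

section \<open>Borel subgroups of the centralizer\<close>

lemma identity_component_subgroup:
  fixes M :: "'n::finite cmat set"
  assumes M: "subgroup M SL"
  shows "subgroup (connected_component_set M (mat 1)) SL"
  unfolding subgroup_SL_iff
proof (intro conjI ballI)
  show "mat 1 \<in> connected_component_set M (mat 1)"
    using M by (simp add: subgroup_SL_iff)
next
  fix g assume g: "g \<in> connected_component_set M (mat 1)"
  then have gM: "g \<in> M" using connected_component_subset by blast
  then show det: "det g = 1" using M by (simp add: subgroup_SL_iff)
  obtain T where T: "connected T" "T \<subseteq> M" "mat 1 \<in> T" "g \<in> T"
    using g unfolding connected_component_def mem_Collect_eq by blast
  have "connected (matrix_inv ` T)"
    using T(1,2) M by (intro connected_continuous_image continuous_on_subset[OF continuous_on_matrix_inv])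
      (auto simp: subgroup_SL_iff subset_iff)
  moreover have "matrix_inv ` T \<subseteq> M" using T(2) M by (auto simp: subgroup_SL_iff)
  moreover have "mat 1 \<in> matrix_inv ` T"
    using T(3) by (intro image_eqI[of _ _ "mat 1"]) (simp_all add: matrix_inv_unique)
  ultimately show "matrix_inv g \<in> connected_component_set M (mat 1)"
    unfolding connected_component_def using T(4) by blast
  fix h assume "h \<in> connected_component_set M (mat 1)"
  then have "connected_component M g (g ** h)"
    using connected_translate_component[OF M gM] by simp
  then show "g ** h \<in> connected_component_set M (mat 1)"
    using g connected_component_trans by fastforce
qed

lemma matrix_inv_commute:
  fixes g X :: "'n::finite cmat"
  assumes "g ** X = X ** g" "det g \<noteq> 0"
  shows "matrix_inv g ** X = X ** matrix_inv g"
proof -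
  have "matrix_inv g ** (g ** X) ** matrix_inv g = matrix_inv g ** (X ** g) ** matrix_inv g"
    by (simp add: assms(1))
  then show ?thesis using assms(2) by (simp add: matrix_mul_assoc)
qed

lemma subgroup_SL_centralizer: "subgroup (SL_centralizer X) SL"
  unfolding subgroup_SL_iff
proof (intro conjI ballI)
  fix g h assume "g \<in> SL_centralizer X" "h \<in> SL_centralizer X"
  then have gh: "det g = 1" "g ** X = X ** g" "det h = 1" "h ** X = X ** h" by (auto simp: SL_centralizer_def)
  have "g ** h ** X = X ** (g ** h)"
    by (metis gh(2,4) matrix_mul_assoc)
  then show "g ** h \<in> SL_centralizer X" using gh by (simp add: SL_centralizer_def det_mul)
qed (auto simp: SL_centralizer_def det_matrix_inv intro: matrix_inv_commute)

context jordan_form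
begin

definition frame :: "'n cmat \<Rightarrow> 'n cmat \<Rightarrow> bool" where
  "frame X Q \<longleftrightarrow> det Q \<noteq> 0 \<and> X ** Q = Q ** J"

definition tri_group :: "'n cmat \<Rightarrow> 'n cmat set" where
  "tri_group Q = {g. det g = 1 \<and> matrix_inv Q ** g ** Q \<in> borel_alg}"

text \<open>\<open>tri_group Q\<close> is disconnected if the parts of \<open>xs\<close> have a common divisor greater than \<open>1\<close>.\<close>

definition borel_of :: "'n cmat \<Rightarrow> 'n cmat set" where
  "borel_of Q = connected_component_set (tri_group Q) (mat 1)"

lemma conj_mult:
  fixes Q g h :: "'n cmat"
  assumes "det Q \<noteq> 0"
  shows "matrix_inv Q ** (g ** h) ** Q = (matrix_inv Q ** g ** Q) ** (matrix_inv Q ** h ** Q)"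
proof -
  have "(matrix_inv Q ** g ** Q) ** (matrix_inv Q ** h ** Q) = matrix_inv Q ** g ** (Q ** matrix_inv Q) ** h ** Q"
    by (simp only: matrix_mul_assoc)
  then show ?thesis using assms by (simp add: matrix_mul_assoc)
qed

lemma det_conj:
  fixes Q g :: "'n cmat"
  assumes "det Q \<noteq> 0"
  shows "det (matrix_inv Q ** g ** Q) = det g"
  using assms by (simp add: det_mul det_matrix_inv)

lemma tri_group_eq_image:
  assumes "det Q \<noteq> 0"
  shows "tri_group Q = (\<lambda>A. Q ** A ** matrix_inv Q) ` {g \<in> borel_alg. det g = 1}"
proof (intro equalityI subsetI)
  fix g assume g: "g \<in> tri_group Q"
  have "g = Q ** (matrix_inv Q ** g ** Q) ** matrix_inv Q"
    using assms by (simp add: matrix_mul_assoc)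
  then show "g \<in> (\<lambda>A. Q ** A ** matrix_inv Q) ` {g \<in> borel_alg. det g = 1}"
    using g det_conj[OF assms, of g] by (intro image_eqI[where x = "matrix_inv Q ** g ** Q"]) (auto simp: tri_group_def)
next
  fix g assume "g \<in> (\<lambda>A. Q ** A ** matrix_inv Q) ` {g \<in> borel_alg. det g = 1}"
  then obtain A where "A \<in> borel_alg" "det A = 1" "g = Q ** A ** matrix_inv Q" by blast
  then show "g \<in> tri_group Q"
    using assms by (simp add: tri_group_def det_mul det_matrix_inv matrix_mul_assoc)
qed

lemma subgroup_tri_group:
  assumes "det Q \<noteq> 0"
  shows "subgroup (tri_group Q) SL"
  unfolding subgroup_SL_iff
proof (intro conjI ballI)
  show "mat 1 \<in> tri_group Q" using assms borel_alg_mat_1 by (simp add: tri_group_def)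
next
  fix g assume g: "g \<in> tri_group Q"
  then show det: "det g = 1" by (simp add: tri_group_def)
  have "matrix_inv (matrix_inv Q ** g ** Q) = matrix_inv Q ** matrix_inv g ** Q"
    using assms det by (intro matrix_inv_unique) (simp flip: conj_mult)
  then show "matrix_inv g \<in> tri_group Q"
    using g det borel_alg_inv[of "matrix_inv Q ** g ** Q"] det_conj[OF assms, of g]
    by (simp add: tri_group_def det_matrix_inv)
  fix h assume "h \<in> tri_group Q"
  then show "g ** h \<in> tri_group Q"
    using g borel_alg_mult by (simp add: tri_group_def det_mul conj_mult[OF assms])
qed

lemma mat_1_borel_of: "det Q \<noteq> 0 \<Longrightarrow> mat 1 \<in> borel_of Q"
  using subgroup_tri_group[of Q] by (simp add: borel_of_def subgroup_SL_iff)

lemma borel_of_subset: "borel_of Q \<subseteq> tri_group Q"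
  unfolding borel_of_def by (rule connected_component_subset)

lemma subset_borel_of: "connected H \<Longrightarrow> mat 1 \<in> H \<Longrightarrow> H \<subseteq> tri_group Q \<Longrightarrow> H \<subseteq> borel_of Q"
  unfolding borel_of_def by (rule connected_component_maximal)

lemma complex_dim_borel_of:
  assumes "det Q \<noteq> 0"
  shows "complex_dim (borel_of Q) = borel_dim_GL xs - 1"
proof (rule complex_dim_eqI)
  show "complex_submanifold (borel_dim_GL xs - 1) (borel_of Q)"
    unfolding borel_of_def tri_group_eq_image[OF assms]
    by (intro complex_submanifold_component complex_submanifold_conj complex_submanifold_borel_alg assms)
  show "borel_of Q \<noteq> {}" using mat_1_borel_of[OF assms] by blast
qed

lemma tri_group_centralizer:
  assumes "frame X Q"
  shows "tri_group Q \<subseteq> SL_centralizer X"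
proof
  fix g assume g: "g \<in> tri_group Q"
  have Q: "det Q \<noteq> 0" "X ** Q = Q ** J" using assms by (auto simp: frame_def)
  let ?c = "matrix_inv Q ** g ** Q"
  have X: "X = Q ** J ** matrix_inv Q" using Q by (simp flip: Q(2))
  have "g = Q ** ?c ** matrix_inv Q" using Q by (simp add: matrix_mul_assoc)
  then have "g ** X = Q ** ?c ** (matrix_inv Q ** Q) ** J ** matrix_inv Q" by (simp add: X matrix_mul_assoc)
  also have "\<dots> = Q ** (?c ** J) ** matrix_inv Q" using Q by (simp add: matrix_mul_assoc)
  also have "?c ** J = J ** ?c" using g by (simp add: tri_group_def borel_alg_def)
  also have "Q ** (J ** ?c) ** matrix_inv Q = X ** g" using Q by (simp add: X matrix_mul_assoc)
  finally show "g \<in> SL_centralizer X" using g by (simp add: SL_centralizer_def tri_group_def)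
qed

lemma conn_solvable_borel_of:
  assumes "frame X Q"
  shows "conn_solvable_subgroup (borel_of Q) (SL_centralizer X)"
proof -
  have Q: "det Q \<noteq> 0" using assms by (simp add: frame_def)
  have sub: "subgroup (borel_of Q) SL"
    unfolding borel_of_def by (intro identity_component_subgroup subgroup_tri_group Q)
  have "solvable (SL\<lparr>carrier := borel_of Q\<rparr>)"
  proof (rule solvable_if_upper[OF sub inj_position_order Q])
    show "matrix_inv Q ** h ** Q \<in> upper position_order 0" if "h \<in> borel_of Q" for h
      using that borel_of_subset borel_alg_upper by (auto simp: tri_group_def)
  qed
  then show ?thesis
    unfolding conn_solvable_subgroup_def subgroup_SL_subgroup[OF subgroup_SL_centralizer]
    using sub borel_of_subset tri_group_centralizer[OF assms]
    by (auto simp: borel_of_def)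
qed

lemma borel_of_subset_imp_eq:
  assumes Q: "det Q \<noteq> 0" and R: "det R \<noteq> 0" and sub: "borel_of Q \<subseteq> borel_of R"
  shows "borel_of Q = borel_of R"
proof -
  define S where "S = R ** matrix_inv Q"
  have detS: "det S \<noteq> 0" using Q R by (simp add: S_def det_mul det_matrix_inv)
  have invS: "matrix_inv S = Q ** matrix_inv R"
    using Q R by (intro matrix_inv_unique) (simp add: S_def matrix_mul_assoc)
  let ?c = "\<lambda>A. matrix_inv S ** A ** S"
  have lin: "linear ?c" by (rule linear_matrix_sandwich)
  have inj: "inj ?c"
    using detS by (intro inj_on_inverseI[of _ "\<lambda>A. S ** A ** matrix_inv S"]) (simp add: matrix_mul_assoc)
  have "?c ` borel_of R \<subseteq> borel_of Q"
  proof (rule subset_borel_of)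
    show "connected (?c ` borel_of R)"
      by (intro connected_continuous_image continuous_intros) (simp add: borel_of_def)
    show "mat 1 \<in> ?c ` borel_of R"
      using mat_1_borel_of[OF R] detS by (intro image_eqI[of _ _ "mat 1"]) auto
    show "?c ` borel_of R \<subseteq> tri_group Q"
    proof clarify
      fix g assume "g \<in> borel_of R"
      then have g: "det g = 1" "matrix_inv R ** g ** R \<in> borel_alg"
        using borel_of_subset by (auto simp: tri_group_def)
      have "matrix_inv Q ** (?c g) ** Q = matrix_inv R ** g ** R"
        unfolding invS using Q by (simp add: S_def matrix_mul_assoc)
      then show "?c g \<in> tri_group Q" using g det_conj[OF detS] by (simp add: tri_group_def)
    qed
  qed
  then have "dim (?c ` borel_of R) \<le> dim (borel_of Q)" by (rule dim_subset)
  moreover have "dim (?c ` borel_of R) = dim (borel_of R)"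
    using inj by (intro dim_image_eq lin) (auto intro: inj_on_subset)
  ultimately have span: "span (borel_of Q) = span (borel_of R)"
    by (intro dim_eq_span sub) simp
  have "borel_of R \<subseteq> borel_of Q"
  proof (rule subset_borel_of)
    show "connected (borel_of R)" by (simp add: borel_of_def)
    show "mat 1 \<in> borel_of R" by (rule mat_1_borel_of[OF R])
    show "borel_of R \<subseteq> tri_group Q"
    proof
      fix g assume g: "g \<in> borel_of R"
      let ?A = "(\<lambda>A. matrix_inv Q ** A ** Q) -` borel_alg"
      have "subspace ?A"
        by (rule linear_subspace_vimage[OF linear_matrix_sandwich subspace_borel_alg])
      moreover have "borel_of Q \<subseteq> ?A" using borel_of_subset by (auto simp: tri_group_def)
      ultimately have "span (borel_of Q) \<subseteq> ?A" by (rule span_minimal[rotated])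
      then have "g \<in> ?A" using g span span_base by blast
      moreover have "det g = 1" using g borel_of_subset by (auto simp: tri_group_def)
      ultimately show "g \<in> tri_group Q" by (simp add: tri_group_def)
    qed
  qed
  with sub show ?thesis by blast
qed

lemma J_vec:
  assumes "valid k i"
  shows "(J *v w) $ e (k, i) = (if Suc i < xs ! k then w $ e (k, Suc i) else 0)"
proof -
  have "J *v w = (J ** (\<chi> p q. w $ p)) *v axis (e (k, i)) 1"
    by (simp add: vec_eq_iff matrix_vector_mult_def axis_def matrix_matrix_mult_def
        if_distrib[of "\<lambda>x. _ * x"] cong: if_cong)
  then show ?thesis using assms by (simp add: J_mult)
qed

lemma J_axis:
  assumes "valid k i"
  shows "J *v axis (e (k, i)) 1 = (if i = 0 then 0 else axis (e (k, i - 1)) 1)"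
proof -
  have "(J *v axis (e (k, i)) 1) $ p = (if i = 0 then 0 else axis (e (k, i - 1)) (1 :: complex)) $ p" for p
  proof (rule index_cases[of p])
    fix l j assume *: "valid l j" "p = e (l, j)"
    have "valid k (i - 1)" using assms by (auto simp: valid_def)
    then show ?thesis
      unfolding matrix_vec_axis using * assms J[of l j k i] by (auto simp: axis_def e_eq_iff) (auto simp: valid_def)
  qed
  then show ?thesis by (rule iffD2[OF vec_eq_iff, OF allI])
qed

lemma J_funpow:
  assumes "valid k i"
  shows "(((*v) J ^^ t) w) $ e (k, i) = (if i + t < xs ! k then w $ e (k, i + t) else 0)"
  using assms
proof (induction t arbitrary: i)
  case 0
  then show ?case by (simp add: valid_def)
next
  case (Suc t)
  show ?case
  proof (cases "Suc i < xs ! k")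
    case True
    then have "valid k (Suc i)" using Suc.prems by (simp add: valid_def)
    with Suc True show ?thesis by (simp add: J_vec)
  next
    case False
    with Suc show ?thesis by (simp add: J_vec)
  qed
qed

lemma vec_independent_family:
  fixes u :: "nat \<Rightarrow> complex ^ 'n"
  assumes "\<And>k. k < m \<Longrightarrow> u k \<notin> vec.span (u ` {..<k})" "(\<Sum>k<m. c k *s u k) = 0" "k < m"
  shows "c k = 0"
  using assms
proof (induction m arbitrary: k)
  case (Suc m)
  have "c m = 0"
  proof (rule ccontr)
    assume c: "c m \<noteq> 0"
    have "c m *s u m = - (\<Sum>k<m. c k *s u k)" using Suc.prems(2) by (simp add: eq_neg_iff_add_eq_0 add.commute)
    then have "inverse (c m) *s (c m *s u m) = inverse (c m) *s (- (\<Sum>k<m. c k *s u k))" by simp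
    then have "u m = inverse (c m) *s (- (\<Sum>k<m. c k *s u k))" using c by simp
    also have "\<dots> \<in> vec.span (u ` {..<m})"
      by (intro vec.span_scale vec.span_neg vec.span_sum) (auto intro: vec.span_base)
    finally show False using Suc.prems(1)[of m] by simp
  qed
  moreover from this have "(\<Sum>k<m. c k *s u k) = 0" using Suc.prems(2) by simp
  ultimately show ?case using Suc.IH[of k] Suc.prems by (cases "k = m") auto
qed simp

lemma funpow_vec_commute:
  fixes X h :: "'n cmat"
  assumes "h ** X = X ** h"
  shows "h *v (((*v) X ^^ t) w) = ((*v) X ^^ t) (h *v w)"
proof (induction t)
  case (Suc t)
  have "h *v (X *v y) = X *v (h *v y)" for y by (simp add: matrix_vector_mul_assoc assms)
  then show ?case by (simp add: Suc)
qed simp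

lemma funpow_vec_linear:
  fixes X :: "'n cmat"
  shows "Vector_Spaces.linear (*s) (*s) ((*v) X ^^ t)"
proof (induction t)
  case 0 show ?case by (simp add: vec.linear_ident)
next
  case (Suc t)
  then show ?case using Vector_Spaces.linear_compose[OF Suc matrix_vector_mul_linear_gen]
    by (simp only: funpow.simps)
qed

text \<open>The frame is built one Jordan string at a time. The bottom of the \<open>m\<close>-th string is an eigenvector
  of \<open>H\<close>, modulo the earlier bottoms, in the \<open>H\<close>-stable space \<open>ker X \<inter> im X\<^bsup>xs ! m - 1\<^esup>\<close>.\<close>

lemma adapted_strings:
  assumes fr: "frame X P" and H: "conn_solvable_subgroup H (SL_centralizer X)" and "m \<le> length xs"
  shows "\<exists>w. \<forall>k<m. ((*v) X ^^ (xs ! k)) (w k) = 0 \<and>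
     ((*v) X ^^ (xs ! k - 1)) (w k) \<notin> vec.span ((\<lambda>k. ((*v) X ^^ (xs ! k - 1)) (w k)) ` {..<k}) \<and>
     stable H (vec.span ((\<lambda>k. ((*v) X ^^ (xs ! k - 1)) (w k)) ` {..<Suc k}))"
  using assms(3)
proof (induction m)
  case (Suc m)
  from Suc.IH[OF Suc_leD[OF Suc.prems]] obtain w where w0: "\<forall>k<m. ((*v) X ^^ (xs ! k)) (w k) = 0 \<and>
     ((*v) X ^^ (xs ! k - 1)) (w k) \<notin> vec.span ((\<lambda>k. ((*v) X ^^ (xs ! k - 1)) (w k)) ` {..<k}) \<and>
     stable H (vec.span ((\<lambda>k. ((*v) X ^^ (xs ! k - 1)) (w k)) ` {..<Suc k}))" by (elim exE)
  note w1 = w0[THEN spec, THEN mp]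
  note w = conjunct1[OF w1] conjunct1[OF conjunct2[OF w1]] conjunct2[OF conjunct2[OF w1]]
  define u where "u k = ((*v) X ^^ (xs ! k - 1)) (w k)" for k
  have m: "m < length xs" using Suc.prems by simp
  have P: "det P \<noteq> 0" "X ** P = P ** J" using fr by (auto simp: frame_def)
  have Hsub: "subgroup H SL" "H \<subseteq> SL_centralizer X" and Hconn: "connected H" "solvable (SL\<lparr>carrier := H\<rparr>)"
    using H unfolding conn_solvable_subgroup_def subgroup_SL_subgroup[OF subgroup_SL_centralizer] by auto
  have comm: "h ** X = X ** h" if "h \<in> H" for h using that Hsub(2) by (auto simp: SL_centralizer_def)
  define W' where "W' = vec.span (u ` {..<m})"
  define W where "W = {v. X *v v = 0} \<inter> range ((*v) X ^^ (xs ! m - 1))"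
  have stW': "stable H W'"
  proof (cases m)
    case 0
    then show ?thesis by (auto simp: W'_def stable_def)
  next
    case (Suc k)
    then show ?thesis using w(3)[of k] by (simp add: W'_def u_def)
  qed
  have subW: "vec.subspace W"
    unfolding W_def
    by (intro vec.subspace_inter vec.linear_subspace_kernel[OF matrix_vector_mul_linear_gen]
        vec.linear_subspace_image[OF funpow_vec_linear] vec.subspace_UNIV)
  have stW: "stable H W"
    unfolding stable_def
  proof (intro conjI ballI subW)
    fix h v assume h: "h \<in> H" and "v \<in> W"
    then obtain x where x: "X *v v = 0" "v = ((*v) X ^^ (xs ! m - 1)) x" by (auto simp: W_def)
    have "X *v (h *v v) = h *v (X *v v)" using comm[OF h] by (simp add: matrix_vector_mul_assoc)
    moreover have "h *v v = ((*v) X ^^ (xs ! m - 1)) (h *v x)"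
      unfolding x(2) by (rule funpow_vec_commute[OF comm[OF h]])
    ultimately show "h *v v \<in> W" using x(1) by (auto simp: W_def)
  qed
  have W'W: "W' \<subseteq> W"
    unfolding W'_def
  proof (rule vec.span_minimal[OF _ subW], clarify)
    fix k assume k: "k < m"
    have pos: "0 < xs ! k" "0 < xs ! m" "xs ! m \<le> xs ! k" using k m part_pos part_mono by auto
    have "X *v u k = ((*v) X ^^ (Suc (xs ! k - 1))) (w k)" by (simp add: u_def)
    then have "X *v u k = 0" using w(1)[OF k] pos by simp
    moreover have "u k = ((*v) X ^^ (xs ! m - 1)) (((*v) X ^^ (xs ! k - xs ! m)) (w k))"
    proof -
      have "xs ! k - 1 = (xs ! m - 1) + (xs ! k - xs ! m)" using pos by simp
      then show ?thesis unfolding u_def by (simp only: funpow_add o_apply)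
    qed
    ultimately show "u k \<in> W" by (auto simp: W_def)
  qed
  have "X *v (P *v x) = P *v (J *v x)" for x by (simp add: matrix_vector_mul_assoc P(2))
  then have Xpow: "((*v) X ^^ t) (P *v x) = P *v (((*v) J ^^ t) x)" for t x
    by (induction t) simp_all
  have PW: "P *v axis (e (k, 0)) 1 \<in> W" if k: "k \<le> m" for k
  proof -
    have vk: "valid k (xs ! k - 1)" "k < length xs" using k m part_pos[of k] by (auto simp: valid_def)
    have Jpow: "((*v) J ^^ t) (axis (e (k, t)) 1) = axis (e (k, 0)) 1" if "valid k t" for t
      using that
    proof (induction t)
      case (Suc t)
      then have "valid k t" by (simp add: valid_def)
      then show ?case using Suc by (simp add: funpow_swap1 J_axis)
    qed simp
    have le: "xs ! m \<le> xs ! k" "0 < xs ! m" using k m part_mono part_pos by auto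
    then have v: "valid k (xs ! m - 1)" using vk by (auto simp: valid_def)
    have "X *v (P *v axis (e (k, 0)) 1) = P *v (J *v axis (e (k, 0)) 1)"
      by (simp add: matrix_vector_mul_assoc P(2))
    then have "X *v (P *v axis (e (k, 0)) 1) = 0" by (simp add: J_axis valid_0 vk)
    moreover have "P *v axis (e (k, 0)) 1 = ((*v) X ^^ (xs ! m - 1)) (P *v axis (e (k, xs ! m - 1)) 1)"
      by (simp only: Xpow Jpow[OF v])
    ultimately show ?thesis by (auto simp: W_def)
  qed
  have "W' \<noteq> W"
  proof
    assume "W' = W"
    have "vec.dim W' < card {..m}"
      using vec.dim_le_card[of W' "u ` {..<m}"] card_image_le[of "{..<m}" u] by (simp add: W'_def)
    then obtain c where c: "\<exists>k\<in>{..m}. c k \<noteq> 0" "(\<Sum>k\<in>{..m}. c k *s (P *v axis (e (k, 0)) 1)) = 0"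
      using vec_linear_relation[of "{..m}" "\<lambda>k. P *v axis (e (k, 0)) 1" W'] PW \<open>W' = W\<close> by blast
    have "P *v (\<Sum>k\<le>m. c k *s axis (e (k, 0)) 1) = 0"
      using c(2) by (simp add: vec.linear_sum[OF matrix_vector_mul_linear_gen] vector_scalar_commute)
    then have "matrix_inv P *v (P *v (\<Sum>k\<le>m. c k *s axis (e (k, 0)) 1)) = 0" by simp
    then have 0: "(\<Sum>k\<le>m. c k *s axis (e (k, 0)) 1) = (0 :: complex ^ 'n)" using P(1) by simp
    have "c l = 0" if l: "l \<le> m" for l
    proof -
      have "(\<Sum>k\<le>m. c k *s axis (e (k, 0)) 1) $ e (l, 0) = (\<Sum>k\<le>m. if k = l then c k else 0)"
        unfolding sum_component using m l valid_0
        by (intro sum.cong) (auto simp: axis_def e_eq_iff)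
      also have "\<dots> = c l" using l by simp
      finally show ?thesis by (simp add: 0)
    qed
    then show False using c(1) by auto
  qed
  then obtain v where v: "v \<in> W" "v \<notin> W'" "\<And>h. h \<in> H \<Longrightarrow> \<exists>c. h *v v - c *s v \<in> W'"
    using Lie_Kolchin[OF Hsub(1) Hconn stW stW'] W'W by blast
  then obtain x where x: "X *v v = 0" "v = ((*v) X ^^ (xs ! m - 1)) x" by (auto simp: W_def)
  define w' where "w' = w(m := x)"
  have u': "((*v) X ^^ (xs ! k - 1)) (w' k) = (u(m := v)) k" for k by (simp add: w'_def u_def x(2))
  have img: "u(m := v) ` {..<k} = u ` {..<k}" if "k \<le> m" for k using that by (intro image_cong) auto
  have new: "((*v) X ^^ (xs ! k)) (w' k) = 0 \<and> (u(m := v)) k \<notin> vec.span (u(m := v) ` {..<k}) \<and>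
      stable H (vec.span (u(m := v) ` {..<Suc k}))" if "k < Suc m" for k
  proof (cases "k = m")
    case False
    then have k: "k < m" using that by simp
    then have img': "u(m := v) ` {..<Suc k} = u ` {..<Suc k}" by (intro img) simp
    show ?thesis using w[OF k] k unfolding img[OF less_imp_le[OF k]] img' by (simp add: w'_def u_def)
  next
    case True
    have "((*v) X ^^ (Suc (xs ! m - 1))) x = 0" using x by simp
    then have "((*v) X ^^ (xs ! m)) x = 0" using part_pos[OF m] by simp
    moreover have "u(m := v) ` {..<Suc m} = insert v (u ` {..<m})" by (auto simp: lessThan_Suc)
    moreover have "stable H (vec.span (insert v (u ` {..<m})))"
      unfolding stable_def
    proof (intro conjI ballI vec.subspace_span)
      fix h y assume h: "h \<in> H" and "y \<in> vec.span (insert v (u ` {..<m}))"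
      then obtain a where a: "y - a *s v \<in> W'" unfolding W'_def using vec.span_breakdown_eq by blast
      obtain c where c: "h *v v - c *s v \<in> W'" using v(3) h by blast
      have "h *v (y - a *s v) \<in> W'" using a stW' h by (simp add: stable_def)
      moreover have eq: "h *v y = h *v (y - a *s v) + a *s (h *v v - c *s v) + (a * c) *s v"
        by (simp add: matrix_vector_mult_diff_distrib vector_scalar_commute vec.scale_right_diff_distrib)
      moreover have "W' \<subseteq> vec.span (insert v (u ` {..<m}))" unfolding W'_def by (intro vec.span_mono) auto
      ultimately show "h *v y \<in> vec.span (insert v (u ` {..<m}))"
        unfolding eq using c by (intro vec.span_add vec.span_scale) (auto intro: vec.span_base)
    qed
    ultimately show ?thesis using v(2) img[of m] True by (simp add: w'_def W'_def)
  qed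
  show ?case by (intro exI[of _ w'] allI impI, unfold u') (rule new)
qed simp

lemma adapted_frame:
  assumes fr: "frame X P" and H: "conn_solvable_subgroup H (SL_centralizer X)"
  shows "\<exists>Q. frame X Q \<and> H \<subseteq> borel_of Q"
proof -
  define r where "r = length xs"
  obtain w where "\<forall>k<r. ((*v) X ^^ (xs ! k)) (w k) = 0 \<and>
     ((*v) X ^^ (xs ! k - 1)) (w k) \<notin> vec.span ((\<lambda>k. ((*v) X ^^ (xs ! k - 1)) (w k)) ` {..<k}) \<and>
     stable H (vec.span ((\<lambda>k. ((*v) X ^^ (xs ! k - 1)) (w k)) ` {..<Suc k}))"
    using adapted_strings[OF fr H, of r] by (auto simp: r_def)
  moreover define u where "u k = ((*v) X ^^ (xs ! k - 1)) (w k)" for k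
  ultimately have w: "\<And>k. k < r \<Longrightarrow> ((*v) X ^^ (xs ! k)) (w k) = 0"
    "\<And>k. k < r \<Longrightarrow> u k \<notin> vec.span (u ` {..<k})" "\<And>k. k < r \<Longrightarrow> stable H (vec.span (u ` {..<Suc k}))"
    by (auto simp: u_def[abs_def])
  have Hsub: "subgroup H SL" "H \<subseteq> SL_centralizer X" "connected H"
    using H unfolding conn_solvable_subgroup_def subgroup_SL_subgroup[OF subgroup_SL_centralizer] by auto
  have inj: "inj_on e {(k, i). valid k i}" by (auto simp: inj_on_def e_eq_iff)
  define f where "f = inv_into {(k, i). valid k i} e"
  have f: "f (e (k, i)) = (k, i)" if "valid k i" for k i
    unfolding f_def using that by (intro inv_into_f_f[OF inj]) simp
  define Q :: "'n cmat" where "Q = (\<chi> p q. (case f q of (k, i) \<Rightarrow> ((*v) X ^^ (xs ! k - 1 - i)) (w k)) $ p)"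
  have Q: "Q *v axis (e (k, i)) 1 = ((*v) X ^^ (xs ! k - 1 - i)) (w k)" if "valid k i" for k i
    using that by (simp add: vec_eq_iff f Q_def)
  have Qu: "Q *v axis (e (k, 0)) 1 = u k" if "k < r" for k
    using that valid_0 by (simp add: Q u_def r_def)
  have XQ: "X ** Q = Q ** J"
  proof -
    have "(X ** Q) *v axis q 1 = (Q ** J) *v axis q 1" for q
    proof (rule index_cases[of q])
      fix k i assume v: "valid k i" "q = e (k, i)"
      then have k: "k < r" "0 < xs ! k" "i < xs ! k" using part_pos by (auto simp: valid_def r_def)
      have "(X ** Q) *v axis q 1 = ((*v) X ^^ (Suc (xs ! k - 1 - i))) (w k)"
        using v by (simp add: Q flip: matrix_vector_mul_assoc)
      also have "Suc (xs ! k - 1 - i) = xs ! k - i" using k by simp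
      also have "((*v) X ^^ (xs ! k - i)) (w k) = Q *v (J *v axis q 1)"
      proof (cases "i = 0")
        case True
        then show ?thesis using v k w(1) by (simp add: J_axis)
      next
        case False
        then have "valid k (i - 1)" "xs ! k - 1 - (i - 1) = xs ! k - i" using v by (auto simp: valid_def)
        then show ?thesis using v False Q[of k "i - 1"] by (simp add: J_axis)
      qed
      finally show ?thesis by (simp add: matrix_vector_mul_assoc)
    qed
    then have "((X ** Q) *v axis q 1) $ p = ((Q ** J) *v axis q 1) $ p" for p q by simp
    then show ?thesis by (simp add: vec_eq_iff)
  qed
  have "X *v (Q *v x) = Q *v (J *v x)" for x by (simp add: matrix_vector_mul_assoc XQ)
  then have Qpow: "((*v) X ^^ t) (Q *v x) = Q *v (((*v) J ^^ t) x)" for t x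
    by (induction t) simp_all
  have "inj ((*v) Q)"
    unfolding vec.linear_inj_iff_eq_0[OF matrix_vector_mul_linear_gen]
  proof (intro allI impI, rule ccontr)
    fix x assume x: "Q *v x = 0" "x \<noteq> 0"
    have "((*v) J ^^ (sum_list xs)) x = 0"
    proof -
      have "(((*v) J ^^ (sum_list xs)) x) $ p = 0" for p
      proof (rule index_cases[of p])
        fix k i assume v: "valid k i" "p = e (k, i)"
        then have "xs ! k \<le> sum_list xs" by (simp add: valid_def elem_le_sum_list)
        then show ?thesis using v by (simp add: J_funpow)
      qed
      then show ?thesis by (simp add: vec_eq_iff)
    qed
    then obtain t where t: "((*v) J ^^ t) x = 0" "\<And>s. s < t \<Longrightarrow> ((*v) J ^^ s) x \<noteq> 0"
      using exists_least_iff[of "\<lambda>t. ((*v) J ^^ t) x = 0"] by blast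
    then obtain s where s: "t = Suc s" using x(2) by (cases t) auto
    define y where "y = ((*v) J ^^ s) x"
    have y: "y \<noteq> 0" "J *v y = 0" using t s by (auto simp: y_def)
    have "Q *v y = ((*v) X ^^ s) (Q *v x)" by (simp add: y_def Qpow)
    also have "\<dots> = 0" unfolding x(1) using vec.linear_0[OF funpow_vec_linear] by simp
    finally have Qy: "Q *v y = 0" .
    have y0: "y $ e (k, i) = 0" if "valid k i" "i \<noteq> 0" for k i
    proof -
      have "valid k (i - 1)" using that by (auto simp: valid_def)
      then show ?thesis using J_vec[of k "i - 1" y] y(2) that by (simp add: valid_def)
    qed
    have ysum: "y = (\<Sum>k<r. y $ e (k, 0) *s axis (e (k, 0)) 1)"
    proof -
      have "y $ p = (\<Sum>k<r. y $ e (k, 0) *s axis (e (k, 0)) 1) $ p" for p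
      proof (rule index_cases[of p])
        fix l i assume v: "valid l i" "p = e (l, i)"
        have "(\<Sum>k<r. y $ e (k, 0) *s axis (e (k, 0)) 1) $ p = (\<Sum>k<r. if k = l then if i = 0 then y $ p else 0 else 0)"
          unfolding sum_component using v valid_0
          by (intro sum.cong) (auto simp: axis_def e_eq_iff r_def)
        also have "\<dots> = y $ p" using v y0 by (auto simp: valid_def r_def)
        finally show ?thesis by (rule sym)
      qed
      then show ?thesis by (rule iffD2[OF vec_eq_iff, OF allI])
    qed
    have "Q *v (\<Sum>k<r. y $ e (k, 0) *s axis (e (k, 0)) 1) = 0" by (simp only: Qy flip: ysum)
    then have "(\<Sum>k<r. y $ e (k, 0) *s u k) = 0"
      by (simp add: vec.linear_sum[OF matrix_vector_mul_linear_gen] vector_scalar_commute Qu)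
    then have "y $ e (k, 0) = 0" if "k < r" for k
      using vec_independent_family[of r u "\<lambda>k. y $ e (k, 0)"] w(2) that by blast
    then have "(\<Sum>k<r. y $ e (k, 0) *s axis (e (k, 0)) 1) = (0 :: complex ^ 'n)" by simp
    from trans[OF ysum this] y(1) show False by simp
  qed
  then have detQ: "det Q \<noteq> 0" by (simp add: inj_matrix_vec_iff)
  have "H \<subseteq> tri_group Q"
  proof
    fix h assume h: "h \<in> H"
    have comm: "h ** X = X ** h" and det: "det h = 1" using h Hsub(2) by (auto simp: SL_centralizer_def)
    let ?c = "matrix_inv Q ** h ** Q"
    have "?c ** J = matrix_inv Q ** h ** (Q ** J)" by (simp only: matrix_mul_assoc)
    also have "\<dots> = matrix_inv Q ** (h ** X) ** Q" by (simp only: XQ[symmetric] matrix_mul_assoc)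
    also have "\<dots> = matrix_inv Q ** X ** (Q ** matrix_inv Q) ** h ** Q" using detQ by (simp add: comm matrix_mul_assoc)
    also have "\<dots> = matrix_inv Q ** (X ** Q) ** matrix_inv Q ** h ** Q" by (simp only: matrix_mul_assoc)
    also have "\<dots> = J ** ?c" using detQ by (simp add: XQ matrix_mul_assoc)
    finally have "?c ** J = J ** ?c" .
    moreover have "?c $ e (k, 0) $ e (l, 0) = 0" if "k < length xs" "l < k" for k l
    proof -
      let ?F = "{v :: complex ^ 'n. (matrix_inv Q *v v) $ e (k, 0) = 0}"
      have l: "l < r" using that by (simp add: r_def)
      have "vec.subspace ?F"
        unfolding vec.subspace_def by (simp add: matrix_vector_right_distrib vector_scalar_commute)
      moreover have "u ` {..<Suc l} \<subseteq> ?F"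
      proof clarify
        fix j assume j: "j < Suc l"
        then have "u j = Q *v axis (e (j, 0)) 1" using l by (simp add: Qu)
        then show "(matrix_inv Q *v u j) $ e (k, 0) = 0"
          using detQ j that valid_0 by (simp add: axis_def e_eq_iff)
      qed
      ultimately have "vec.span (u ` {..<Suc l}) \<subseteq> ?F" by (rule vec.span_minimal[rotated])
      moreover have "h *v u l \<in> vec.span (u ` {..<Suc l})"
        using w(3)[OF l] h by (auto simp: stable_def intro: vec.span_base)
      ultimately have "(matrix_inv Q *v (h *v (Q *v axis (e (l, 0)) 1))) $ e (k, 0) = 0"
        using l by (auto simp: Qu)
      then show ?thesis by (simp add: matrix_vector_mul_assoc matrix_mul_assoc)
    qed
    ultimately have "?c \<in> borel_alg" by (simp add: borel_alg_def)
    then show "h \<in> tri_group Q" using det by (simp add: tri_group_def)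
  qed
  then have "H \<subseteq> borel_of Q"
    using Hsub by (intro subset_borel_of) (auto simp: subgroup_SL_iff)
  moreover have "frame X Q" using detQ XQ by (simp add: frame_def)
  ultimately show ?thesis by blast
qed

lemma borel_subgroup_centralizer_iff:
  assumes "frame X P"
  shows "borel_subgroup B (SL_centralizer X) \<longleftrightarrow> (\<exists>Q. frame X Q \<and> B = borel_of Q)"
proof
  assume B: "borel_subgroup B (SL_centralizer X)"
  then obtain Q where Q: "frame X Q" "B \<subseteq> borel_of Q"
    using adapted_frame[OF assms] unfolding borel_subgroup_def by blast
  then have "borel_of Q = B" using B conn_solvable_borel_of unfolding borel_subgroup_def by blast
  with Q show "\<exists>Q. frame X Q \<and> B = borel_of Q" by blast
next
  assume "\<exists>Q. frame X Q \<and> B = borel_of Q"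
  then obtain Q where Q: "frame X Q" "B = borel_of Q" by blast
  show "borel_subgroup B (SL_centralizer X)"
    unfolding borel_subgroup_def
  proof (intro conjI allI impI)
    show "conn_solvable_subgroup B (SL_centralizer X)" using conn_solvable_borel_of Q by simp
    fix H assume H: "conn_solvable_subgroup H (SL_centralizer X) \<and> B \<subseteq> H"
    then obtain R where R: "frame X R" "H \<subseteq> borel_of R" using adapted_frame[OF assms] by blast
    then have "borel_of Q = borel_of R"
      using H Q by (intro borel_of_subset_imp_eq) (auto simp: frame_def)
    then show "H = B" using H Q R by blast
  qed
qed

theorem borel_dim_centralizer:
  assumes "frame X P"
  shows "borel_dim (SL_centralizer X) = borel_dim_GL xs - 1"
  unfolding borel_dim_def borel_subgroup_centralizer_iff[OF assms]
  using assms complex_dim_borel_of by (intro the_equality) (auto simp: frame_def)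

end

section \<open>Nilpotent orbits\<close>

lemma matrix_eq_axisI:
  fixes A B :: "'n::finite cmat"
  assumes "\<And>q. A *v axis q 1 = B *v axis q 1"
  shows "A = B"
proof -
  have "(A *v axis q 1) $ p = (B *v axis q 1) $ p" for p q by (simp only: assms)
  then show ?thesis by (simp add: vec_eq_iff)
qed

lemma jordan_form_if_nilpotent_jordan_matrix:
  fixes J :: "'n::finite cmat"
  assumes "is_partition CARD('n) xs" "nilpotent_jordan_matrix xs J"
  shows "\<exists>e. jordan_form xs e J"
  using assms unfolding nilpotent_jordan_matrix_def jordan_form_def by blast

lemma has_jordan_typeE:
  fixes X :: "'n::finite cmat"
  assumes "is_partition CARD('n) xs" "has_jordan_type X xs"
  obtains e J P where "jordan_form xs e J" "jordan_form.frame J X P"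
proof -
  obtain J P :: "'n cmat" where J: "nilpotent_jordan_matrix xs J" and P: "invertible P" "X = P ** J ** matrix_inv P"
    using assms(2) by (auto simp: has_jordan_type_def)
  then obtain e where e: "jordan_form xs e J" using jordan_form_if_nilpotent_jordan_matrix[OF assms(1)] by blast
  have "det P \<noteq> 0" using P(1) by (simp add: invertible_det_nz)
  then have "jordan_form.frame J X P" using P(2) by (simp add: jordan_form.frame_def[OF e])
  then show thesis using that e by blast
qed

lemma has_jordan_type_exists:
  assumes "is_partition CARD('n::finite) xs"
  shows "\<exists>J :: 'n cmat. nilpotent_jordan_matrix xs J \<and> has_jordan_type J xs"
proof -
  let ?I = "{(k, i). k < length xs \<and> i < xs ! k}"
  have I: "?I = (SIGMA k:{..<length xs}. {..<xs ! k})" by auto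
  have "card ?I = (\<Sum>k<length xs. xs ! k)" unfolding I by simp
  also have "\<dots> = CARD('n)" using assms by (simp add: is_partition_def sum_list_sum_nth atLeast0LessThan)
  finally obtain e :: "nat \<times> nat \<Rightarrow> 'n" where e: "bij_betw e ?I UNIV"
    using finite_same_card_bij[of ?I "UNIV :: 'n set"] unfolding I by auto
  define f where "f = inv_into ?I e"
  have f: "f (e (k, i)) = (k, i)" if "k < length xs" "i < xs ! k" for k i
    unfolding f_def using e that by (intro inv_into_f_f) (auto simp: bij_betw_def)
  define J :: "'n cmat" where "J = (\<chi> p q. if fst (f p) = fst (f q) \<and> snd (f q) = Suc (snd (f p)) then 1 else 0)"
  have J: "nilpotent_jordan_matrix xs J"
    unfolding nilpotent_jordan_matrix_def
    by (intro exI[of _ e] conjI e allI impI) (auto simp: J_def f)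
  then have "has_jordan_type J xs"
    unfolding has_jordan_type_def
    by (intro exI[of _ J] exI[of _ "mat 1"]) (simp add: matrix_inv_unique invertible_def exI[of _ "mat 1"])
  with J show ?thesis by blast
qed

lemma jordan_forms_conj:
  assumes "jordan_form xs e J" "jordan_form xs e' J'"
  shows "\<exists>R. det R \<noteq> 0 \<and> J' ** R = R ** J"
proof -
  interpret A: jordan_form xs e J by fact
  interpret B: jordan_form xs e' J' by fact
  define f where "f = inv_into {(k, i). A.valid k i} e"
  define f' where "f' = inv_into {(k, i). A.valid k i} e'"
  have f: "f (e (k, i)) = (k, i)" if "A.valid k i" for k i
    unfolding f_def using that by (intro inv_into_f_f) (auto simp: inj_on_def A.e_eq_iff)
  have f': "f' (e' (k, i)) = (k, i)" if "A.valid k i" for k i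
    unfolding f'_def using that by (intro inv_into_f_f) (auto simp: inj_on_def B.e_eq_iff)
  define R :: "'a cmat" where "R = (\<chi> p q. axis (e' (f q)) 1 $ p)"
  define R' :: "'a cmat" where "R' = (\<chi> p q. axis (e (f' q)) 1 $ p)"
  have R: "R *v axis (e (k, i)) 1 = axis (e' (k, i)) 1" if "A.valid k i" for k i
    using that by (simp add: vec_eq_iff R_def f)
  have R': "R' *v axis (e' (k, i)) 1 = axis (e (k, i)) 1" if "A.valid k i" for k i
    using that by (simp add: vec_eq_iff R'_def f')
  have "R' ** R = mat 1"
  proof (rule matrix_eq_axisI)
    fix q show "R' ** R *v axis q 1 = mat 1 *v axis q 1"
    proof (rule A.index_cases[of q])
      fix k i assume "A.valid k i" "q = e (k, i)"
      then show ?thesis by (simp add: R R' flip: matrix_vector_mul_assoc)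
    qed
  qed
  then have "det R' * det R = 1" by (metis det_I det_mul)
  then have "det R \<noteq> 0" by auto
  moreover have "J' ** R = R ** J"
  proof (rule matrix_eq_axisI)
    fix q show "J' ** R *v axis q 1 = R ** J *v axis q 1"
    proof (rule A.index_cases[of q])
      fix k i assume v: "A.valid k i" "q = e (k, i)"
      then have "A.valid k (i - 1)" by (auto simp: A.valid_def)
      then show ?thesis using v by (simp add: R A.J_axis B.J_axis flip: matrix_vector_mul_assoc)
    qed
  qed
  ultimately show ?thesis by blast
qed

lemma SL_conj_if_GL_conj:
  fixes X Y R :: "'n::finite cmat"
  assumes "det R \<noteq> 0" "Y ** R = R ** X"
  shows "Y \<in> adjoint_orbit X"
proof -
  define z where "z = exp (- (Ln (det R) / of_nat CARD('n)))"
  have "z ^ CARD('n) = exp (- Ln (det R))" by (simp add: z_def flip: exp_of_nat_mult)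
  then have z: "z ^ CARD('n) * det R = 1" using assms(1) by (simp add: exp_minus)
  define g where "g = mat z ** R"
  have det: "det g = 1" using z by (simp add: g_def det_mat_mult)
  have "Y ** g = mat z ** (Y ** R)" by (simp add: g_def matrix_mul_assoc mat_mult_commute)
  then have "Y ** g = g ** X" using assms(2) by (simp add: g_def matrix_mul_assoc)
  then have "Y = g ** X ** matrix_inv g" using det by (simp flip: \<open>Y ** g = g ** X\<close>)
  then show ?thesis using det unfolding adjoint_orbit_def by auto
qed

lemma adjoint_orbit_eq:
  fixes X :: "'n::finite cmat"
  assumes part: "is_partition CARD('n) xs" and X: "has_jordan_type X xs"
  shows "adjoint_orbit X = {Y. has_jordan_type Y xs}"
proof (intro equalityI subsetI)
  fix Y :: "'n cmat" assume "Y \<in> adjoint_orbit X"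
  then obtain g where g: "det g = 1" "Y = g ** X ** matrix_inv g" by (auto simp: adjoint_orbit_def)
  obtain J P :: "'n cmat" where J: "nilpotent_jordan_matrix xs J" and P: "invertible P" "X = P ** J ** matrix_inv P"
    using X by (auto simp: has_jordan_type_def)
  have detP: "det P \<noteq> 0" using P(1) by (simp add: invertible_det_nz)
  have "matrix_inv (g ** P) = matrix_inv P ** matrix_inv g"
    using g detP by (intro matrix_inv_unique) (simp add: matrix_mul_assoc)
  then have "Y = (g ** P) ** J ** matrix_inv (g ** P)" by (simp add: g P(2) matrix_mul_assoc)
  moreover have "invertible (g ** P)" using g detP by (simp add: invertible_det_nz det_mul)
  ultimately show "Y \<in> {Y. has_jordan_type Y xs}" using J by (auto simp: has_jordan_type_def)
next
  fix Y :: "'n cmat" assume "Y \<in> {Y. has_jordan_type Y xs}"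
  then have Y: "has_jordan_type Y xs" by simp
  obtain e J P where 1: "jordan_form xs e J" "jordan_form.frame J X P" by (rule has_jordan_typeE[OF part X])
  obtain e' J' P' where 2: "jordan_form xs e' J'" "jordan_form.frame J' Y P'" by (rule has_jordan_typeE[OF part Y])
  obtain R where R: "det R \<noteq> 0" "J' ** R = R ** J" using jordan_forms_conj[OF 1(1) 2(1)] by blast
  have P: "det P \<noteq> 0" "X ** P = P ** J" using 1 by (auto simp: jordan_form.frame_def[OF 1(1)])
  have P': "det P' \<noteq> 0" "Y ** P' = P' ** J'" using 2 by (auto simp: jordan_form.frame_def[OF 2(1)])
  define S where "S = P' ** R ** matrix_inv P"
  have JX: "J ** matrix_inv P = matrix_inv P ** X"
  proof -
    have "matrix_inv P ** (X ** P) ** matrix_inv P = matrix_inv P ** (P ** J) ** matrix_inv P" by (simp only: P(2))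
    then show ?thesis using P(1) by (simp add: matrix_mul_assoc)
  qed
  have "Y ** S = (Y ** P') ** R ** matrix_inv P" by (simp only: S_def matrix_mul_assoc)
  also have "\<dots> = P' ** (J' ** R) ** matrix_inv P" by (simp only: P'(2) matrix_mul_assoc)
  also have "\<dots> = P' ** R ** (J ** matrix_inv P)" by (simp only: R(2) matrix_mul_assoc)
  also have "\<dots> = S ** X" by (simp only: JX S_def matrix_mul_assoc)
  finally have "Y ** S = S ** X" .
  moreover have "det S \<noteq> 0" using P P' R by (simp add: S_def det_mul det_matrix_inv)
  ultimately show "Y \<in> adjoint_orbit X" by (intro SL_conj_if_GL_conj)
qed

lemma nilpotent_orbit_eq:
  assumes "is_partition CARD('n::finite) xs"
  shows "nilpotent_orbit xs = {X :: 'n cmat. has_jordan_type X xs}"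
  unfolding nilpotent_orbit_def
proof (rule the_equality)
  obtain J :: "'n cmat" where "has_jordan_type J xs" using has_jordan_type_exists[OF assms] by blast
  then show "\<exists>X :: 'n cmat. has_jordan_type X xs \<and> {X. has_jordan_type X xs} = adjoint_orbit X"
    using adjoint_orbit_eq[OF assms] by blast
qed (use adjoint_orbit_eq[OF assms] in blast)

lemma m_nilpotent_orbit:
  assumes "is_partition CARD('n::finite) xs"
  shows "m_orbit (nilpotent_orbit xs :: 'n cmat set) =
    int (borel_dim (carrier SL :: 'n cmat set)) - int (borel_dim_GL xs - 1)"
proof -
  have dim: "borel_dim (SL_centralizer X) = borel_dim_GL xs - 1" if "has_jordan_type X xs" for X :: "'n cmat"
    using that by (rule has_jordan_typeE[OF assms]) (rule jordan_form.borel_dim_centralizer)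
  obtain J :: "'n cmat" where "has_jordan_type J xs" using has_jordan_type_exists[OF assms] by blast
  then show ?thesis
    unfolding m_orbit_def nilpotent_orbit_eq[OF assms] using dim
    by (intro the_equality) auto
qed

section \<open>Closure relations and kernels\<close>

definition matrix_power :: "'n::finite cmat \<Rightarrow> nat \<Rightarrow> 'n cmat" where
  "matrix_power X i = ((**) X ^^ i) (mat 1)"

lemma continuous_on_matrix_power: "continuous_on S (\<lambda>X. matrix_power X i)"
  unfolding matrix_power_def
  by (induction i) (auto intro!: continuous_intros)

lemma matrix_power_vec: "matrix_power X i *v x = ((*v) X ^^ i) x"
  unfolding matrix_power_def
  by (induction i) (simp_all flip: matrix_vector_mul_assoc)

definition kernel_index :: "nat list \<Rightarrow> nat \<Rightarrow> (nat \<times> nat) set" where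
  "kernel_index xs i = {(k, j). k < length xs \<and> j < xs ! k \<and> j < i}"

lemma card_kernel_index: "card (kernel_index xs i) = (\<Sum>t<i. part_count xs (Suc t))"
proof -
  have "bij_betw (\<lambda>(k, j). (j, k)) (kernel_index xs i) (SIGMA j:{..<i}. {k. k < length xs \<and> Suc j \<le> xs ! k})"
    by (rule bij_betw_byWitness[where f' = "\<lambda>(j, k). (k, j)"]) (auto simp: kernel_index_def)
  then have "card (kernel_index xs i) = card (SIGMA j:{..<i}. {k. k < length xs \<and> Suc j \<le> xs ! k})"
    by (rule bij_betw_same_card)
  also have "\<dots> = (\<Sum>t<i. part_count xs (Suc t))" by (simp add: part_count_def)
  finally show ?thesis .
qed

context jordan_form
begin

text \<open>Since invertibility is an open condition, this bounds the kernels of the \<open>i\<close>-th powers of all matrices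
  near a conjugate of \<open>J\<close>.\<close>

lemma power_complement:
  "\<exists>Z. det (matrix_power J i + Z) \<noteq> 0 \<and>
     (\<forall>x. (\<forall>(k, j)\<in>kernel_index xs i. x $ e (k, j) = 0) \<longrightarrow> Z *v x = 0)"
proof -
  define f where "f = inv_into {(k, i). valid k i} e"
  have f: "f (e (k, i)) = (k, i)" if "valid k i" for k i
    unfolding f_def using that by (intro inv_into_f_f) (auto simp: inj_on_def e_eq_iff)
  define g where "g k q = q - (xs ! k - min i (xs ! k))" for k q
  define Z :: "'n cmat" where "Z = (\<chi> p q. case f p of (k, s) \<Rightarrow>
     if xs ! k \<le> s + i \<and> q = e (k, g k s) then 1 else 0)"
  have Z: "(Z *v x) $ e (k, s) = (if xs ! k \<le> s + i then x $ e (k, g k s) else 0)" if "valid k s" for x k s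
    using that by (simp add: matrix_vector_mult_def Z_def f if_distrib[of "\<lambda>a. a * _"] cong: if_cong)
  have "inj ((*v) (matrix_power J i + Z))"
    unfolding vec.linear_inj_iff_eq_0[OF matrix_vector_mul_linear_gen]
  proof (intro allI impI)
    fix x assume 0: "(matrix_power J i + Z) *v x = 0"
    have entry: "(if s + i < xs ! k then x $ e (k, s + i) else x $ e (k, g k s)) = 0" if "valid k s" for k s
    proof -
      have "((matrix_power J i + Z) *v x) $ e (k, s) = (((*v) J ^^ i) x) $ e (k, s) + (Z *v x) $ e (k, s)"
        by (simp add: matrix_vector_mult_add_rdistrib matrix_power_vec)
      then show ?thesis using 0 that by (simp add: J_funpow Z split: if_splits)
    qed
    have "x $ p = 0" for p
    proof (rule index_cases[of p])
      fix k j assume v: "valid k j" "p = e (k, j)"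
      show ?thesis
      proof (cases "i \<le> j")
        case True
        then have "valid k (j - i)" using v by (auto simp: valid_def)
        then show ?thesis using entry[of k "j - i"] True v by (simp add: valid_def)
      next
        case False
        define s where "s = j + (xs ! k - min i (xs ! k))"
        have "valid k s" "\<not> s + i < xs ! k" "g k s = j" using v False by (auto simp: valid_def s_def g_def)
        then show ?thesis using entry[of k s] v by simp
      qed
    qed
    then show "x = 0" by (simp add: vec_eq_iff)
  qed
  moreover have "Z *v x = 0" if "\<forall>(k, j)\<in>kernel_index xs i. x $ e (k, j) = 0" for x
  proof -
    have "(Z *v x) $ p = 0" for p
    proof (rule index_cases[of p])
      fix k s assume v: "valid k s" "p = e (k, s)"
      have "(k, g k s) \<in> kernel_index xs i" if "xs ! k \<le> s + i"
        using v that by (auto simp: kernel_index_def g_def valid_def)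
      then show ?thesis using v that by (auto simp: Z)
    qed
    then show ?thesis by (simp add: vec_eq_iff)
  qed
  ultimately show ?thesis by (auto simp: inj_matrix_vec_iff)
qed

end

lemma card_kernel_index_le_of_closure:
  assumes lam: "is_partition CARD('n::finite) lam" and d: "is_partition CARD('n) d"
    and cl: "X \<in> closure {Y :: 'n cmat. has_jordan_type Y lam}" and X: "has_jordan_type X d"
  shows "card (kernel_index lam i) \<le> card (kernel_index d i)"
proof (rule ccontr)
  assume "\<not> ?thesis"
  then have less: "card (kernel_index d i) < card (kernel_index lam i)" by simp
  obtain e J P where 1: "jordan_form d e J" "jordan_form.frame J X P" by (rule has_jordan_typeE[OF d X])
  interpret A: jordan_form d e J by fact
  have P: "det P \<noteq> 0" "X ** P = P ** J" using 1(2) by (auto simp: A.frame_def)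
  obtain Z where Z: "det (matrix_power J i + Z) \<noteq> 0"
    "\<And>x. \<forall>(k, j)\<in>kernel_index d i. x $ e (k, j) = 0 \<Longrightarrow> Z *v x = 0"
    using A.power_complement[of i] by blast
  let ?F = "\<lambda>Y. det (matrix_power Y i + P ** Z ** matrix_inv P)"
  have frame_power: "((*v) Y ^^ t) (R *v x) = R *v (((*v) K ^^ t) x)" if "Y ** R = R ** K"
    for Y R K :: "'n cmat" and t x
  proof -
    have "Y *v (R *v x) = R *v (K *v x)" for x by (simp add: matrix_vector_mul_assoc that)
    then show ?thesis by (induction t) simp_all
  qed
  have "?F X \<noteq> 0"
  proof -
    have "(matrix_power X i + P ** Z ** matrix_inv P) ** P = P ** (matrix_power J i + Z)"
    proof (rule matrix_eq_axisI)
      fix q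
      have "(matrix_power X i + P ** Z ** matrix_inv P) ** P *v axis q 1 =
         matrix_power X i *v (P *v axis q 1) + P *v (Z *v (matrix_inv P *v (P *v axis q 1)))"
        by (simp add: matrix_vector_mult_add_rdistrib matrix_vector_mul_assoc)
          (simp add: matrix_vector_mult_add_rdistrib matrix_mul_assoc flip: matrix_vector_mul_assoc)
      also have "\<dots> = P *v (matrix_power J i *v axis q 1) + P *v (Z *v axis q 1)"
        by (simp only: matrix_power_vec frame_power[OF P(2)] matrix_inv_vec[OF P(1)])
      also have "\<dots> = P ** (matrix_power J i + Z) *v axis q 1"
        by (simp add: matrix_vector_mult_add_rdistrib matrix_vector_right_distrib flip: matrix_vector_mul_assoc)
      finally show "(matrix_power X i + P ** Z ** matrix_inv P) ** P *v axis q 1 = P ** (matrix_power J i + Z) *v axis q 1" .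
    qed
    then have "?F X * det P = det P * det (matrix_power J i + Z)" by (metis det_mul)
    then show ?thesis using Z(1) P(1) by auto
  qed
  moreover have "open {Y. ?F Y \<noteq> 0}"
    by (intro open_Collect_neq continuous_intros continuous_on_matrix_power)
  ultimately obtain Y where Y: "has_jordan_type Y lam" "?F Y \<noteq> 0"
    using cl by (auto simp: closure_iff_nhds_not_empty)
  obtain e' J' R where 2: "jordan_form lam e' J'" "jordan_form.frame J' Y R" by (rule has_jordan_typeE[OF lam Y(1)])
  interpret B: jordan_form lam e' J' by fact
  have R: "det R \<noteq> 0" "Y ** R = R ** J'" using 2(2) by (auto simp: B.frame_def)
  define C where "C = e ` kernel_index d i"
  define pr where "pr v = (\<chi> p. if p \<in> C then v $ p else 0)" for v :: "complex ^ 'n"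
  define u where "u = (\<lambda>s. matrix_inv P *v (R *v axis (e' s) 1))"
  have fin: "finite (kernel_index xs i)" for xs
    by (rule finite_subset[of _ "(SIGMA k:{..<length xs}. {..<xs ! k})"]) (auto simp: kernel_index_def)
  let ?S = "{v :: complex ^ 'n. \<forall>p. p \<notin> C \<longrightarrow> v $ p = 0}"
  have "vec.dim ?S = card C" by (rule dim_substandard_cart)
  also have "\<dots> < card (kernel_index lam i)"
    using less card_image_le[OF fin, of e d] unfolding C_def by linarith
  finally have dimS: "vec.dim ?S < card (kernel_index lam i)" .
  have "(\<lambda>s. pr (u s)) ` kernel_index lam i \<subseteq> ?S" by (auto simp: pr_def)
  from vec_linear_relation[OF fin this dimS]
  obtain c where c: "\<exists>s\<in>kernel_index lam i. c s \<noteq> 0" "(\<Sum>s\<in>kernel_index lam i. c s *s pr (u s)) = 0"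
    by blast
  define y where "y = (\<Sum>s\<in>kernel_index lam i. c s *s axis (e' s) (1 :: complex))"
  have y_entry: "y $ e' (k, j) = (if (k, j) \<in> kernel_index lam i then c (k, j) else 0)" if v: "B.valid k j" for k j
  proof -
    have "y $ e' (k, j) = (\<Sum>s\<in>kernel_index lam i. if s = (k, j) then c s else 0)"
      unfolding y_def sum_component
    proof (intro sum.cong refl)
      fix s assume "s \<in> kernel_index lam i"
      then obtain k' j' where "s = (k', j')" "B.valid k' j'" by (auto simp: kernel_index_def B.valid_def)
      then show "(c s *s axis (e' s) 1) $ e' (k, j) = (if s = (k, j) then c s else 0)"
        using v by (auto simp: axis_def B.e_eq_iff)
    qed
    then show ?thesis using fin by simp
  qed
  obtain k j where kj: "(k, j) \<in> kernel_index lam i" "c (k, j) \<noteq> 0" using c(1) by auto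
  then have "y $ e' (k, j) \<noteq> 0" by (subst y_entry) (auto simp: kernel_index_def B.valid_def)
  then have y: "y \<noteq> 0" by auto
  have "((*v) J' ^^ i) y $ p = 0" for p
  proof (rule B.index_cases[of p])
    fix k j assume v: "B.valid k j" "p = e' (k, j)"
    then have "j + i < lam ! k \<Longrightarrow> B.valid k (j + i)" by (simp add: B.valid_def)
    then show ?thesis using v by (auto simp: B.J_funpow y_entry kernel_index_def)
  qed
  then have Jy: "((*v) J' ^^ i) y = 0" by (simp add: vec_eq_iff)
  have Py: "matrix_inv P *v (R *v y) = (\<Sum>s\<in>kernel_index lam i. c s *s u s)"
    by (simp add: y_def u_def vec.linear_sum[OF matrix_vector_mul_linear_gen] vector_scalar_commute)
  have "Z *v (matrix_inv P *v (R *v y)) = 0"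
  proof (rule Z(2), clarify)
    fix k j assume "(k, j) \<in> kernel_index d i"
    then have "e (k, j) \<in> C" by (simp add: C_def)
    then have "(matrix_inv P *v (R *v y)) $ e (k, j) = (\<Sum>s\<in>kernel_index lam i. c s *s pr (u s)) $ e (k, j)"
      unfolding Py by (simp add: pr_def)
    then show "(matrix_inv P *v (R *v y)) $ e (k, j) = 0" by (simp add: c(2))
  qed
  then have "(matrix_power Y i + P ** Z ** matrix_inv P) *v (R *v y) = 0"
    by (simp add: matrix_vector_mult_add_rdistrib matrix_power_vec frame_power[OF R(2)] Jy flip: matrix_vector_mul_assoc)
  moreover have "inj ((*v) (matrix_power Y i + P ** Z ** matrix_inv P))" using Y(2) by (simp add: inj_matrix_vec_iff)
  ultimately have "R *v y = 0" by (metis injD matrix_vector_mult_0_right)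
  moreover have "inj ((*v) R)" using R(1) by (simp add: inj_matrix_vec_iff)
  ultimately have "y = 0" by (metis injD matrix_vector_mult_0_right)
  then show False using y by simp
qed

section \<open>Comparing the dimensions\<close>

lemma abel_sum:
  fixes a w :: "nat \<Rightarrow> int"
  shows "(\<Sum>t<n. a t * w t) = (\<Sum>t<n. a t) * w n + (\<Sum>t<n. (\<Sum>s<Suc t. a s) * (w t - w (Suc t)))"
  by (induction n) (simp_all add: algebra_simps)

text \<open>With \<open>c = p + q\<close> and \<open>D\<close> the partial sums of \<open>q - p\<close>, the difference of the two sides is
  \<open>D\<^sub>1 + (\<Sum>t. D\<^bsub>t+1\<^esub> ((c\<^bsub>t-1\<^esub> - c\<^sub>t) + (c\<^bsub>t+1\<^esub> - c\<^bsub>t+2\<^esub>)))\<close>, where \<open>c\<^bsub>-1\<^esub>\<close> stands for \<open>c\<^sub>0\<close>.\<close>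

lemma dominance_quadratic:
  fixes p q :: "nat \<Rightarrow> int" and n :: nat
  defines "B \<equiv> \<lambda>p :: nat \<Rightarrow> int. p 0 * p 0 + p 0 + 2 * (\<Sum>t<n. p t * p (Suc t))"
  assumes p: "antimono p" and q: "antimono q" and n: "p n = 0" "q n = 0"
    and dom: "\<And>i. (\<Sum>t<i. p t) \<le> (\<Sum>t<i. q t)" and tot: "(\<Sum>t<n. p t) = (\<Sum>t<n. q t)"
  shows "B p \<le> B q" and "i < n \<Longrightarrow> p i \<noteq> q i \<Longrightarrow> B p < B q"
proof -
  define a where "a t = q t - p t" for t
  define c where "c t = p t + q t" for t
  define w where "w t = c (Suc t) + c (t - 1)" for t
  define D where "D i = (\<Sum>t<i. a t)" for i
  have c: "c t \<le> c s" if "s \<le> t" for s t using antimonoD[OF p that] antimonoD[OF q that] by (simp add: c_def)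
  have D: "0 \<le> D i" for i using dom[of i] by (simp add: D_def a_def sum_subtractf)
  have Dn: "D n = 0" using tot by (simp add: D_def a_def sum_subtractf)
  have w: "0 \<le> w t - w (Suc t)" for t using c[of "t - 1" t] c[of "Suc t" "Suc (Suc t)"] by (simp add: w_def)
  have shift: "(\<Sum>t<m. a (Suc t) * c t) + a 0 * c 0 = (\<Sum>t<m. a t * c (t - 1)) + a m * c (m - 1)" for m
    by (induction m) simp_all
  have "B q - B p = a 0 + a 0 * c 0 + (\<Sum>t<n. a t * c (Suc t)) + (\<Sum>t<n. a (Suc t) * c t)"
  proof -
    have "2 * (q t * q (Suc t)) - 2 * (p t * p (Suc t)) = a t * c (Suc t) + a (Suc t) * c t" for t
      by (simp add: a_def c_def algebra_simps)
    then have "2 * (\<Sum>t<n. q t * q (Suc t)) - 2 * (\<Sum>t<n. p t * p (Suc t)) =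
        (\<Sum>t<n. a t * c (Suc t)) + (\<Sum>t<n. a (Suc t) * c t)"
      by (simp add: sum_distrib_left flip: sum_subtractf sum.distrib)
    moreover have "q 0 * q 0 + q 0 - (p 0 * p 0 + p 0) = a 0 + a 0 * c 0" by (simp add: a_def c_def algebra_simps)
    ultimately show ?thesis unfolding B_def by linarith
  qed
  also have "\<dots> = a 0 + (\<Sum>t<n. a t * w t) + a n * c (n - 1)"
    using shift[of n] by (simp add: w_def distrib_left sum.distrib)
  also have "\<dots> = D 1 + (\<Sum>t<n. D (Suc t) * (w t - w (Suc t)))"
    using Dn n abel_sum[of a w n] by (simp add: D_def a_def)
  finally have diff: "B q - B p = D 1 + (\<Sum>t<n. D (Suc t) * (w t - w (Suc t)))" .
  have terms: "0 \<le> D (Suc t) * (w t - w (Suc t))" for t using D w by simp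
  then have sum: "0 \<le> (\<Sum>t<n. D (Suc t) * (w t - w (Suc t)))" by (intro sum_nonneg)
  then show "B p \<le> B q" using diff D[of 1] by linarith
  assume i: "i < n" "p i \<noteq> q i"
  define j where "j = (LEAST j. p j \<noteq> q j)"
  have j: "p j \<noteq> q j" "j \<le> i" "\<And>t. t < j \<Longrightarrow> p t = q t"
    using i LeastI[of "\<lambda>j. p j \<noteq> q j" i] Least_le[of "\<lambda>j. p j \<noteq> q j" i] not_less_Least by (auto simp: j_def)
  have "D (Suc j) = a j" using j(3) by (simp add: D_def a_def)
  then have Dj: "0 < D (Suc j)" using D[of "Suc j"] j(1) by (simp add: a_def)
  show "B p < B q"
  proof (cases j)
    case 0
    then show ?thesis using diff sum Dj by simp
  next
    case (Suc l)
    have "p j \<le> p l" "q j \<le> q l" "p l = q l"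
      using antimonoD[OF p, of l j] antimonoD[OF q, of l j] j(3)[of l] Suc by simp_all
    then have "c j < c (j - 1)" using j(1) Suc by (auto simp: c_def)
    then have "0 < w j - w (Suc j)" using c[of "Suc j" "Suc (Suc j)"] by (simp add: w_def)
    then have "0 < D (Suc j) * (w j - w (Suc j))" using Dj by simp
    then have "0 < (\<Sum>t<n. D (Suc t) * (w t - w (Suc t)))"
      using i j(2) terms by (intro sum_pos2[of _ j]) auto
    then show ?thesis using diff D[of 1] by linarith
  qed
qed

lemma part_count_antimono: "s \<le> t \<Longrightarrow> part_count xs t \<le> part_count xs s"
  unfolding part_count_def by (intro card_mono) auto

lemma less_part_count_iff:
  assumes "is_partition n xs"
  shows "k < part_count xs t \<longleftrightarrow> k < length xs \<and> t \<le> xs ! k"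
proof -
  have mono: "xs ! l \<le> xs ! k" if "k \<le> l" "l < length xs" for k l
    using assms that by (auto simp: is_partition_def sorted_wrt_iff_nth_less le_less)
  let ?A = "{k. k < length xs \<and> t \<le> xs ! k}"
  have fin: "finite ?A" by simp
  show ?thesis
  proof
    assume k: "k < length xs \<and> t \<le> xs ! k"
    then have "{..k} \<subseteq> ?A" using mono by (auto intro: order_trans)
    then have "card {..k} \<le> card ?A" by (intro card_mono fin)
    then show "k < part_count xs t" by (simp add: part_count_def)
  next
    assume k: "k < part_count xs t"
    show "k < length xs \<and> t \<le> xs ! k"
    proof (rule ccontr)
      assume n: "\<not> (k < length xs \<and> t \<le> xs ! k)"
      have "?A \<subseteq> {..<k}"
      proof (rule subsetI, rule ccontr)
        fix l assume "l \<in> ?A" "l \<notin> {..<k}"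
        then have "k \<le> l" "l < length xs" "t \<le> xs ! l" by auto
        then show False using n mono[of k l] by auto
      qed
      then have "part_count xs t \<le> k" unfolding part_count_def using card_mono[of "{..<k}" ?A] by simp
      then show False using k by simp
    qed
  qed
qed

lemma part_count_1:
  assumes "is_partition n xs"
  shows "part_count xs (Suc 0) = length xs"
proof -
  have "{k. k < length xs \<and> Suc 0 \<le> xs ! k} = {..<length xs}"
    using assms by (auto simp: is_partition_def Suc_le_eq)
  then show ?thesis by (simp add: part_count_def)
qed

lemma part_count_inject:
  assumes xs: "is_partition n xs" and ys: "is_partition n ys"
    and eq: "\<And>t. part_count xs (Suc t) = part_count ys (Suc t)"
  shows "xs = ys"
proof (rule nth_equalityI)
  show len: "length xs = length ys" using eq[of 0] part_count_1[OF xs] part_count_1[OF ys] by simp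
  have le: "xs ! k \<le> ys ! k" if "is_partition n xs" "is_partition n ys"
    "\<And>t. part_count xs (Suc t) = part_count ys (Suc t)" "k < length xs" for xs ys k
  proof -
    have "0 < xs ! k" using that by (auto simp: is_partition_def)
    then obtain t where t: "xs ! k = Suc t" by (cases "xs ! k") auto
    then have "k < part_count xs (Suc t)" using less_part_count_iff[OF that(1)] that(4) by simp
    then show ?thesis using that(3) less_part_count_iff[OF that(2)] t by simp
  qed
  show "xs ! k = ys ! k" if "k < length xs" for k
    using le[OF xs ys eq that] le[OF ys xs eq[symmetric]] that len by (simp add: antisym)
qed

lemma part_count_large:
  assumes "is_partition n xs"
  shows "part_count xs (Suc n) = 0"
proof -
  have "{k. k < length xs \<and> Suc n \<le> xs ! k} = {}"
  proof (rule ccontr)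
    assume "{k. k < length xs \<and> Suc n \<le> xs ! k} \<noteq> {}"
    then obtain k where "k < length xs" "Suc n \<le> xs ! k" by blast
    then show False using elem_le_sum_list[of k xs] assms by (simp add: is_partition_def)
  qed
  then show ?thesis by (simp add: part_count_def)
qed

lemma sum_part_count:
  assumes "is_partition n xs"
  shows "(\<Sum>t<n. part_count xs (Suc t)) = n"
proof -
  have "xs ! k \<le> n" if "k < length xs" for k
    using elem_le_sum_list[OF that] assms by (simp add: is_partition_def)
  then have "kernel_index xs n = (SIGMA k:{..<length xs}. {..<xs ! k})"
    by (force simp: kernel_index_def)
  then have "card (kernel_index xs n) = (\<Sum>k<length xs. xs ! k)" by simp
  also have "\<dots> = n" using assms by (simp add: is_partition_def sum_list_sum_nth atLeast0LessThan)
  finally show ?thesis by (simp add: card_kernel_index)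
qed

lemma borel_dim_GL_quadratic:
  assumes "is_partition n xs"
  defines "p \<equiv> \<lambda>t. int (part_count xs (Suc t))"
  shows "2 * int (borel_dim_GL xs) = p 0 * p 0 + p 0 + 2 * (\<Sum>t<n. p t * p (Suc t))"
proof -
  have "2 * (\<Sum>l<m. Suc l) = m * m + m" for m :: nat by (induction m) simp_all
  then have "2 * int (\<Sum>l<length xs. Suc l) = p 0 * p 0 + p 0"
    unfolding p_def part_count_1[OF assms(1)] by (metis of_nat_add of_nat_mult of_nat_numeral)
  moreover have "(\<Sum>t=1..sum_list xs. part_count xs t * part_count xs (Suc t)) =
      (\<Sum>t<n. part_count xs (Suc t) * part_count xs (Suc (Suc t)))"
    using assms(1) by (intro sum.reindex_bij_witness[of _ Suc "\<lambda>t. t - 1"]) (auto simp: is_partition_def)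
  ultimately show ?thesis by (simp add: borel_dim_GL_def p_def algebra_simps)
qed

lemma borel_dim_GL_dominance:
  assumes lam: "is_partition n lam" and d: "is_partition n d"
    and dom: "\<And>i. (\<Sum>t<i. part_count lam (Suc t)) \<le> (\<Sum>t<i. part_count d (Suc t))"
  shows "borel_dim_GL lam \<le> borel_dim_GL d" and "lam \<noteq> d \<Longrightarrow> borel_dim_GL lam < borel_dim_GL d"
proof -
  let ?p = "\<lambda>t. int (part_count lam (Suc t))" and ?q = "\<lambda>t. int (part_count d (Suc t))"
  have anti: "antimono ?p" "antimono ?q" by (auto simp: antimono_def part_count_antimono)
  have n: "?p n = 0" "?q n = 0" using part_count_large[OF lam] part_count_large[OF d] by auto
  have dom': "(\<Sum>t<i. ?p t) \<le> (\<Sum>t<i. ?q t)" for i using dom[of i] by (simp flip: of_nat_sum)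
  have tot: "(\<Sum>t<n. ?p t) = (\<Sum>t<n. ?q t)"
    by (simp add: sum_part_count[OF lam] sum_part_count[OF d] flip: of_nat_sum)
  note quad = dominance_quadratic[OF anti n dom' tot]
  show "borel_dim_GL lam \<le> borel_dim_GL d"
    using quad(1) borel_dim_GL_quadratic[OF lam] borel_dim_GL_quadratic[OF d] by linarith
  assume "lam \<noteq> d"
  then obtain i where i: "?p i \<noteq> ?q i" using part_count_inject[OF lam d] by auto
  have "i < n"
  proof (rule ccontr)
    assume "\<not> i < n"
    then have "?p i = 0" "?q i = 0"
      using n part_count_antimono[of "Suc n" "Suc i" lam] part_count_antimono[of "Suc n" "Suc i" d] by auto
    then show False using i by simp
  qed
  then show "borel_dim_GL lam < borel_dim_GL d"
    using quad(2)[OF _ i] borel_dim_GL_quadratic[OF lam] borel_dim_GL_quadratic[OF d] by linarith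
qed

theorem proposition4p4:
  fixes lam d :: "nat list"
  assumes "is_partition CARD('n::finite) lam"
    and "is_partition CARD('n) d"
  shows "(orbit_le (nilpotent_orbit d :: 'n cmat set) (nilpotent_orbit lam) \<longrightarrow>
            m_orbit (nilpotent_orbit d :: 'n cmat set)
              \<le> m_orbit (nilpotent_orbit lam :: 'n cmat set)) \<and>
         (orbit_less (nilpotent_orbit d :: 'n cmat set) (nilpotent_orbit lam) \<longrightarrow>
            m_orbit (nilpotent_orbit d :: 'n cmat set)
              < m_orbit (nilpotent_orbit lam :: 'n cmat set))"
proof -
  have dom: "(\<Sum>t<i. part_count lam (Suc t)) \<le> (\<Sum>t<i. part_count d (Suc t))"
    if "orbit_le (nilpotent_orbit d :: 'n cmat set) (nilpotent_orbit lam)" for i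
  proof -
    obtain X :: "'n cmat" where X: "has_jordan_type X d" using has_jordan_type_exists[OF assms(2)] by blast
    then have "X \<in> closure {X :: 'n cmat. has_jordan_type X d}" by (simp add: closure_subset[THEN subsetD])
    moreover have "closure {X :: 'n cmat. has_jordan_type X d} \<subseteq> closure {Y. has_jordan_type Y lam}"
      using that unfolding orbit_le_def nilpotent_orbit_eq[OF assms(1)] nilpotent_orbit_eq[OF assms(2)] .
    ultimately have "X \<in> closure {Y :: 'n cmat. has_jordan_type Y lam}" by (rule rev_subsetD)
    from card_kernel_index_le_of_closure[OF assms this X] show ?thesis by (simp add: card_kernel_index)
  qed
  have pos: "1 \<le> borel_dim_GL xs" if "is_partition CARD('n) xs" for xs
  proof -
    have "xs \<noteq> []" using that by (auto simp: is_partition_def)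
    then obtain l where "length xs = Suc l" by (cases xs) auto
    then show ?thesis by (simp add: borel_dim_GL_def)
  qed
  note m = m_nilpotent_orbit[OF assms(1)] m_nilpotent_orbit[OF assms(2)]
  show ?thesis
  proof (intro conjI impI)
    assume "orbit_le (nilpotent_orbit d :: 'n cmat set) (nilpotent_orbit lam)"
    from borel_dim_GL_dominance(1)[OF assms dom[OF this]]
    show "m_orbit (nilpotent_orbit d :: 'n cmat set) \<le> m_orbit (nilpotent_orbit lam :: 'n cmat set)"
      unfolding m by simp
  next
    assume less: "orbit_less (nilpotent_orbit d :: 'n cmat set) (nilpotent_orbit lam)"
    then have le: "orbit_le (nilpotent_orbit d :: 'n cmat set) (nilpotent_orbit lam)" and "lam \<noteq> d"
      by (auto simp: orbit_less_def orbit_le_def)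
    from borel_dim_GL_dominance(2)[OF assms dom[OF le] this(2)] pos[OF assms(1)]
    show "m_orbit (nilpotent_orbit d :: 'n cmat set) < m_orbit (nilpotent_orbit lam :: 'n cmat set)"
      unfolding m by simp
  qed
qed

end
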